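(* Let $\bar i\in I_\sigma$. The inductive limit $V_{\bar i}^\infty$ of the Kirillov–Reshetikhin modules $L(M_k)$, $k\ge1$, has a $\mathcal U_q(\mathfrak b^\sigma)$-module structure in which $e^+_{\bar j}$, $k_{\bar j}$ ($\bar j\in I_\sigma$) and $e^+_\epsilon$ act by the operators $\tilde e_{\bar j}$, $\tilde k_{\bar j}$ and $\tilde e_\epsilon$, respectively.
   Context: Twisted data. $\mathfrak g$ is a simple complex Lie algebra of type $A_m$ ($m\ge2$), $D_m$ ($m\ge4$) or $E_6$ with Dynkin nodes $I$ and Cartan matrix $C$; $\sigma:I\to I$ is a non-trivial diagram automorphism of order $M\in\{2,3\}$; $\omega=e^{2\pi\sqrt{-1}/M}$. $I_\sigma$ is the set of $\sigma$-orbits, $\bar i$ the orbit of $i$; in each orbit a representative is fixed, the smallest node in the standard labelling ($1,\dots,n$ for $A_{2n}^{(2)},A_{2n-1}^{(2)},D_{n+1}^{(2)}$; $1$ and the trivalent node $2$ for $D_4^{(3)}$; in all cases a connected subdiagram); given $\bar i$, $i$ is this representative. $N_i=M$ if $\sigma(i)=i$, $N_i=1$ otherwise; $d_{\bar i}=\frac12\sum_{r=1}^MC_{i,\sigma^r(i)}$. $\hat I_\sigma=I_\sigma\sqcup\{\epsilon\}$; $C^\sigma$ is the generalized Cartan matrix of the twisted affine type, $\epsilon$ the affine node (for $A_{2n}^{(2)}$ the end node with longest root), so $d_{\bar i}C^\sigma_{\bar i,\bar j}=\sum_{r=1}^MC_{i,\sigma^r(j)}$ on $I_\sigma$; $d_\epsilon$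 makes $(d_iC^\sigma_{i,j})$ symmetric; $(a_i)_{i\in\hat I_\sigma}$ are the positive integers with $\sum_ia_id_iC^\sigma_{i,j}=0$ for all $j$, $a_\epsilon=1$. $q\in\mathbb C^*$ is not a root of unity (with a fixed square root), $q_i=q^{d_i}$, $[m]_p=\frac{p^m-p^{-m}}{p-p^{-1}}$. Algebra. $\mathcal U_q(\mathcal L\mathfrak g^\sigma)$ has generators $e_i^\pm,k_i^{\pm1}$ ($i\in\hat I_\sigma$) and relations: the $k_i$ are invertible and commute, $k_ie_j^\pm=q_i^{\pm C^\sigma_{i,j}}e_j^\pm k_i$, $[e_i^+,e_j^-]=\delta_{i,j}\frac{k_i-k_i^{-1}}{q_i-q_i^{-1}}$, the quantum Serre relations of $C^\sigma$, and $\prod_ik_i^{a_i}=1$. Coproduct: $\Delta(k_i)=k_i\otimes k_i$, $\Delta(e_i^+)=e_i^+\otimes1+k_i\otimes e_i^+$, $\Delta(e_i^-)=e_i^-\otimes k_i^{-1}+1\otimes e_i^-$. It is also generated by the Drinfeld generators $x_{i,m}^\pm$ ($m\in\mathbb Z$), $h_{i,r}$ ($r\neq0$), $k_i^{\pm1}$, $i\in I$, of its Drinfeld presentation (Chari–Pressley, Damiani), where $x_{i,0}^\pm=e_{\bar i}^\pm$, $k_i=k_{\bar i}$ for representatives $i$, $e_\epsilon^\pm$ has degree $\pm1$ for the grading $\deg x_{i,m}^\pm=m,\deg h_{i,r}=r,\deg k_i=0$, and $x_{\sigma(i),m}^\pm=\omega^mx_{i,m}^\pm$, $h_{\sigma(i),r}=\omega^rh_{i,r}$,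 $k_{\sigma(i)}=k_i$, the $h$'s and $k$'s commute, $k_ix_{j,m}^\pm=q^{\pm\sum_{r=1}^MC_{i,\sigma^r(j)}}x_{j,m}^\pm k_i$, $[h_{i,s},x_{j,l}^\pm]=\pm\frac1s\left(\sum_{r=1}^M[sC_{i,\sigma^r(j)}/d_{\bar i}]_{q_{\bar i}}\omega^{sr}\right)x_{j,s+l}^\pm$, $[x_{i,s}^+,x_{j,l}^-]=\frac{\sum_{r=1}^M\delta_{\sigma^r(i),j}\omega^{rl}}{N_i}\frac{\phi_{i,s+l}^+-\phi_{i,s+l}^-}{q_{\bar i}-q_{\bar i}^{-1}}$, and $\phi_i^\pm(u)=\sum_{m\ge0}\phi^\pm_{i,\pm m}u^{\pm m}=k_i^{\pm1}\exp(\pm(q_{\bar i}-q_{\bar i}^{-1})\sum_{l\ge1}h_{i,\pm l}u^{\pm l})$ (other $\phi^\pm_{i,m}$ are $0$). $\mathcal U_q(\mathfrak b^\sigma)$ is the subalgebra generated by $e_j^+,k_j^{\pm1}$ ($j\in\hat I_\sigma$); note $k_\epsilon=\prod_{\bar j\in I_\sigma}k_{\bar j}^{-a_{\bar j}}$. Kirillov–Reshetikhin modules. For $b\in\mathbb C^*$ let $Z_{\bar i,b}$ be the tuple of rational functions $(Z_j(u))_{j\in I}$ with: if $\sigma(i)\ne i$, $Z_{\sigma^r(i)}=q\frac{1-b\omega^rq^{-1}u}{1-b\omega^rqu}$; if $\sigma(i)=i$, $Z_i=q^M\frac{1-b^Mq^{-M}u^M}{1-b^Mq^Mu^M}$; $Z_j=1$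 for $j\notin\bar i$. For a product (componentwise) $\mathbf m$ of such tuples, $L(\mathbf m)$ is the simple finite-dimensional $\mathcal U_q(\mathcal L\mathfrak g^\sigma)$-module generated by a (highest $l$-weight) vector $v$ with $x^+_{j,m}v=0$ ($m\in\mathbb Z$) and $\phi_j^\pm(u)v=\mathbf m_j(u)v$ (expansions at $0$, resp. $\infty$). Fix $\bar i$. Put $M_k=Z_{\bar i,q^{-1}}Z_{\bar i,q^{-3}}\cdots Z_{\bar i,q^{-2k+1}}$, and for $l<k$, $M_{l,k}=Z_{\bar i,q^{-2l-1}}\cdots Z_{\bar i,q^{-2k+1}}$. For $j\in I$ write $j=\sigma^s(j_0)$ with $j_0$ the representative and $Z_{j,b}=Z_{\bar j,b\omega^s}$; $A_{\bar j,b}=Z_{j,bq}Z_{j,bq^{-1}}\prod_{j':C_{j,j'}=-1}Z_{j',b}^{-1}$ for a representative $j$. $L(M_k)_{\ge-2l+1}$ is the sum of the $l$-weight spaces (generalized common eigenspaces of the $\phi^\pm_{j,m}$) whose $l$-weight is $M_k$ times a product of $A_{\bar j,q^n\omega^m}^{-1}$ with $\bar j\in I_\sigma$, $m\in\mathbb Z$, $n\ge-2l+2$. For $l<k$ let $v'$ be a highest $l$-weight vector of $L(M_{l,k})$; there is a non-zero $\mathcal U_q(\mathcal L\mathfrak g^\sigma)$-morphism $L(M_l)\otimes L(M_{l,k})\to L(M_{l,k})\otimes L(M_l)$ (intertwining operator) whose image is simple and isomorphic to $L(M_k)$, and its restriction to $L(M_l)\otimes v'$ is a linear isomorphism $\varphi_{l,k}:L(M_l)\to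 L(M_k)_{\ge-2l+1}$, normalized to send a fixed highest $l$-weight vector to a fixed highest $l$-weight vector; $\varphi_{k,k}=\mathrm{id}$. $V_{\bar i}^\infty$ is the inductive limit of vector spaces of $(L(M_k),\varphi_{l,k})$. Operators on $V_{\bar i}^\infty$. $\tilde e_{\bar j}$ is induced by $x^+_{j,0}$ on the $L(M_l)$ ($j$ the representative; these commute with the $\varphi_{l,k}$). $\tilde k_{\bar j}$ is induced by $k_j$ on the $L(M_l)$ if $\bar j\ne\bar i$ and by $q^{-lN_i}k_i$ on $L(M_l)$ if $\bar j=\bar i$. $\tilde e_\epsilon$: for each $l$ there are $N\ge0$ and finitely many operators $C_l,D_l,\dots,E_l\in\mathrm{Hom}(L(M_l),L(M_{l+N}))$, independent of $k$, such that for all $k\ge l+N$ one has $e^+_\epsilon\varphi_{l,k}(L(M_l))\subset\varphi_{l+N,k}(L(M_{l+N}))$ and $\varphi_{l+N,k}^{-1}e^+_\epsilon\varphi_{l,k}=C_l+q^{-2k}D_l+\cdots+q^{-2kN}E_l$ (a polynomial in $q^{-2k}$); the constant terms $C_l$ are compatible with the $\varphi_{l,k}$ and define $\tilde e_\epsilon$ on $V_{\bar i}^\infty$. *)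

theory Defs
  imports
    "HOL-Library.Poly_Mapping"
    "HOL-Library.Function_Algebras"
    "HOL-Complex_Analysis.Laurent_Convergence"
begin

section \<open>Complex vector spaces and complex algebras\<close>

class complex_vector = ab_group_add +
  fixes scaleC :: "complex \<Rightarrow> 'a \<Rightarrow> 'a" (infixr \<open>*\<^sub>C\<close> 75)
  assumes scaleC_add_right: "c *\<^sub>C (x + y) = c *\<^sub>C x + c *\<^sub>C y"
    and scaleC_add_left: "(c + d) *\<^sub>C x = c *\<^sub>C x + d *\<^sub>C x"
    and scaleC_scaleC: "c *\<^sub>C d *\<^sub>C x = (c * d) *\<^sub>C x"
    and scaleC_one: "1 *\<^sub>C x = x"

class complex_algebra_1 = complex_vector + ring_1 +
  assumes mult_scaleC_left: "(c *\<^sub>C x) * y = c *\<^sub>C (x * y)"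
    and mult_scaleC_right: "x * (c *\<^sub>C y) = c *\<^sub>C (x * y)"

instantiation complex :: complex_algebra_1
begin
definition scaleC_complex :: "complex \<Rightarrow> complex \<Rightarrow> complex" where "scaleC_complex = (*)"
instance by standard (simp_all add: scaleC_complex_def algebra_simps)
end

instantiation "fun" :: (type, complex_vector) complex_vector
begin
definition scaleC_fun :: "complex \<Rightarrow> ('a \<Rightarrow> 'b) \<Rightarrow> 'a \<Rightarrow> 'b" where
  "scaleC_fun c f = (\<lambda>x. c *\<^sub>C f x)"
instance
  by standard (auto simp: scaleC_fun_def fun_eq_iff scaleC_add_right scaleC_add_left
      scaleC_scaleC scaleC_one)
end

global_interpretation cv: vector_space "scaleC :: complex \<Rightarrow> 'a \<Rightarrow> 'a::complex_vector"
  by unfold_locales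
    (simp_all add: scaleC_add_right scaleC_add_left scaleC_scaleC scaleC_one)

definition linear_on :: "'a::complex_vector set \<Rightarrow> 'b::complex_vector set \<Rightarrow> ('a \<Rightarrow> 'b) \<Rightarrow> bool" where
  "linear_on V W f \<longleftrightarrow>
     (\<forall>x\<in>V. f x \<in> W) \<and> (\<forall>x\<in>V. \<forall>y\<in>V. f (x + y) = f x + f y) \<and> (\<forall>c. \<forall>x\<in>V. f (c *\<^sub>C x) = c *\<^sub>C f x)"

definition is_subalgebra :: "'u::complex_algebra_1 set \<Rightarrow> bool" where
  "is_subalgebra A \<longleftrightarrow> cv.subspace A \<and> 1 \<in> A \<and> (\<forall>x\<in>A. \<forall>y\<in>A. x * y \<in> A)"

definition gen_subalgebra :: "'u::complex_algebra_1 set \<Rightarrow> 'u set" where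
  "gen_subalgebra S = \<Inter> {A. is_subalgebra A \<and> S \<subseteq> A}"

definition is_grading :: "(int \<Rightarrow> 'u::complex_algebra_1 set) \<Rightarrow> bool" where
  "is_grading G \<longleftrightarrow>
     (\<forall>n. cv.subspace (G n)) \<and> 1 \<in> G 0 \<and>
     (\<forall>m n. \<forall>x\<in>G m. \<forall>y\<in>G n. x * y \<in> G (m + n)) \<and>
     (\<forall>x. \<exists>!f. finite {n. f n \<noteq> 0} \<and> (\<forall>n. f n \<in> G n) \<and> x = (\<Sum>n | f n \<noteq> 0. f n))"


section \<open>Algebras given by generators and relations\<close>

text \<open>The free algebra on a type of letters is the monoid algebra of the free monoid of words.\<close>

datatype 'a word = Word (letters: "'a list")

instantiation word :: (type) monoid_add
begin
definition zero_word :: "'a word" where "zero_word = Word []"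
definition plus_word :: "'a word \<Rightarrow> 'a word \<Rightarrow> 'a word" where
  "plus_word v w = Word (letters v @ letters w)"
instance by standard (simp_all add: zero_word_def plus_word_def)
end

type_synonym 'a free_alg = "'a word \<Rightarrow>\<^sub>0 complex"

definition free_var :: "'a \<Rightarrow> 'a free_alg" where
  "free_var s = Poly_Mapping.single (Word [s]) 1"

definition free_const :: "complex \<Rightarrow> 'a free_alg" where
  "free_const c = Poly_Mapping.single 0 c"

definition free_on :: "'a set \<Rightarrow> 'a free_alg set" where
  "free_on S = {p. \<forall>w \<in> Poly_Mapping.keys p. set (letters w) \<subseteq> S}"

definition free_eval :: "('a \<Rightarrow> 'u::complex_algebra_1) \<Rightarrow> 'a free_alg \<Rightarrow> 'u" where
  "free_eval g p =
     (\<Sum>w \<in> Poly_Mapping.keys p. Poly_Mapping.lookup p w *\<^sub>C prod_list (map g (letters w)))"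

text \<open>The two-sided ideal of the ring \<open>A\<close> generated by \<open>R \<subseteq> A\<close>.\<close>

definition ideal_in :: "'r::ring_1 set \<Rightarrow> 'r set \<Rightarrow> 'r set" where
  "ideal_in A R = \<Inter> {J. R \<subseteq> J \<and> 0 \<in> J \<and> (\<forall>x\<in>J. \<forall>y\<in>J. x + y \<in> J) \<and>
                          (\<forall>b\<in>A. \<forall>x\<in>J. b * x \<in> J \<and> x * b \<in> J)}"

text \<open>The algebra \<open>'u\<close> is the one presented by the generators \<open>S\<close> (with images given by \<open>g\<close>)
  and the relators \<open>R\<close>, i.e. \<open>g\<close> induces an isomorphism from free algebra modulo ideal.\<close>

definition presented_by :: "'a set \<Rightarrow> 'a free_alg set \<Rightarrow> ('a \<Rightarrow> 'u::complex_algebra_1) \<Rightarrow> bool" where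
  "presented_by S R g \<longleftrightarrow>
     free_eval g ` free_on S = UNIV \<and>
     {p \<in> free_on S. free_eval g p = 0} = ideal_in (free_on S) R"


section \<open>Twisted data\<close>

datatype dynkin = TypeA nat | TypeD nat | TypeE6

fun nodes_of :: "dynkin \<Rightarrow> nat set" where
  "nodes_of (TypeA m) = {1..m}"
| "nodes_of (TypeD m) = {1..m}"
| "nodes_of TypeE6 = {1..6}"

fun adj :: "dynkin \<Rightarrow> nat \<Rightarrow> nat \<Rightarrow> bool" where
  "adj (TypeA m) i j \<longleftrightarrow> j = i + 1 \<or> i = j + 1"
| "adj (TypeD m) i j \<longleftrightarrow>
     {i, j} = {m - 2, m} \<or> (i < m \<and> j < m \<and> (j = i + 1 \<or> i = j + 1))"
| "adj TypeE6 i j \<longleftrightarrow> {i, j} \<in> {{1, 3}, {3, 4}, {4, 5}, {5, 6}, {2, 4}}"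

definition cartan :: "dynkin \<Rightarrow> nat \<Rightarrow> nat \<Rightarrow> int" where
  "cartan X i j = (if i = j then 2 else if adj X i j then -1 else 0)"

text \<open>The last component is the fixed square root of \<open>q\<close>.\<close>

record twisted =
  dyn :: dynkin
  aut :: "nat \<Rightarrow> nat"
  sqrt_q :: complex

abbreviation nodes :: "twisted \<Rightarrow> nat set" where
  "nodes T \<equiv> nodes_of (dyn T)"

abbreviation qq :: "twisted \<Rightarrow> complex" where
  "qq T \<equiv> (sqrt_q T) ^ 2"

definition ord_aut :: "twisted \<Rightarrow> nat" where
  "ord_aut T = (LEAST r. r > 0 \<and> (\<forall>i\<in>nodes T. (aut T ^^ r) i = i))"

definition omega :: "twisted \<Rightarrow> complex" where
  "omega T = exp (2 * pi * \<i> / of_nat (ord_aut T))"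

definition is_twisted :: "twisted \<Rightarrow> bool" where
  "is_twisted T \<longleftrightarrow>
     (case dyn T of TypeA m \<Rightarrow> m \<ge> 2 | TypeD m \<Rightarrow> m \<ge> 4 | TypeE6 \<Rightarrow> True) \<and>
     bij_betw (aut T) (nodes T) (nodes T) \<and>
     (\<forall>i\<in>nodes T. \<forall>j\<in>nodes T. cartan (dyn T) (aut T i) (aut T j) = cartan (dyn T) i j) \<and>
     (\<exists>i\<in>nodes T. aut T i \<noteq> i) \<and> ord_aut T \<in> {2, 3} \<and>
     sqrt_q T \<noteq> 0 \<and> (\<forall>n>0. qq T ^ n \<noteq> 1)"

text \<open>An orbit is encoded by its smallest node, so that \<open>I\<^sub>\<sigma>\<close> becomes the set \<open>Isig\<close> of
  representatives; the affine node \<open>\<epsilon>\<close> is encoded by \<open>0\<close>, which is not a node.\<close>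

definition rep :: "twisted \<Rightarrow> nat \<Rightarrow> nat" where
  "rep T j = (LEAST i. \<exists>r. i = (aut T ^^ r) j)"

definition shift :: "twisted \<Rightarrow> nat \<Rightarrow> nat" where
  "shift T j = (LEAST s. j = (aut T ^^ s) (rep T j))"

definition Isig :: "twisted \<Rightarrow> nat set" where
  "Isig T = rep T ` nodes T"

abbreviation (input) eps :: nat where "eps \<equiv> 0"

definition hatI :: "twisted \<Rightarrow> nat set" where
  "hatI T = insert eps (Isig T)"

definition NN :: "twisted \<Rightarrow> nat \<Rightarrow> nat" where
  "NN T i = (if aut T i = i then ord_aut T else 1)"

definition cartan_sum :: "twisted \<Rightarrow> nat \<Rightarrow> nat \<Rightarrow> int" where
  "cartan_sum T i j = (\<Sum>r=1..ord_aut T. cartan (dyn T) i ((aut T ^^ r) j))"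

text \<open>The affine type is \<open>A\<^sub>m\<^sup>(\<^sup>2\<^sup>)\<close>, \<open>D\<^sub>m\<^sup>(\<^sup>2\<^sup>)\<close>, \<open>D\<^sub>4\<^sup>(\<^sup>3\<^sup>)\<close> or \<open>E\<^sub>6\<^sup>(\<^sup>2\<^sup>)\<close>, and the affine node has exactly
  one neighbour. For \<open>D\<^sub>m\<^sup>(\<^sup>2\<^sup>)\<close> this neighbour is the fixed end node of the Dynkin diagram: node
  \<open>1\<close> if \<open>\<sigma>\<close> exchanges \<open>m - 1\<close> and \<open>m\<close>; for \<open>m = 4\<close> the definition also covers the involutions
  exchanging two other end nodes.\<close>

definition eps_nb :: "twisted \<Rightarrow> nat" where
  "eps_nb T = (case dyn T of
      TypeA m \<Rightarrow> (if even m then 1 else 2)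
    | TypeD m \<Rightarrow> (if ord_aut T = 3 then 1
                  else (LEAST j. j \<in> nodes T \<and> aut T j = j \<and> card {i \<in> nodes T. adj (dyn T) j i} = 1))
    | TypeE6 \<Rightarrow> 1)"

text \<open>\<open>eps_entries T = (C\<^sup>\<sigma>(\<epsilon>, j), C\<^sup>\<sigma>(j, \<epsilon>))\<close> for the neighbour \<open>j\<close> of \<open>\<epsilon>\<close>.\<close>

definition eps_entries :: "twisted \<Rightarrow> int \<times> int" where
  "eps_entries T = (case dyn T of
      TypeA m \<Rightarrow> (if even m then (-1, if m = 2 then -4 else -2)
                  else (if m = 3 then -2 else -1, -1))
    | TypeD m \<Rightarrow> (if ord_aut T = 3 then (-1, -1) else (-2, -1))
    | TypeE6 \<Rightarrow> (-1, -1))"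

definition dd :: "twisted \<Rightarrow> nat \<Rightarrow> rat" where
  "dd T i = (if i = eps then (case dyn T of TypeA m \<Rightarrow> (if even m then 2 else 1) | _ \<Rightarrow> 1)
             else of_int (cartan_sum T i i) / 2)"

text \<open>On \<open>I\<^sub>\<sigma>\<close> the entries are \<open>cartan_sum T i j / d\<^sub>i\<close>; the division below is exact.\<close>

definition Csig :: "twisted \<Rightarrow> nat \<Rightarrow> nat \<Rightarrow> int" where
  "Csig T i j =
     (if i = eps \<and> j = eps then 2
      else if i = eps then (if j = eps_nb T then fst (eps_entries T) else 0)
      else if j = eps then (if i = eps_nb T then snd (eps_entries T) else 0)
      else (2 * cartan_sum T i j) div cartan_sum T i i)"

definition is_marks :: "twisted \<Rightarrow> (nat \<Rightarrow> nat) \<Rightarrow> bool" where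
  "is_marks T a \<longleftrightarrow> a eps = 1 \<and> (\<forall>i\<in>hatI T. a i > 0) \<and>
     (\<forall>j\<in>hatI T. (\<Sum>i\<in>hatI T. of_nat (a i) * dd T i * of_int (Csig T i j)) = 0)"

text \<open>\<open>qpow T r = q\<^sup>r\<close> for half-integers \<open>r\<close>.\<close>

definition qpow :: "twisted \<Rightarrow> rat \<Rightarrow> complex" where
  "qpow T r = sqrt_q T powi \<lfloor>2 * r\<rfloor>"

definition qi :: "twisted \<Rightarrow> nat \<Rightarrow> complex" where
  "qi T i = qpow T (dd T i)"

text \<open>\<open>qint T d x\<close> is the number \<open>[x]\<close> in base \<open>p = q\<^sup>d\<close>; it is used for rational \<open>x\<close> with \<open>d x\<close> a
  half-integer, and \<open>p\<^sup>x\<close> means \<open>q\<^sup>d\<^sup>x\<close>.\<close>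

definition qint :: "twisted \<Rightarrow> rat \<Rightarrow> rat \<Rightarrow> complex" where
  "qint T d x = (qpow T (d * x) - qpow T (- d * x)) / (qpow T d - qpow T (- d))"

definition qfact :: "twisted \<Rightarrow> rat \<Rightarrow> nat \<Rightarrow> complex" where
  "qfact T d n = (\<Prod>m=1..n. qint T d (of_nat m))"

definition qbinom :: "twisted \<Rightarrow> rat \<Rightarrow> nat \<Rightarrow> nat \<Rightarrow> complex" where
  "qbinom T d n s = qfact T d n / (qfact T d s * qfact T d (n - s))"


section \<open>The quantum loop algebra\<close>

datatype sign = Plus | Minus

fun sg :: "sign \<Rightarrow> int" where "sg Plus = 1" | "sg Minus = -1"

text \<open>\<open>K Minus i\<close> is the inverse of \<open>k\<^sub>i = K Plus i\<close>.\<close>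

datatype gen = E sign nat | K sign nat

abbreviation Ev :: "sign \<Rightarrow> nat \<Rightarrow> gen free_alg" where "Ev s i \<equiv> free_var (E s i)"
abbreviation Kv :: "sign \<Rightarrow> nat \<Rightarrow> gen free_alg" where "Kv s i \<equiv> free_var (K s i)"

definition gens :: "twisted \<Rightarrow> gen set" where
  "gens T = (\<Union>s. \<Union>i\<in>hatI T. {E s i, K s i})"

definition serre :: "twisted \<Rightarrow> sign \<Rightarrow> nat \<Rightarrow> nat \<Rightarrow> gen free_alg" where
  "serre T s i j =
     (let n = nat (1 - Csig T i j) in
      \<Sum>r\<le>n. free_const ((-1) ^ r * qbinom T (dd T i) n r) * Ev s i ^ (n - r) * Ev s j * Ev s i ^ r)"

definition relators :: "twisted \<Rightarrow> (nat \<Rightarrow> nat) \<Rightarrow> gen free_alg set" where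
  "relators T a =
     {Kv Plus i * Kv Minus i - 1 | i. i \<in> hatI T} \<union>
     {Kv Minus i * Kv Plus i - 1 | i. i \<in> hatI T} \<union>
     {Kv Plus i * Kv Plus j - Kv Plus j * Kv Plus i | i j. i \<in> hatI T \<and> j \<in> hatI T} \<union>
     {Kv Plus i * Ev s j - free_const (qi T i powi (sg s * Csig T i j)) * Ev s j * Kv Plus i
       | s i j. i \<in> hatI T \<and> j \<in> hatI T} \<union>
     {Ev Plus i * Ev Minus j - Ev Minus j * Ev Plus i -
        (if i = j then free_const (1 / (qi T i - 1 / qi T i)) * (Kv Plus i - Kv Minus i) else 0)
       | i j. i \<in> hatI T \<and> j \<in> hatI T} \<union>
     {serre T s i j | s i j. i \<in> hatI T \<and> j \<in> hatI T \<and> i \<noteq> j} \<union>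
     {prod_list (map (\<lambda>i. Kv Plus i ^ a i) (sorted_list_of_set (hatI T))) - 1}"

definition is_Uq :: "twisted \<Rightarrow> (nat \<Rightarrow> nat) \<Rightarrow> (gen \<Rightarrow> 'u::complex_algebra_1) \<Rightarrow> bool" where
  "is_Uq T a g \<longleftrightarrow> presented_by (gens T) (relators T a) g"

definition Uq_borel :: "twisted \<Rightarrow> (gen \<Rightarrow> 'u::complex_algebra_1) \<Rightarrow> 'u set" where
  "Uq_borel T g =
     gen_subalgebra (\<Union>j\<in>hatI T. {g (E Plus j), g (K Plus j), g (K Minus j)})"


section \<open>Drinfeld generators\<close>

definition fps_exp_nth :: "'u::complex_algebra_1 fps \<Rightarrow> nat \<Rightarrow> 'u" where
  "fps_exp_nth H m = (\<Sum>n\<le>m. (1 / fact n) *\<^sub>C fps_nth (H ^ n) m)"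

text \<open>\<open>fps_exp_nth H m\<close> is the coefficient of \<open>u\<^sup>m\<close> in \<open>exp H\<close> for \<open>H\<close> without constant term.
  \<open>phi T g h s j m\<close> is the coefficient of \<open>u\<^sup>m\<close> in \<open>\<phi>\<^sub>j\<^sup>\<plusminus>(u)\<close>, a series in \<open>u\<^sup>\<plusminus>\<^sup>1\<close>.\<close>

definition phi ::
  "twisted \<Rightarrow> (gen \<Rightarrow> 'u::complex_algebra_1) \<Rightarrow> (nat \<Rightarrow> int \<Rightarrow> 'u) \<Rightarrow> sign \<Rightarrow> nat \<Rightarrow> int \<Rightarrow> 'u" where
  "phi T g h s j m =
     (if sg s * m < 0 then 0
      else g (K s (rep T j)) *
           fps_exp_nth
             (Abs_fps (\<lambda>l. if l = 0 then 0
                else (of_int (sg s) * (qi T (rep T j) - 1 / qi T (rep T j))) *\<^sub>C h j (sg s * int l)))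
             (nat (sg s * m)))"

text \<open>\<open>x s i m\<close> stands for \<open>x\<^sub>i\<^sub>,\<^sub>m\<^sup>\<plusminus>\<close>, and \<open>k\<^sub>i\<close> for a node \<open>i\<close> is \<open>g (K Plus (rep T i))\<close>. Only the
  values \<open>h i r\<close> with \<open>r \<noteq> 0\<close> are meaningful.\<close>

definition is_drinfeld ::
  "twisted \<Rightarrow> (gen \<Rightarrow> 'u::complex_algebra_1) \<Rightarrow> (sign \<Rightarrow> nat \<Rightarrow> int \<Rightarrow> 'u) \<Rightarrow> (nat \<Rightarrow> int \<Rightarrow> 'u) \<Rightarrow> bool" where
  "is_drinfeld T g x h \<longleftrightarrow>
     gen_subalgebra
       ({x s i m | s i m. i \<in> nodes T} \<union> {h i r | i r. i \<in> nodes T \<and> r \<noteq> 0} \<union>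
        {g (K s i) | s i. i \<in> Isig T}) = UNIV \<and>
     (\<forall>s. \<forall>i\<in>Isig T. x s i 0 = g (E s i)) \<and>
     (\<exists>G. is_grading G \<and>
        (\<forall>s. \<forall>i\<in>nodes T. \<forall>m. x s i m \<in> G m) \<and>
        (\<forall>i\<in>nodes T. \<forall>r. r \<noteq> 0 \<longrightarrow> h i r \<in> G r) \<and>
        (\<forall>s. \<forall>i\<in>Isig T. g (K s i) \<in> G 0) \<and>
        (\<forall>s. g (E s eps) \<in> G (sg s))) \<and>
     (\<forall>s. \<forall>i\<in>nodes T. \<forall>m. x s (aut T i) m = (omega T powi m) *\<^sub>C x s i m) \<and>
     (\<forall>i\<in>nodes T. \<forall>r. r \<noteq> 0 \<longrightarrow> h (aut T i) r = (omega T powi r) *\<^sub>C h i r) \<and>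
     (\<forall>i\<in>nodes T. \<forall>j\<in>nodes T. \<forall>r t. r \<noteq> 0 \<longrightarrow> t \<noteq> 0 \<longrightarrow> h i r * h j t = h j t * h i r) \<and>
     (\<forall>i\<in>nodes T. \<forall>j\<in>Isig T. \<forall>r. r \<noteq> 0 \<longrightarrow> h i r * g (K Plus j) = g (K Plus j) * h i r) \<and>
     (\<forall>s. \<forall>i\<in>nodes T. \<forall>j\<in>nodes T. \<forall>m.
        g (K Plus (rep T i)) * x s j m =
        (qq T powi (sg s * cartan_sum T i j)) *\<^sub>C (x s j m * g (K Plus (rep T i)))) \<and>
     (\<forall>s. \<forall>i\<in>nodes T. \<forall>j\<in>nodes T. \<forall>r l. r \<noteq> 0 \<longrightarrow>
        h i r * x s j l - x s j l * h i r =
        (of_int (sg s) * (1 / of_int r) *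
          (\<Sum>t=1..ord_aut T.
             qint T (dd T (rep T i))
               (of_int (r * cartan (dyn T) i ((aut T ^^ t) j)) / dd T (rep T i)) *
             omega T powi (r * int t))) *\<^sub>C x s j (r + l)) \<and>
     (\<forall>i\<in>nodes T. \<forall>j\<in>nodes T. \<forall>r l.
        x Plus i r * x Minus j l - x Minus j l * x Plus i r =
        ((\<Sum>t=1..ord_aut T. if (aut T ^^ t) i = j then omega T powi (int t * l) else 0) /
           of_nat (NN T i) / (qi T (rep T i) - 1 / qi T (rep T i))) *\<^sub>C
        (phi T g h Plus i (r + l) - phi T g h Minus i (r + l)))"


section \<open>Modules\<close>

text \<open>All vector spaces are linear subspaces of some type of class \<open>complex_vector\<close>.\<close>

definition is_module ::
  "'u::complex_algebra_1 set \<Rightarrow> 'v::complex_vector set \<Rightarrow> ('u \<Rightarrow> 'v \<Rightarrow> 'v) \<Rightarrow> bool" where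
  "is_module A V \<rho> \<longleftrightarrow> cv.subspace V \<and>
     (\<forall>b\<in>A. linear_on V V (\<rho> b)) \<and>
     (\<forall>v\<in>V. \<rho> 1 v = v) \<and>
     (\<forall>b\<in>A. \<forall>c\<in>A. \<forall>v\<in>V. \<rho> (b + c) v = \<rho> b v + \<rho> c v \<and> \<rho> (b * c) v = \<rho> b (\<rho> c v)) \<and>
     (\<forall>z. \<forall>b\<in>A. \<forall>v\<in>V. \<rho> (z *\<^sub>C b) v = z *\<^sub>C \<rho> b v)"

definition is_simple :: "'v::complex_vector set \<Rightarrow> ('u::complex_algebra_1 \<Rightarrow> 'v \<Rightarrow> 'v) \<Rightarrow> bool" where
  "is_simple V \<rho> \<longleftrightarrow> is_module UNIV V \<rho> \<and> V \<noteq> {0} \<and>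
     (\<forall>W. cv.subspace W \<and> W \<subseteq> V \<and> (\<forall>b. \<forall>w\<in>W. \<rho> b w \<in> W) \<longrightarrow> W = {0} \<or> W = V)"

definition is_hom ::
  "'v::complex_vector set \<Rightarrow> ('u::complex_algebra_1 \<Rightarrow> 'v \<Rightarrow> 'v) \<Rightarrow>
   'w::complex_vector set \<Rightarrow> ('u \<Rightarrow> 'w \<Rightarrow> 'w) \<Rightarrow> ('v \<Rightarrow> 'w) \<Rightarrow> bool" where
  "is_hom V \<rho> W \<tau> f \<longleftrightarrow> linear_on V W f \<and> (\<forall>b. \<forall>v\<in>V. f (\<rho> b v) = \<tau> b (f v))"

text \<open>Tensors are realized through the canonical embedding of \<open>V \<otimes> W\<close> into the dual of the space
  of bilinear forms on \<open>V \<times> W\<close>: a pure tensor is evaluation at \<open>(v, w)\<close>.\<close>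

definition bilinear_form ::
  "'v::complex_vector set \<Rightarrow> 'w::complex_vector set \<Rightarrow> ('v \<Rightarrow> 'w \<Rightarrow> complex) \<Rightarrow> bool" where
  "bilinear_form V W \<beta> \<longleftrightarrow>
     (\<forall>v\<in>V. linear_on W UNIV (\<beta> v)) \<and> (\<forall>w\<in>W. linear_on V UNIV (\<lambda>v. \<beta> v w))"

definition tens ::
  "'v::complex_vector set \<Rightarrow> 'w::complex_vector set \<Rightarrow> 'v \<Rightarrow> 'w \<Rightarrow> ('v \<Rightarrow> 'w \<Rightarrow> complex) \<Rightarrow> complex" where
  "tens V W v w = (\<lambda>\<beta>. if bilinear_form V W \<beta> then \<beta> v w else 0)"

definition tensor_space ::
  "'v::complex_vector set \<Rightarrow> 'w::complex_vector set \<Rightarrow> (('v \<Rightarrow> 'w \<Rightarrow> complex) \<Rightarrow> complex) set" where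
  "tensor_space V W = cv.span {tens V W v w | v w. v \<in> V \<and> w \<in> W}"

text \<open>The module structure \<open>\<mu>\<close> on \<open>V \<otimes> W\<close> given by the coproduct.\<close>

definition is_tensor_module ::
  "twisted \<Rightarrow> (gen \<Rightarrow> 'u::complex_algebra_1) \<Rightarrow>
   'v::complex_vector set \<Rightarrow> ('u \<Rightarrow> 'v \<Rightarrow> 'v) \<Rightarrow> 'w::complex_vector set \<Rightarrow> ('u \<Rightarrow> 'w \<Rightarrow> 'w) \<Rightarrow>
   ('u \<Rightarrow> (('v \<Rightarrow> 'w \<Rightarrow> complex) \<Rightarrow> complex) \<Rightarrow> ('v \<Rightarrow> 'w \<Rightarrow> complex) \<Rightarrow> complex) \<Rightarrow> bool" where
  "is_tensor_module T g V \<rho> W \<tau> \<mu> \<longleftrightarrow>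
     is_module UNIV (tensor_space V W) \<mu> \<and>
     (\<forall>i\<in>hatI T. \<forall>v\<in>V. \<forall>w\<in>W.
        (\<forall>s. \<mu> (g (K s i)) (tens V W v w) = tens V W (\<rho> (g (K s i)) v) (\<tau> (g (K s i)) w)) \<and>
        \<mu> (g (E Plus i)) (tens V W v w) =
          tens V W (\<rho> (g (E Plus i)) v) w + tens V W (\<rho> (g (K Plus i)) v) (\<tau> (g (E Plus i)) w) \<and>
        \<mu> (g (E Minus i)) (tens V W v w) =
          tens V W (\<rho> (g (E Minus i)) v) (\<tau> (g (K Minus i)) w) + tens V W v (\<tau> (g (E Minus i)) w))"


section \<open>Highest l-weight modules and Kirillov-Reshetikhin modules\<close>

text \<open>An l-weight is a family \<open>\<Psi> j\<close> (\<open>j\<close> a node) of rational functions, regarded as functions of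
  \<open>u\<close>; \<open>expands s f F\<close> says that \<open>F\<close> is the expansion of \<open>f\<close> at \<open>0\<close> (in powers of \<open>u\<close>) resp. at
  \<open>\<infinity>\<close> (in powers of \<open>u\<^sup>-\<^sup>1\<close>).\<close>

type_synonym lweight = "nat \<Rightarrow> complex \<Rightarrow> complex"

fun expands :: "sign \<Rightarrow> (complex \<Rightarrow> complex) \<Rightarrow> complex fps \<Rightarrow> bool" where
  "expands Plus f F \<longleftrightarrow> f has_laurent_expansion fps_to_fls F"
| "expands Minus f F \<longleftrightarrow> (\<lambda>t. f (inverse t)) has_laurent_expansion fps_to_fls F"

text \<open>\<open>Zrep T i b\<close> is the tuple attached to the orbit with representative \<open>i\<close>; \<open>Znode T j b\<close> is the
  extension of the notation to arbitrary nodes \<open>j\<close>.\<close>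

definition Zrep :: "twisted \<Rightarrow> nat \<Rightarrow> complex \<Rightarrow> lweight" where
  "Zrep T i b j u =
     (let q = qq T; M = ord_aut T; r = shift T j in
      if rep T j \<noteq> i then 1
      else if aut T i = i then q ^ M * (1 - b ^ M * q powi (- int M) * u ^ M) / (1 - b ^ M * q ^ M * u ^ M)
      else q * (1 - b * omega T ^ r * inverse q * u) / (1 - b * omega T ^ r * q * u))"

definition Znode :: "twisted \<Rightarrow> nat \<Rightarrow> complex \<Rightarrow> lweight" where
  "Znode T j b = Zrep T (rep T j) (b * omega T ^ shift T j)"

definition Alw :: "twisted \<Rightarrow> nat \<Rightarrow> complex \<Rightarrow> lweight" where
  "Alw T j b n u =
     Zrep T j (b * qq T) n u * Zrep T j (b * inverse (qq T)) n u *
     (\<Prod>j' \<in> {j' \<in> nodes T. cartan (dyn T) j j' = -1}. inverse (Znode T j' b n u))"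

text \<open>\<open>Mlw T i l k\<close> is \<open>M\<^sub>l\<^sub>,\<^sub>k\<close>, and \<open>M\<^sub>k\<close> is \<open>Mlw T i 0 k\<close>.\<close>

definition Mlw :: "twisted \<Rightarrow> nat \<Rightarrow> nat \<Rightarrow> nat \<Rightarrow> lweight" where
  "Mlw T i l k n u = (\<Prod>s\<in>{l+1..k}. Zrep T i (qq T powi (1 - 2 * int s)) n u)"

record ('u, 'v) hwmod =
  carr :: "'v set"
  act :: "'u \<Rightarrow> 'v \<Rightarrow> 'v"
  hwv :: 'v

text \<open>\<open>H\<close> is the simple module \<open>L(\<Psi>)\<close> together with a highest l-weight vector.\<close>

definition is_L ::
  "twisted \<Rightarrow> (gen \<Rightarrow> 'u::complex_algebra_1) \<Rightarrow> (sign \<Rightarrow> nat \<Rightarrow> int \<Rightarrow> 'u) \<Rightarrow> (nat \<Rightarrow> int \<Rightarrow> 'u) \<Rightarrow>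
   lweight \<Rightarrow> ('u, 'v::complex_vector) hwmod \<Rightarrow> bool" where
  "is_L T g x h \<Psi> H \<longleftrightarrow>
     is_simple (carr H) (act H) \<and> (\<exists>B. finite B \<and> carr H = cv.span B) \<and>
     hwv H \<in> carr H \<and> hwv H \<noteq> 0 \<and> carr H = range (\<lambda>b. act H b (hwv H)) \<and>
     (\<forall>j\<in>nodes T. \<forall>m. act H (x Plus j m) (hwv H) = 0) \<and>
     (\<forall>s. \<forall>j\<in>nodes T. \<exists>F. expands s (\<Psi> j) F \<and>
        (\<forall>n. act H (phi T g h s j (sg s * int n)) (hwv H) = fps_nth F n *\<^sub>C hwv H))"

definition lweight_space ::
  "twisted \<Rightarrow> (gen \<Rightarrow> 'u::complex_algebra_1) \<Rightarrow> (nat \<Rightarrow> int \<Rightarrow> 'u) \<Rightarrow>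
   ('u, 'v::complex_vector) hwmod \<Rightarrow> lweight \<Rightarrow> 'v set" where
  "lweight_space T g h H \<Psi> =
     {v \<in> carr H. \<forall>s. \<forall>j\<in>nodes T. \<exists>F. expands s (\<Psi> j) F \<and>
        (\<forall>n. \<exists>p. ((\<lambda>w. act H (phi T g h s j (sg s * int n)) w - fps_nth F n *\<^sub>C w) ^^ p) v = 0)}"

text \<open>The subspace of \<open>H = L(M\<^sub>k)\<close> denoted by \<open>L(M\<^sub>k)\<close> with subscript \<open>\<ge> -2l+1\<close>.\<close>

definition geq_part ::
  "twisted \<Rightarrow> (gen \<Rightarrow> 'u::complex_algebra_1) \<Rightarrow> (nat \<Rightarrow> int \<Rightarrow> 'u) \<Rightarrow> nat \<Rightarrow>
   ('u, 'v::complex_vector) hwmod \<Rightarrow> nat \<Rightarrow> nat \<Rightarrow> 'v set" where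
  "geq_part T g h i H l k =
     cv.span (\<Union>{lweight_space T g h H
         (\<lambda>n u. Mlw T i 0 k n u *
            prod_list (map (\<lambda>(j, r, m). inverse (Alw T j (qq T powi r * omega T powi m) n u)) xs))
       | xs :: (nat \<times> int \<times> int) list. \<forall>(j, r, m) \<in> set xs. j \<in> Isig T \<and> r \<ge> 2 - 2 * int l})"

text \<open>\<open>f\<close> is the normalized isomorphism \<open>L(M\<^sub>l) \<rightarrow> L(M\<^sub>k)\<close> obtained from an intertwining operator
  \<open>R\<close>, where \<open>H\<^sub>1 = L(M\<^sub>l)\<close>, \<open>H\<^sub>2 = L(M\<^sub>l\<^sub>,\<^sub>k)\<close>, \<open>H\<^sub>3 = L(M\<^sub>k)\<close> and \<open>\<theta>\<close> identifies the image of \<open>R\<close> with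
  \<open>L(M\<^sub>k)\<close>.\<close>

definition is_transition ::
  "twisted \<Rightarrow> (gen \<Rightarrow> 'u::complex_algebra_1) \<Rightarrow> (nat \<Rightarrow> int \<Rightarrow> 'u) \<Rightarrow> nat \<Rightarrow> nat \<Rightarrow> nat \<Rightarrow>
   ('u, 'v::complex_vector) hwmod \<Rightarrow> ('u, 'v) hwmod \<Rightarrow> ('u, 'v) hwmod \<Rightarrow> ('v \<Rightarrow> 'v) \<Rightarrow> bool" where
  "is_transition T g h i l k H1 H2 H3 f \<longleftrightarrow>
     (\<exists>\<mu> \<nu> R \<theta>.
        is_tensor_module T g (carr H1) (act H1) (carr H2) (act H2) \<mu> \<and>
        is_tensor_module T g (carr H2) (act H2) (carr H1) (act H1) \<nu> \<and>
        is_hom (tensor_space (carr H1) (carr H2)) \<mu> (tensor_space (carr H2) (carr H1)) \<nu> R \<and>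
        (\<exists>t \<in> tensor_space (carr H1) (carr H2). R t \<noteq> 0) \<and>
        is_simple (R ` tensor_space (carr H1) (carr H2)) \<nu> \<and>
        is_hom (R ` tensor_space (carr H1) (carr H2)) \<nu> (carr H3) (act H3) \<theta> \<and>
        bij_betw \<theta> (R ` tensor_space (carr H1) (carr H2)) (carr H3) \<and>
        (\<forall>v\<in>carr H1. f v = \<theta> (R (tens (carr H1) (carr H2) v (hwv H2))))) \<and>
     linear_on (carr H1) (carr H3) f \<and>
     bij_betw f (carr H1) (geq_part T g h i H3 l k) \<and>
     f (hwv H1) = hwv H3"


section \<open>Inductive limits\<close>

text \<open>Inductive systems and limits of vector spaces indexed by \<open>k \<ge> 1\<close>. In a limit, with canonical
  maps \<open>\<psi> k\<close>, every element comes from some stage, and elements of a stage vanish in the limit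
  iff they vanish at some later stage.\<close>

definition inductive_system ::
  "(nat \<Rightarrow> 'v::complex_vector set) \<Rightarrow> (nat \<Rightarrow> nat \<Rightarrow> 'v \<Rightarrow> 'v) \<Rightarrow> bool" where
  "inductive_system V \<phi> \<longleftrightarrow>
     (\<forall>l k. 1 \<le> l \<and> l \<le> k \<longrightarrow> linear_on (V l) (V k) (\<phi> l k)) \<and>
     (\<forall>k\<ge>1. \<forall>v\<in>V k. \<phi> k k v = v) \<and>
     (\<forall>l k m. 1 \<le> l \<and> l \<le> k \<and> k \<le> m \<longrightarrow> (\<forall>v\<in>V l. \<phi> k m (\<phi> l k v) = \<phi> l m v))"

definition is_inductive_limit ::
  "(nat \<Rightarrow> 'v::complex_vector set) \<Rightarrow> (nat \<Rightarrow> nat \<Rightarrow> 'v \<Rightarrow> 'v) \<Rightarrow>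
   (nat \<Rightarrow> 'v \<Rightarrow> 'w::complex_vector) \<Rightarrow> bool" where
  "is_inductive_limit V \<phi> \<psi> \<longleftrightarrow>
     (\<forall>l\<ge>1. linear_on (V l) UNIV (\<psi> l)) \<and>
     (\<forall>l k. 1 \<le> l \<and> l \<le> k \<longrightarrow> (\<forall>v\<in>V l. \<psi> k (\<phi> l k v) = \<psi> l v)) \<and>
     (\<forall>w. \<exists>l\<ge>1. \<exists>v\<in>V l. w = \<psi> l v) \<and>
     (\<forall>l\<ge>1. \<forall>v\<in>V l. \<psi> l v = 0 \<longleftrightarrow> (\<exists>k\<ge>l. \<phi> l k v = 0))"

text \<open>The operator \<open>f\<close> on the limit is induced by the family \<open>S l : V l \<rightarrow> V (l + N l)\<close>. As the
  images of the \<open>\<psi> l\<close> exhaust the limit, there is at most one such \<open>f\<close>.\<close>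

definition induced_by ::
  "(nat \<Rightarrow> 'v::complex_vector set) \<Rightarrow> (nat \<Rightarrow> 'v \<Rightarrow> 'w::complex_vector) \<Rightarrow> (nat \<Rightarrow> nat) \<Rightarrow>
   (nat \<Rightarrow> 'v \<Rightarrow> 'v) \<Rightarrow> ('w \<Rightarrow> 'w) \<Rightarrow> bool" where
  "induced_by V \<psi> N S f \<longleftrightarrow> (\<forall>l\<ge>1. \<forall>v\<in>V l. f (\<psi> l v) = \<psi> (l + N l) (S l v))"

text \<open>Polynomial dependence on \<open>q\<^sup>-\<^sup>2\<^sup>k\<close> of the action of \<open>e\<^sub>\<epsilon>\<^sup>+\<close>: the coefficient of \<open>q\<^sup>-\<^sup>2\<^sup>k\<^sup>r\<close> is
  \<open>D l r\<close>, so \<open>D l 0\<close> is the constant term. For each \<open>l\<close> the operators do not depend on \<open>k\<close>.\<close>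

definition eps_expansion ::
  "twisted \<Rightarrow> (gen \<Rightarrow> 'u::complex_algebra_1) \<Rightarrow> (nat \<Rightarrow> ('u, 'v::complex_vector) hwmod) \<Rightarrow>
   (nat \<Rightarrow> nat \<Rightarrow> 'v \<Rightarrow> 'v) \<Rightarrow> (nat \<Rightarrow> nat) \<Rightarrow> (nat \<Rightarrow> nat \<Rightarrow> 'v \<Rightarrow> 'v) \<Rightarrow> bool" where
  "eps_expansion T g L \<phi> N D \<longleftrightarrow>
     (\<forall>l\<ge>1.
        (\<forall>r\<le>N l. linear_on (carr (L l)) (carr (L (l + N l))) (D l r)) \<and>
        (\<forall>k\<ge>l + N l.
           act (L k) (g (E Plus eps)) ` \<phi> l k ` carr (L l) \<subseteq> \<phi> (l + N l) k ` carr (L (l + N l)) \<and>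
           (\<forall>v\<in>carr (L l).
              inv_into (carr (L (l + N l))) (\<phi> (l + N l) k) (act (L k) (g (E Plus eps)) (\<phi> l k v)) =
              (\<Sum>r\<le>N l. (qq T powi (- 2 * int k * int r)) *\<^sub>C D l r v))))"

end

theory Submission
  imports Defs "HOL-Combinatorics.Cycles"
begin

text \<open>On the image of \<open>L(M\<^sub>k)\<close> in the limit, the Borel part acts by operators which, after rescaling
  the \<open>k\<^sub>j\<close> by powers of \<open>q\<^sup>k\<close>, are polynomial in \<open>q\<^sup>-\<^sup>2\<^sup>k\<close>; taking constant terms is multiplicative, so the
  limit operators inherit the relations of the Borel part, which are homogeneous in the \<open>k\<^sub>j\<close>. Since
  \<open>\<U>\<^sub>q(\<bb>\<^sup>\<sigma>)\<close> is a subalgebra and not a presented algebra, it remains to see that these relations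
  imply all relations between its generators. For this a representation of the relations on a space
  \<open>V\<close> is coinduced to the full algebra, on functions from words in the \<open>e\<^sub>j\<^sup>-\<close> to \<open>V\<close>; an expression in
  the Borel generators which vanishes in the full algebra then acts as zero on \<open>V\<close>.\<close>

text \<open>On L(M_k) the eigenvalues of k_i grow like q^(k N_i). The commutator of e_i^+ and e_i^-
  contains both k_i and its inverse, and no single power of q^k rescales both; this is why the limit
  is treated for the Borel part only. Constant terms are well defined because q^(-2) is not a root
  of unity: polynomials in q^(-2k) that agree for all large k have equal coefficients. Coinduction
  stands in for the triangular decomposition. Right translation by e_i can be computed on words in
  free letters f_j from the commutators of e_i and f_j alone, and values at the empty word transform
  under the Borel generators as V does. The Serre relations of the f_j hold only on a subspace,
  which has to be invariant and has to contain enough vectors: the functions supported at the empty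
  word belong to it, since all f_j kill them. Both the Serre relations of the e_i and this
  invariance rest on the fact that a Serre element commutes with the opposite generators, and here
  the symmetrizability of the twisted Cartan matrix, including its affine node, enters.\<close>

section \<open>Evaluation of the free algebra\<close>

text \<open>The endomorphism algebra of the zero space satisfies \<open>0 = 1\<close>, hence it is not of class
  \<^class>\<open>ring_1\<close>.\<close>

class unital_algebra = complex_vector + ring + monoid_mult +
  assumes scaleC_mult_left: "(c *\<^sub>C x) * y = c *\<^sub>C (x * y)"
    and scaleC_mult_right: "x * (c *\<^sub>C y) = c *\<^sub>C (x * y)"

instance complex_algebra_1 \<subseteq> unital_algebra
  by standard (simp_all add: mult_scaleC_left mult_scaleC_right)

definition word_eval :: "('a \<Rightarrow> 'b::unital_algebra) \<Rightarrow> 'a free_alg \<Rightarrow> 'b" where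
  "word_eval g p =
     (\<Sum>w \<in> Poly_Mapping.keys p. Poly_Mapping.lookup p w *\<^sub>C prod_list (map g (letters w)))"

lemma free_eval_eq: "free_eval = word_eval"
  by (simp add: fun_eq_iff free_eval_def word_eval_def)

lemma word_eval_superset:
  assumes "finite A" "Poly_Mapping.keys p \<subseteq> A"
  shows "word_eval g p = (\<Sum>w\<in>A. Poly_Mapping.lookup p w *\<^sub>C prod_list (map g (letters w)))"
  unfolding word_eval_def
  by (rule sum.mono_neutral_left[OF assms]) (auto simp: in_keys_iff)

lemma word_eval_0 [simp]: "word_eval g 0 = 0"
  by (simp add: word_eval_def)

lemma word_eval_add: "word_eval g (p + r) = word_eval g p + word_eval g r"
proof -
  let ?A = "Poly_Mapping.keys p \<union> Poly_Mapping.keys r"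
  have "Poly_Mapping.keys (p + r) \<subseteq> ?A"
    by (rule Poly_Mapping.keys_add)
  then show ?thesis
    by (simp add: word_eval_superset[of ?A] lookup_add cv.scale_left_distrib sum.distrib)
qed

lemma word_eval_single:
  "word_eval g (Poly_Mapping.single w c) = c *\<^sub>C prod_list (map g (letters w))"
  by (cases "c = 0") (simp_all add: word_eval_def)

lemma word_eval_uminus: "word_eval g (- p) = - word_eval g p"
  using word_eval_add[of g p "- p"] by (simp add: eq_neg_iff_add_eq_0 add.commute)

lemma word_eval_diff: "word_eval g (p - r) = word_eval g p - word_eval g r"
  using word_eval_add[of g p "- r"] by (simp add: word_eval_uminus)

lemma free_alg_induct [case_names zero single add]:
  fixes p :: "'a free_alg"
  assumes "P 0" "\<And>w c. P (Poly_Mapping.single w c)" "\<And>p r. P p \<Longrightarrow> P r \<Longrightarrow> P (p + r)"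
  shows "P p"
proof (induction p rule: update_induct)
  case const
  then show ?case by (rule assms(1))
next
  case (update f a b)
  have "Poly_Mapping.update a b f = f + Poly_Mapping.single a b"
    using update(1) by (intro poly_mapping_eqI)
      (auto simp: lookup_update lookup_add lookup_single when_def not_in_keys_iff_lookup_eq_zero)
  then show ?case using update assms by simp
qed

lemma word_eval_mult: "word_eval g (p * r) = word_eval g p * word_eval g r"
proof (induction p rule: free_alg_induct)
  case (single w c)
  show ?case
  proof (induction r rule: free_alg_induct)
    case (single v d)
    show ?case
      by (simp add: mult_single word_eval_single plus_word_def scaleC_mult_left scaleC_mult_right
          scaleC_scaleC)
  qed (simp_all add: word_eval_add distrib_left)
qed (simp_all add: word_eval_add distrib_right)

lemma word_eval_1 [simp]: "word_eval g 1 = 1"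
  using word_eval_single[of g 0 1] by (simp add: zero_word_def[symmetric])
    (simp add: zero_word_def)

lemma word_eval_var [simp]: "word_eval g (free_var s) = g s"
  by (simp add: free_var_def word_eval_single scaleC_one)

lemma word_eval_const [simp]: "word_eval g (free_const c) = c *\<^sub>C 1"
  by (simp add: free_const_def word_eval_single zero_word_def)

lemma word_eval_power: "word_eval g (p ^ n) = word_eval g p ^ n"
  by (induction n) (simp_all add: word_eval_mult)

lemma word_eval_sum: "word_eval g (\<Sum>a\<in>A. f a) = (\<Sum>a\<in>A. word_eval g (f a))"
  by (induction A rule: infinite_finite_induct) (simp_all add: word_eval_add)

lemma word_eval_prod_list: "word_eval g (prod_list ps) = prod_list (map (word_eval g) ps)"
  by (induction ps) (simp_all add: word_eval_mult)

lemmas word_eval_hom = word_eval_add word_eval_uminus word_eval_diff word_eval_mult word_eval_power word_eval_sum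
  word_eval_prod_list

lemma free_on_add: "p \<in> free_on S \<Longrightarrow> r \<in> free_on S \<Longrightarrow> p + r \<in> free_on S"
  using Poly_Mapping.keys_add[of p r] by (simp add: free_on_def subset_iff) blast

lemma free_on_mult:
  assumes "p \<in> free_on S" "r \<in> free_on S"
  shows "p * r \<in> free_on S"
  unfolding free_on_def mem_Collect_eq
proof
  fix w assume "w \<in> Poly_Mapping.keys (p * r)"
  then obtain a b where "a \<in> Poly_Mapping.keys p" "b \<in> Poly_Mapping.keys r" "w = a + b"
    using Poly_Mapping.keys_mult[of p r] by blast
  then show "set (letters w) \<subseteq> S"
    using assms by (simp add: free_on_def plus_word_def)
qed

lemma free_on_const: "free_const c \<in> free_on S"
  by (auto simp: free_on_def free_const_def zero_word_def)

lemma free_on_var: "s \<in> S \<Longrightarrow> free_var s \<in> free_on S"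
  by (auto simp: free_on_def free_var_def)

lemma free_on_1: "1 \<in> free_on S"
  using free_on_const[of 1 S] by (simp add: free_const_def)

lemma free_on_mono: "S \<subseteq> S' \<Longrightarrow> free_on S \<subseteq> free_on S'"
  by (auto simp: free_on_def)

lemma ideal_in_subset:
  assumes "R \<subseteq> J" "0 \<in> J" "\<And>x y. x \<in> J \<Longrightarrow> y \<in> J \<Longrightarrow> x + y \<in> J"
    "\<And>b x. b \<in> A \<Longrightarrow> x \<in> J \<Longrightarrow> b * x \<in> J" "\<And>b x. b \<in> A \<Longrightarrow> x \<in> J \<Longrightarrow> x * b \<in> J"
  shows "ideal_in A R \<subseteq> J"
  unfolding ideal_in_def using assms by (intro Inter_lower) auto

lemma presented_by_relator:
  assumes "presented_by S R g" "r \<in> R"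
  shows "word_eval g r = 0"
proof -
  have "r \<in> ideal_in (free_on S) R"
    unfolding ideal_in_def using assms(2) by blast
  moreover have "ideal_in (free_on S) R = {p \<in> free_on S. word_eval g p = 0}"
    using assms(1) by (simp add: presented_by_def free_eval_eq)
  ultimately show ?thesis by blast
qed

lemma gen_subalgebra_word_eval:
  fixes g :: "_ \<Rightarrow> _::complex_algebra_1"
  assumes "b \<in> gen_subalgebra (g ` S)"
  shows "\<exists>p\<in>free_on S. word_eval g p = b"
proof -
  let ?A = "word_eval g ` free_on S"
  have "is_subalgebra ?A"
    unfolding is_subalgebra_def cv.subspace_def
  proof (intro conjI ballI allI)
    show "0 \<in> ?A" by (rule image_eqI[of _ _ 0]) (simp_all add: free_on_def)
    show "1 \<in> ?A" by (rule image_eqI[of _ _ 1]) (simp_all add: free_on_def zero_word_def)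
  next
    fix x y assume "x \<in> ?A" "y \<in> ?A"
    then obtain p r where pr: "p \<in> free_on S" "r \<in> free_on S"
      "x = word_eval g p" "y = word_eval g r"
      by blast
    show "x + y \<in> ?A"
      by (rule image_eqI[of _ _ "p + r"]) (simp_all add: pr word_eval_add free_on_add)
    show "x * y \<in> ?A"
      by (rule image_eqI[of _ _ "p * r"]) (simp_all add: pr word_eval_mult free_on_mult)
  next
    fix c x assume "x \<in> ?A"
    then obtain p where "p \<in> free_on S" "x = word_eval g p" by blast
    then have "free_const c * p \<in> free_on S" "word_eval g (free_const c * p) = c *\<^sub>C x"
      by (simp_all add: free_on_mult free_on_const word_eval_mult scaleC_mult_left)
    then show "c *\<^sub>C x \<in> ?A" by (metis image_eqI)
  qed
  moreover have "g ` S \<subseteq> ?A"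
  proof
    fix b assume "b \<in> g ` S"
    then obtain s where "s \<in> S" "b = g s" by blast
    then show "b \<in> ?A"
      by (intro image_eqI[of _ _ "free_var s"]) (simp_all add: free_on_var)
  qed
  ultimately have "gen_subalgebra (g ` S) \<subseteq> ?A"
    unfolding gen_subalgebra_def by (intro Inter_lower) simp
  then show ?thesis using assms by blast
qed

section \<open>Linear endomorphisms\<close>

lemma scaleC_apply: "(c *\<^sub>C f) x = c *\<^sub>C f x"
  by (simp add: scaleC_fun_def)

lemma sum_fun_apply: "(\<Sum>i\<in>A. f i) x = (\<Sum>i\<in>A. f i x)"
  by (induction A rule: infinite_finite_induct) simp_all

lemma linear_onI:
  assumes "\<And>x. x \<in> V \<Longrightarrow> f x \<in> W" "\<And>x y. x \<in> V \<Longrightarrow> y \<in> V \<Longrightarrow> f (x + y) = f x + f y"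
    "\<And>c x. x \<in> V \<Longrightarrow> f (c *\<^sub>C x) = c *\<^sub>C f x"
  shows "linear_on V W f"
  using assms by (simp add: linear_on_def)

lemma linear_on_0:
  assumes "linear_on V W f" "0 \<in> V" shows "f 0 = 0"
proof -
  have "f (0 *\<^sub>C 0) = 0 *\<^sub>C f 0"
    using assms by (simp only: linear_on_def)
  then show ?thesis by simp
qed

lemma linear_on_sum:
  assumes "linear_on V W f" "cv.subspace V" "\<And>a. a \<in> A \<Longrightarrow> v a \<in> V"
  shows "f (\<Sum>a\<in>A. c a *\<^sub>C v a) = (\<Sum>a\<in>A. c a *\<^sub>C f (v a))"
  using assms(3)
proof (induction A rule: infinite_finite_induct)
  case (insert a A)
  have "(\<Sum>a\<in>A. c a *\<^sub>C v a) \<in> V" "c a *\<^sub>C v a \<in> V"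
    using insert.prems by (auto intro!: cv.subspace_sum cv.subspace_scale assms(2))
  then show ?case
    using insert assms(1) by (simp add: linear_on_def)
qed (simp_all add: linear_on_0[OF assms(1)] cv.subspace_0[OF assms(2)])

lemma linear_on_inj:
  assumes "linear_on U W f" "cv.subspace U" "\<And>v. v \<in> U \<Longrightarrow> f v = 0 \<Longrightarrow> v = 0"
  shows "inj_on f U"
proof (rule inj_onI)
  fix u v assume uv: "u \<in> U" "v \<in> U" "f u = f v"
  have v: "-1 *\<^sub>C v \<in> U" using uv assms(2) by (simp only: cv.subspace_scale)
  then have "u + -1 *\<^sub>C v \<in> U" using uv assms(2) cv.subspace_add by blast
  moreover have "f (u + -1 *\<^sub>C v) = f u + f (-1 *\<^sub>C v)" "f (-1 *\<^sub>C v) = -1 *\<^sub>C f v"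
    using assms(1) uv v unfolding linear_on_def by blast+
  then have "f (u + -1 *\<^sub>C v) = 0" using uv(3) by simp
  ultimately have "u + -1 *\<^sub>C v = 0" by (rule assms(3))
  then show "u = v" by simp
qed

text \<open>Both spaces whose operators are studied, the inductive limit and the functions on words,
  are whole types. Total linear maps therefore suffice, and bundling them into a ring makes
  \<open>word_eval\<close> applicable.\<close>

typedef (overloaded) 'a endo = "{f :: 'a::complex_vector \<Rightarrow> 'a. linear_on UNIV UNIV f}"
  morphisms app Endo
  by (intro exI[of _ id]) (simp add: linear_on_def)

setup_lifting type_definition_endo

lemma app_Endo: "linear_on UNIV UNIV f \<Longrightarrow> app (Endo f) = f"
  by (simp add: Endo_inverse)

lemma linear_app: "linear_on UNIV UNIV (app X)"
  using app[of X] by simp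

lemma app_add: "app X (v + w) = app X v + app X w"
  and app_scale: "app X (c *\<^sub>C v) = c *\<^sub>C app X v"
  using linear_app[of X] by (auto simp: linear_on_def)

lemma app_0 [simp]: "app X 0 = 0"
  using linear_on_0[OF linear_app] by simp

lemma app_diff: "app X (v - w) = app X v - app X w"
  using app_add[of X "v - w" w] by (simp add: algebra_simps)

lemma endo_eqI: "(\<And>v. app X v = app Y v) \<Longrightarrow> X = Y"
  by (simp add: ext app_inject[symmetric])

instantiation endo :: (complex_vector) unital_algebra
begin

lift_definition zero_endo :: "'a endo" is "\<lambda>_. 0"
  by (simp add: linear_on_def)
lift_definition one_endo :: "'a endo" is "\<lambda>v. v"
  by (simp add: linear_on_def)
lift_definition plus_endo :: "'a endo \<Rightarrow> 'a endo \<Rightarrow> 'a endo" is "\<lambda>f g v. f v + g v"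
  by (simp add: linear_on_def cv.scale_right_distrib algebra_simps)
lift_definition minus_endo :: "'a endo \<Rightarrow> 'a endo \<Rightarrow> 'a endo" is "\<lambda>f g v. f v - g v"
  by (simp add: linear_on_def cv.scale_right_diff_distrib algebra_simps)
lift_definition uminus_endo :: "'a endo \<Rightarrow> 'a endo" is "\<lambda>f v. - f v"
  by (simp add: linear_on_def)
lift_definition times_endo :: "'a endo \<Rightarrow> 'a endo \<Rightarrow> 'a endo" is "\<lambda>f g v. f (g v)"
  by (simp add: linear_on_def)
lift_definition scaleC_endo :: "complex \<Rightarrow> 'a endo \<Rightarrow> 'a endo" is "\<lambda>c f v. c *\<^sub>C f v"
  by (simp add: linear_on_def cv.scale_right_distrib mult.commute)

lemmas app_endo = zero_endo.rep_eq one_endo.rep_eq plus_endo.rep_eq minus_endo.rep_eq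
  uminus_endo.rep_eq times_endo.rep_eq scaleC_endo.rep_eq

instance
proof
  fix X Y Z :: "'a endo" and c d :: complex
  note simps = app_endo app_add app_scale app_diff
  show "X + Y + Z = X + (Y + Z)" "X + Y = Y + X"
    by (auto intro!: endo_eqI simp: simps add.assoc add.commute)
  show "0 + X = X" "- X + X = 0" "X - Y = X + - Y" "X * Y * Z = X * (Y * Z)" "1 * X = X" "X * 1 = X"
    "(X + Y) * Z = X * Z + Y * Z" "X * (Y + Z) = X * Y + X * Z"
    by (auto intro!: endo_eqI simp: simps)
  show "c *\<^sub>C (X + Y) = c *\<^sub>C X + c *\<^sub>C Y" "(c + d) *\<^sub>C X = c *\<^sub>C X + d *\<^sub>C X"
    "c *\<^sub>C d *\<^sub>C X = (c * d) *\<^sub>C X" "1 *\<^sub>C X = X"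
    "(c *\<^sub>C X) * Y = c *\<^sub>C (X * Y)" "X * (c *\<^sub>C Y) = c *\<^sub>C (X * Y)"
    by (auto intro!: endo_eqI simp: simps cv.scale_right_distrib cv.scale_left_distrib scaleC_scaleC)
qed

end

declare app_endo [simp]

lemma app_sum: "app (\<Sum>i\<in>A. f i) v = (\<Sum>i\<in>A. app (f i) v)"
  by (induction A rule: infinite_finite_induct) simp_all

lemma app_word_eval:
  "app (word_eval Y p) v =
    (\<Sum>w\<in>Poly_Mapping.keys p. Poly_Mapping.lookup p w *\<^sub>C app (prod_list (map Y (letters w))) v)"
  by (simp add: word_eval_def app_sum)

section \<open>Quantum Serre elements\<close>

definition qnum :: "complex \<Rightarrow> nat \<Rightarrow> complex" where
  "qnum p m = (p ^ m - inverse p ^ m) / (p - inverse p)"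

definition qfac :: "complex \<Rightarrow> nat \<Rightarrow> complex" where
  "qfac p n = (\<Prod>m=1..n. qnum p m)"

definition qbin :: "complex \<Rightarrow> nat \<Rightarrow> nat \<Rightarrow> complex" where
  "qbin p n r = qfac p n / (qfac p r * qfac p (n - r))"

text \<open>Genericity serves twice: at q_i it keeps the quantum integers away from 0, and at q^(-2)
  it makes the coefficients of a polynomial in q^(-2k) unique.\<close>

definition generic :: "complex \<Rightarrow> bool" where
  "generic p \<longleftrightarrow> p \<noteq> 0 \<and> (\<forall>m>0. p ^ m \<noteq> 1)"

lemma generic_denominator:
  assumes "generic p" shows "p - inverse p \<noteq> 0"
proof
  assume "p - inverse p = 0"
  then have "p ^ 2 = 1" using assms by (simp add: generic_def power2_eq_square field_simps)
  then show False using assms unfolding generic_def by (metis zero_less_numeral)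
qed

lemma qnum_nonzero:
  assumes "generic p" "m > 0" shows "qnum p m \<noteq> 0"
proof
  assume "qnum p m = 0"
  then have "p ^ m = inverse p ^ m"
    using generic_denominator[OF assms(1)] by (simp add: qnum_def)
  then have "p ^ m * p ^ m = p ^ m * inverse p ^ m" by simp
  also have "\<dots> = 1"
    using assms by (simp add: generic_def power_inverse)
  finally have "p ^ (m + m) = 1" by (simp add: power_add)
  then show False using assms unfolding generic_def by (metis add_pos_pos)
qed

lemma qfac_Suc: "qfac p (Suc n) = qfac p n * qnum p (Suc n)"
  by (simp add: qfac_def)

lemma qfac_nonzero: "generic p \<Longrightarrow> qfac p n \<noteq> 0"
  by (simp add: qfac_def qnum_nonzero)

lemma qbin_0 [simp]: "generic p \<Longrightarrow> qbin p n 0 = 1"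
  by (simp add: qbin_def qfac_nonzero) (simp add: qfac_def)

lemma qbin_self [simp]: "generic p \<Longrightarrow> qbin p n n = 1"
  by (simp add: qbin_def qfac_nonzero) (simp add: qfac_def)

lemma generic_inverse:
  assumes "generic p" shows "generic (inverse p)"
proof -
  have "inverse p ^ m \<noteq> 1" if "m > 0" for m
  proof -
    have "p ^ m \<noteq> 1" using assms that by (simp add: generic_def)
    then show ?thesis by (metis inverse_1 inverse_inverse_eq power_inverse)
  qed
  then show ?thesis using assms by (simp add: generic_def)
qed

lemma generic_power: "generic v \<Longrightarrow> n > 0 \<Longrightarrow> generic (v ^ n)"
  by (simp add: generic_def power_mult[symmetric])

lemma qnum_inverse: "qnum (inverse p) m = qnum p m"
proof -
  have "qnum (inverse p) m = (- (p ^ m - inverse p ^ m)) / (- (p - inverse p))"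
    by (simp add: qnum_def)
  then show ?thesis by (simp only: minus_divide_divide qnum_def)
qed

lemma qbin_inverse: "qbin (inverse p) n r = qbin p n r"
  by (simp add: qbin_def qfac_def qnum_inverse)

lemma qnum_add:
  assumes "p \<noteq> 0"
  shows "qnum p (r + m) = p ^ r * qnum p m + inverse p ^ m * qnum p r"
proof -
  have "p ^ (r + m) - inverse p ^ (r + m) =
        p ^ r * (p ^ m - inverse p ^ m) + inverse p ^ m * (p ^ r - inverse p ^ r)"
    by (simp add: power_add algebra_simps)
  then show ?thesis by (simp only: qnum_def add_divide_distrib times_divide_eq_right)
qed

lemma qbin_pascal:
  assumes "generic p" "r < n"
  shows "qbin p (Suc n) (Suc r) =
    p ^ Suc r * qbin p n (Suc r) + inverse p ^ (n - r) * qbin p n r"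
proof -
  define m where "m = n - Suc r"
  have n: "n = r + Suc m" and nr: "n - r = Suc m" "Suc n - Suc r = Suc m" "n - Suc r = m"
    using assms(2) by (simp_all add: m_def)
  have p0: "p \<noteq> 0" using assms(1) by (simp add: generic_def)
  have "qnum p (Suc n) = p ^ Suc r * qnum p (Suc m) + inverse p ^ Suc m * qnum p (Suc r)"
    using qnum_add[OF p0, of "Suc r" "Suc m"] by (simp add: n)
  moreover have "qfac p r \<noteq> 0" "qfac p m \<noteq> 0" "qnum p (Suc r) \<noteq> 0" "qnum p (Suc m) \<noteq> 0"
    using assms(1) by (simp_all add: qfac_nonzero qnum_nonzero)
  ultimately show ?thesis
    unfolding qbin_def nr by (simp add: qfac_Suc divide_simps) (simp add: algebra_simps)
qed

text \<open>Both sides equal [n+1]! / ([r]! [n-r]!). The identity matches the two families of terms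
  in \<open>qserre_commute_first\<close>.\<close>

lemma qbin_absorb:
  assumes "generic p" "r \<le> n"
  shows "qbin p (Suc n) r * qnum p (Suc n - r) = qbin p (Suc n) (Suc r) * qnum p (Suc r)"
proof -
  have "Suc n - r = Suc (n - r)" "Suc n - Suc r = n - r" using assms(2) by simp_all
  moreover have "qfac p r \<noteq> 0" "qfac p (n - r) \<noteq> 0" "qnum p (Suc r) \<noteq> 0" "qnum p (Suc (n - r)) \<noteq> 0"
    using assms(1) by (simp_all add: qfac_nonzero qnum_nonzero)
  ultimately show ?thesis by (simp add: qbin_def qfac_Suc)
qed

text \<open>One step of the q-binomial theorem: the Pascal rule splits off one linear factor in z
  and leaves the sum of lower order at \<open>p * z\<close>.\<close>

lemma qbin_sum_Suc:
  assumes "generic p"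
  shows "(\<Sum>r\<le>Suc n. (-1) ^ r * qbin p (Suc n) r * z ^ r) =
    (1 - z * inverse p ^ n) * (\<Sum>r\<le>n. (-1) ^ r * qbin p n r * (p * z) ^ r)"
proof -
  have p0: "p \<noteq> 0" using assms(1) by (simp add: generic_def)
  let ?a = "\<lambda>r. (-1) ^ r * qbin p n r * (p * z) ^ r"
  have step: "(-1) ^ Suc r * qbin p (Suc n) (Suc r) * z ^ Suc r = ?a (Suc r) - z * inverse p ^ n * ?a r"
    if "r < n" for r
  proof -
    have "inverse p ^ (n - r) = inverse p ^ n * p ^ r"
      using that p0 by (simp add: power_diff power_inverse divide_inverse)
    then show ?thesis
      unfolding qbin_pascal[OF assms that] by (simp add: power_mult_distrib algebra_simps)
  qed
  \<comment> \<open>The top coefficient is outside the range of \<open>qbin_pascal\<close> and is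
    computed on its own.\<close>
  have last: "(-1) ^ Suc n * qbin p (Suc n) (Suc n) * z ^ Suc n = - (z * inverse p ^ n * ?a n)"
    using assms p0 by (simp add: power_mult_distrib power_inverse)
  have "(\<Sum>r\<le>Suc n. (-1) ^ r * qbin p (Suc n) r * z ^ r) =
      1 + (\<Sum>r<n. (-1) ^ Suc r * qbin p (Suc n) (Suc r) * z ^ Suc r)
        + (-1) ^ Suc n * qbin p (Suc n) (Suc n) * z ^ Suc n"
    using assms by (subst sum.atMost_Suc_shift) (simp add: lessThan_Suc_atMost[symmetric] del: power_Suc)
  also have "\<dots> = 1 + (\<Sum>r<n. ?a (Suc r) - z * inverse p ^ n * ?a r) - z * inverse p ^ n * ?a n"
    unfolding last using step by simp
  also have "\<dots> = (?a 0 + (\<Sum>r<n. ?a (Suc r))) - z * inverse p ^ n * ((\<Sum>r<n. ?a r) + ?a n)"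
    using assms by (simp add: sum_subtractf sum_distrib_left algebra_simps del: power_Suc)
  also have "?a 0 + (\<Sum>r<n. ?a (Suc r)) = (\<Sum>r\<le>n. ?a r)"
    by (simp only: lessThan_Suc_atMost[symmetric] sum.lessThan_Suc_shift)
  also have "(\<Sum>r<n. ?a r) + ?a n = (\<Sum>r\<le>n. ?a r)"
    by (simp only: lessThan_Suc_atMost[symmetric] sum.lessThan_Suc)
  finally show ?thesis by (simp only: left_diff_distrib mult_1)
qed

text \<open>At \<open>z = p ^ n\<close> the factor split off in \<open>qbin_sum_Suc\<close> is 0.
  The second sum is the first one at \<open>inverse p\<close>, since Gaussian binomials are
  invariant under this substitution.\<close>

lemma qbin_alternating_sum:
  assumes "generic p"
  shows "(\<Sum>r\<le>Suc n. (-1) ^ r * qbin p (Suc n) r * (p ^ n) ^ r) = 0"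
    and "(\<Sum>r\<le>Suc n. (-1) ^ r * qbin p (Suc n) r * (inverse p ^ n) ^ r) = 0"
proof -
  have *: "(\<Sum>r\<le>Suc n. (-1) ^ r * qbin p (Suc n) r * (p ^ n) ^ r) = 0" if "generic p" for p
    using qbin_sum_Suc[OF that, of n "p ^ n"] that
    by (simp add: generic_def power_inverse del: sum.atMost_Suc)
  show "(\<Sum>r\<le>Suc n. (-1) ^ r * qbin p (Suc n) r * (p ^ n) ^ r) = 0"
    by (rule *[OF assms])
  show "(\<Sum>r\<le>Suc n. (-1) ^ r * qbin p (Suc n) r * (inverse p ^ n) ^ r) = 0"
    using *[OF generic_inverse[OF assms]] by (simp only: qbin_inverse)
qed

section \<open>Serre elements and their commutation with opposite generators\<close>

definition qserre :: "complex \<Rightarrow> nat \<Rightarrow> 'a::unital_algebra \<Rightarrow> 'a \<Rightarrow> 'a" where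
  "qserre p n x y = (\<Sum>r\<le>n. ((-1) ^ r * qbin p n r) *\<^sub>C (x ^ (n - r) * y * x ^ r))"

lemma skew_commute_power:
  fixes k x :: "'a::unital_algebra"
  assumes "k * x = a *\<^sub>C (x * k)"
  shows "k * x ^ n = a ^ n *\<^sub>C (x ^ n * k)"
proof (induction n)
  case (Suc n)
  have "k * x ^ Suc n = (k * x) * x ^ n" by (simp add: mult.assoc)
  also have "\<dots> = a *\<^sub>C (x * (k * x ^ n))" by (simp add: assms scaleC_mult_left mult.assoc)
  also have "\<dots> = a ^ Suc n *\<^sub>C (x ^ Suc n * k)"
    by (simp add: Suc scaleC_mult_right scaleC_scaleC mult.assoc)
  finally show ?case .
qed (simp add: scaleC_one)

lemma skew_commute_qserre:
  fixes k x y :: "'a::unital_algebra"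
  assumes x: "k * x = a *\<^sub>C (x * k)" and y: "k * y = b *\<^sub>C (y * k)"
  shows "k * qserre p n x y = (a ^ n * b) *\<^sub>C (qserre p n x y * k)"
proof -
  have "k * (x ^ (n - r) * y * x ^ r) = (a ^ n * b) *\<^sub>C (x ^ (n - r) * y * x ^ r * k)" if "r \<le> n" for r
  proof -
    have "k * (x ^ (n - r) * y * x ^ r) = (k * x ^ (n - r)) * y * x ^ r" by (simp add: mult.assoc)
    also have "\<dots> = a ^ (n - r) *\<^sub>C (x ^ (n - r) * (k * y) * x ^ r)"
      by (simp add: skew_commute_power[OF x] scaleC_mult_left mult.assoc)
    also have "\<dots> = (a ^ (n - r) * b) *\<^sub>C (x ^ (n - r) * y * (k * x ^ r))"
      by (simp add: y scaleC_mult_left scaleC_mult_right scaleC_scaleC mult.assoc)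
    also have "\<dots> = (a ^ (n - r) * b * a ^ r) *\<^sub>C (x ^ (n - r) * y * x ^ r * k)"
      by (simp add: skew_commute_power[OF x] scaleC_mult_right scaleC_scaleC mult.assoc)
    also have "a ^ (n - r) * b * a ^ r = a ^ n * b"
      using that by (simp add: power_add[symmetric] mult.commute mult.left_commute)
    finally show ?thesis .
  qed
  then show ?thesis
    unfolding qserre_def sum_distrib_left sum_distrib_right cv.scale_sum_right
    by (intro sum.cong) (simp_all add: scaleC_mult_left scaleC_mult_right scaleC_scaleC mult_ac)
qed

lemma commute_qserre:
  fixes x y z :: "'a::unital_algebra"
  assumes "x * z = z * x" "y * z = z * y"
  shows "qserre p n x y * z = z * qserre p n x y"
  using skew_commute_qserre[of z x 1 y 1 p n] assms by (simp add: scaleC_one)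

text \<open>The model is x = e_i, y = e_j, z = f_j with p = q_i and n = -C_ij. Passing z through y
  leaves k and k' in the middle; moving them to the right end turns the coefficients into the two
  sums of \<open>qbin_alternating_sum\<close>.\<close>

lemma qserre_commute_second:
  fixes x y z k k' :: "'a::unital_algebra"
  assumes p: "generic p"
    and xz: "x * z = z * x" and yz: "y * z = z * y + c *\<^sub>C (k - k')"
    and kx: "k * x = inverse p ^ n *\<^sub>C (x * k)" and k'x: "k' * x = p ^ n *\<^sub>C (x * k')"
  shows "qserre p (Suc n) x y * z = z * qserre p (Suc n) x y"
proof -
  let ?b = "\<lambda>r. (-1) ^ r * qbin p (Suc n) r"
  have xz': "x ^ m * z = z * x ^ m" for m
    by (rule power_commuting_commutes[OF xz])
  have main: "x ^ (Suc n - r) * y * x ^ r * z = z * (x ^ (Suc n - r) * y * x ^ r) +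
      c *\<^sub>C ((inverse p ^ n) ^ r *\<^sub>C (x ^ Suc n * k) - (p ^ n) ^ r *\<^sub>C (x ^ Suc n * k'))"
    if "r \<le> Suc n" for r
  proof -
    have pow: "x ^ (Suc n - r) * x ^ r = x ^ Suc n"
      using that by (simp add: power_add[symmetric] del: power_Suc)
    have "x ^ (Suc n - r) * y * x ^ r * z = x ^ (Suc n - r) * (y * z) * x ^ r"
      by (simp add: xz' mult.assoc)
    also have "\<dots> = (x ^ (Suc n - r) * z) * y * x ^ r
        + c *\<^sub>C (x ^ (Suc n - r) * (k * x ^ r) - x ^ (Suc n - r) * (k' * x ^ r))"
      by (simp add: yz distrib_left distrib_right left_diff_distrib right_diff_distrib mult.assoc
          scaleC_mult_left scaleC_mult_right)
    also have "\<dots> = z * (x ^ (Suc n - r) * y * x ^ r)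
        + c *\<^sub>C ((inverse p ^ n) ^ r *\<^sub>C (x ^ (Suc n - r) * x ^ r * k)
              - (p ^ n) ^ r *\<^sub>C (x ^ (Suc n - r) * x ^ r * k'))"
      by (simp only: xz' skew_commute_power[OF kx] skew_commute_power[OF k'x] scaleC_mult_right mult.assoc)
    finally show ?thesis by (simp only: pow)
  qed
  have "qserre p (Suc n) x y * z = (\<Sum>r\<le>Suc n. ?b r *\<^sub>C (x ^ (Suc n - r) * y * x ^ r * z))"
    by (simp only: qserre_def sum_distrib_right scaleC_mult_left)
  also have "\<dots> = (\<Sum>r\<le>Suc n. ?b r *\<^sub>C (z * (x ^ (Suc n - r) * y * x ^ r)) +
      (c *\<^sub>C ((?b r * (inverse p ^ n) ^ r) *\<^sub>C (x ^ Suc n * k)) - c *\<^sub>C ((?b r * (p ^ n) ^ r) *\<^sub>C (x ^ Suc n * k'))))"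
    by (intro sum.cong refl, subst main)
      (simp_all add: cv.scale_right_distrib cv.scale_right_diff_distrib scaleC_scaleC mult_ac del: power_Suc)
  also have "\<dots> = (\<Sum>r\<le>Suc n. ?b r *\<^sub>C (z * (x ^ (Suc n - r) * y * x ^ r))) +
      (c *\<^sub>C ((\<Sum>r\<le>Suc n. ?b r * (inverse p ^ n) ^ r) *\<^sub>C (x ^ Suc n * k))
       - c *\<^sub>C ((\<Sum>r\<le>Suc n. ?b r * (p ^ n) ^ r) *\<^sub>C (x ^ Suc n * k')))"
    by (simp only: sum.distrib sum_subtractf cv.scale_sum_left cv.scale_sum_right)
  also have "\<dots> = z * qserre p (Suc n) x y"
    by (simp only: qbin_alternating_sum[OF p] cv.scale_zero_left cv.scale_zero_right
        qserre_def sum_distrib_left scaleC_mult_right diff_self add_0_right)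
  finally show ?thesis .
qed

text \<open>The rank one formula for e_i^m and f_i, with p = q_i and k = k_i; the powers of p arise
  from collecting all k on the right.\<close>

lemma power_commutator:
  fixes x z k k' :: "'a::unital_algebra"
  assumes p: "generic p"
    and xz: "x * z = z * x + c *\<^sub>C (k - k')"
    and kx: "k * x = p\<^sup>2 *\<^sub>C (x * k)" and k'x: "k' * x = (inverse p)\<^sup>2 *\<^sub>C (x * k')"
  shows "x ^ Suc m * z = z * x ^ Suc m +
    (c * qnum p (Suc m)) *\<^sub>C (x ^ m * (p ^ m *\<^sub>C k - inverse p ^ m *\<^sub>C k'))"
proof (induction m)
  case 0
  then show ?case
    using xz generic_denominator[OF p] by (simp add: qnum_def scaleC_one)
next
  case (Suc m)
  have p0: "p \<noteq> 0" using p by (simp add: generic_def)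
  \<comment> \<open>This identity and the next one say that the contribution of the new factor x and
    that of the induction hypothesis add up to the next quantum integer.\<close>
  have 1: "p ^ (2 * Suc m) + qnum p (Suc m) * p ^ m = qnum p (Suc (Suc m)) * p ^ Suc m"
  proof -
    have "qnum p (Suc m + 1) * p ^ Suc m = p ^ Suc m * p ^ Suc m + qnum p (Suc m) * (inverse p * p ^ Suc m)"
      unfolding qnum_add[OF p0, of "Suc m" 1] using generic_denominator[OF p]
      by (simp add: algebra_simps) (simp add: qnum_def)
    also have "p ^ Suc m * p ^ Suc m = p ^ (2 * Suc m)" by (simp add: power_add[symmetric] mult_2)
    also have "inverse p * p ^ Suc m = p ^ m" using p0 by simp
    finally show ?thesis by simp
  qed
  have 2: "inverse p ^ (2 * Suc m) + qnum p (Suc m) * inverse p ^ m = qnum p (Suc (Suc m)) * inverse p ^ Suc m"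
  proof -
    have "qnum p (1 + Suc m) * inverse p ^ Suc m =
      inverse p ^ Suc m * inverse p ^ Suc m + qnum p (Suc m) * (p * inverse p ^ Suc m)"
      unfolding qnum_add[OF p0, of 1 "Suc m"] using generic_denominator[OF p]
      by (simp add: algebra_simps) (simp add: qnum_def)
    also have "inverse p ^ Suc m * inverse p ^ Suc m = inverse p ^ (2 * Suc m)"
      by (simp only: power_add[symmetric] mult_2)
    also have "p * inverse p ^ Suc m = inverse p ^ m" using p0 by simp
    finally show ?thesis by simp
  qed
  have "x ^ Suc (Suc m) * z = x * (x ^ Suc m * z)" by (simp add: mult.assoc)
  also have "\<dots> = (x * z) * x ^ Suc m +
      (c * qnum p (Suc m)) *\<^sub>C (x ^ Suc m * (p ^ m *\<^sub>C k - inverse p ^ m *\<^sub>C k'))"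
    unfolding Suc by (simp add: distrib_left scaleC_mult_right mult.assoc)
  also have "(x * z) * x ^ Suc m = z * x ^ Suc (Suc m) + c *\<^sub>C (k * x ^ Suc m - k' * x ^ Suc m)"
    by (simp add: xz distrib_right scaleC_mult_left left_diff_distrib mult.assoc)
  also have "k * x ^ Suc m - k' * x ^ Suc m =
      x ^ Suc m * (p ^ (2 * Suc m) *\<^sub>C k - inverse p ^ (2 * Suc m) *\<^sub>C k')"
    by (simp only: skew_commute_power[OF kx] skew_commute_power[OF k'x] right_diff_distrib
        scaleC_mult_right power_mult)
  also have "z * x ^ Suc (Suc m) + c *\<^sub>C (x ^ Suc m * (p ^ (2 * Suc m) *\<^sub>C k - inverse p ^ (2 * Suc m) *\<^sub>C k'))
      + (c * qnum p (Suc m)) *\<^sub>C (x ^ Suc m * (p ^ m *\<^sub>C k - inverse p ^ m *\<^sub>C k')) =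
      z * x ^ Suc (Suc m) + c *\<^sub>C (x ^ Suc m * ((p ^ (2 * Suc m) + qnum p (Suc m) * p ^ m) *\<^sub>C k
        - (inverse p ^ (2 * Suc m) + qnum p (Suc m) * inverse p ^ m) *\<^sub>C k'))"
    by (simp add: right_diff_distrib scaleC_mult_right cv.scale_right_diff_distrib scaleC_scaleC
        distrib_left scaleC_add_left scaleC_add_right mult_ac del: power_Suc)
  also have "\<dots> = z * x ^ Suc (Suc m) + (c * qnum p (Suc (Suc m))) *\<^sub>C
      (x ^ Suc m * (p ^ Suc m *\<^sub>C k - inverse p ^ Suc m *\<^sub>C k'))"
    unfolding 1 2
    by (simp add: right_diff_distrib scaleC_mult_right cv.scale_right_diff_distrib scaleC_scaleC
        mult_ac del: power_Suc)
  finally show ?case .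
qed

text \<open>The model is z = f_i. Passing z through the right and the left power of x produces two
  families of terms, all multiples of the same elements \<open>B r\<close>. After an index shift in
  one family they cancel by \<open>qbin_absorb\<close>.\<close>

lemma qserre_commute_first:
  fixes x y z k k' :: "'a::unital_algebra"
  assumes p: "generic p"
    and xz: "x * z = z * x + c *\<^sub>C (k - k')" and yz: "y * z = z * y"
    and kx: "k * x = p\<^sup>2 *\<^sub>C (x * k)" and k'x: "k' * x = (inverse p)\<^sup>2 *\<^sub>C (x * k')"
    and ky: "k * y = inverse p ^ n *\<^sub>C (y * k)" and k'y: "k' * y = p ^ n *\<^sub>C (y * k')"
  shows "qserre p (Suc n) x y * z = z * qserre p (Suc n) x y"
proof -
  have p0: "p \<noteq> 0" using p by (simp add: generic_def)
  let ?b = "\<lambda>r. (-1) ^ r * qbin p (Suc n) r"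
  define B where "B r = x ^ (n - r) * y * x ^ r * (p ^ r *\<^sub>C k - inverse p ^ r *\<^sub>C k')" for r
  \<comment> \<open>\<open>G m\<close> is the commutator of \<open>x ^ m\<close> with z as given by
    \<open>power_commutator\<close>; the case split supplies its value 0 at
    \<open>m = 0\<close>.\<close>
  define G where "G m = (case m of 0 \<Rightarrow> 0 | Suc m \<Rightarrow>
    (c * qnum p (Suc m)) *\<^sub>C (x ^ m * (p ^ m *\<^sub>C k - inverse p ^ m *\<^sub>C k')))" for m
  have G0: "G 0 = 0" by (simp add: G_def)
  have xz': "x ^ m * z = z * x ^ m + G m" for m
    using power_commutator[OF p xz kx k'x] by (cases m) (simp_all add: G_def del: power_Suc)
  have ylow: "x ^ (n - r) * y * G (Suc r) = (c * qnum p (Suc r)) *\<^sub>C B r" for r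
    by (simp add: G_def B_def scaleC_mult_right mult.assoc)
  have kyx: "k * y * x ^ r = (inverse p ^ n * p ^ (2 * r)) *\<^sub>C (y * x ^ r * k)" for r
    by (simp add: ky scaleC_mult_left mult.assoc skew_commute_power[OF kx] scaleC_mult_right
        scaleC_scaleC power_mult)
  have k'yx: "k' * y * x ^ r = (p ^ n * inverse p ^ (2 * r)) *\<^sub>C (y * x ^ r * k')" for r
    by (simp add: k'y scaleC_mult_left mult.assoc skew_commute_power[OF k'x] scaleC_mult_right
        scaleC_scaleC power_mult)
  have yhigh: "G (Suc n - r) * y * x ^ r = (c * qnum p (Suc n - r)) *\<^sub>C B r" if "r \<le> n" for r
  proof -
    have n: "n = (n - r) + r" "Suc n - r = Suc (n - r)" using that by simp_all
    \<comment> \<open>On its way to the right k picks up p^(-n) from y and p^(2r) from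
      \<open>x ^ r\<close>.\<close>
    have 1: "p ^ (n - r) * (inverse p ^ n * p ^ (2 * r)) = p ^ r"
      using p0 by (subst (2) n(1)) (simp add: power_add mult_2 mult_2_right field_simps)
    have 2: "inverse p ^ (n - r) * (p ^ n * inverse p ^ (2 * r)) = inverse p ^ r"
      using p0 by (subst (2) n(1)) (simp add: power_add mult_2 mult_2_right field_simps)
    have "(p ^ (n - r) *\<^sub>C k - inverse p ^ (n - r) *\<^sub>C k') * y * x ^ r =
        p ^ (n - r) *\<^sub>C (k * y * x ^ r) - inverse p ^ (n - r) *\<^sub>C (k' * y * x ^ r)"
      by (simp add: left_diff_distrib scaleC_mult_left)
    also have "\<dots> = y * x ^ r * (p ^ r *\<^sub>C k - inverse p ^ r *\<^sub>C k')"
      by (simp only: kyx k'yx scaleC_scaleC 1 2 right_diff_distrib scaleC_mult_right)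
    finally show ?thesis
      by (simp add: n(2) G_def B_def scaleC_mult_left mult.assoc)
  qed
  have main: "x ^ (Suc n - r) * y * x ^ r * z = z * (x ^ (Suc n - r) * y * x ^ r) +
      G (Suc n - r) * y * x ^ r + x ^ (Suc n - r) * y * G r" for r
  proof -
    have "x ^ (Suc n - r) * y * x ^ r * z = x ^ (Suc n - r) * (y * z) * x ^ r + x ^ (Suc n - r) * y * G r"
      by (simp add: mult.assoc xz' distrib_left)
    also have "x ^ (Suc n - r) * (y * z) * x ^ r = (x ^ (Suc n - r) * z) * y * x ^ r"
      by (simp add: yz mult.assoc)
    also have "\<dots> = z * (x ^ (Suc n - r) * y * x ^ r) + G (Suc n - r) * y * x ^ r"
      by (simp only: xz' distrib_right mult.assoc)
    finally show ?thesis by (simp only: add.assoc)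
  qed
  have "(\<Sum>r\<le>Suc n. ?b r *\<^sub>C (G (Suc n - r) * y * x ^ r)) =
      (\<Sum>r\<le>n. (?b r * (c * qnum p (Suc n - r))) *\<^sub>C B r)"
    by (simp add: yhigh scaleC_scaleC G0)
  moreover have "(\<Sum>r\<le>Suc n. ?b r *\<^sub>C (x ^ (Suc n - r) * y * G r)) =
      (\<Sum>r\<le>n. (?b (Suc r) * (c * qnum p (Suc r))) *\<^sub>C B r)"
    unfolding sum.atMost_Suc_shift diff_Suc_Suc ylow scaleC_scaleC by (simp add: G0)
  moreover have "(\<Sum>r\<le>n. (?b (Suc r) * (c * qnum p (Suc r))) *\<^sub>C B r) =
      (\<Sum>r\<le>n. - ((?b r * (c * qnum p (Suc n - r))) *\<^sub>C B r))"
  proof (rule sum.cong[OF refl])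
    fix r assume "r \<in> {..n}"
    then have "?b (Suc r) * (c * qnum p (Suc r)) = - (?b r * (c * qnum p (Suc n - r)))"
      using qbin_absorb[OF p, of r n] by (simp add: algebra_simps)
    then show "(?b (Suc r) * (c * qnum p (Suc r))) *\<^sub>C B r = - ((?b r * (c * qnum p (Suc n - r))) *\<^sub>C B r)"
      by (simp only: cv.scale_minus_left)
  qed
  ultimately have cancel: "(\<Sum>r\<le>Suc n. ?b r *\<^sub>C (G (Suc n - r) * y * x ^ r)) +
      (\<Sum>r\<le>Suc n. ?b r *\<^sub>C (x ^ (Suc n - r) * y * G r)) = 0"
    by (simp only: sum_negf) simp
  have "qserre p (Suc n) x y * z = (\<Sum>r\<le>Suc n. ?b r *\<^sub>C (x ^ (Suc n - r) * y * x ^ r * z))"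
    by (simp only: qserre_def sum_distrib_right scaleC_mult_left)
  also have "\<dots> = z * qserre p (Suc n) x y + ((\<Sum>r\<le>Suc n. ?b r *\<^sub>C (G (Suc n - r) * y * x ^ r)) +
      (\<Sum>r\<le>Suc n. ?b r *\<^sub>C (x ^ (Suc n - r) * y * G r)))"
    by (simp only: main scaleC_add_right sum.distrib qserre_def sum_distrib_left scaleC_mult_right
        add.assoc)
  finally show ?thesis by (simp only: cancel add_0_right)
qed

section \<open>The twisted Cartan matrix is symmetrizable\<close>

lemma adj_sym: "adj X i j = adj X j i"
  by (cases X) (auto simp: insert_commute)

text \<open>A two-colouring excludes loops and triangles at once; \<open>no_triangle\<close>
  controls the orbits of size three.\<close>

lemma dynkin_bipartite:
  assumes "is_twisted T"
  obtains c :: "nat \<Rightarrow> bool" where "\<And>i j. adj (dyn T) i j \<Longrightarrow> c i \<noteq> c j"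
proof (cases "dyn T")
  case (TypeA m)
  show ?thesis by (rule that[of even]) (auto simp: TypeA)
next
  case (TypeD m)
  then have m: "m \<ge> 4" using assms by (simp add: is_twisted_def)
  \<comment> \<open>Node m is joined to m - 2 and not to m - 1, so its colour is the opposite of the
    one given by its parity.\<close>
  define c where "c i = (if i = m then odd m else even i)" for i
  have "c i \<noteq> c j" if "adj (dyn T) i j" for i j
    using that m by (auto simp: TypeD doubleton_eq_iff c_def)
  then show ?thesis by (rule that)
next
  case TypeE6
  show ?thesis
    by (rule that[of "\<lambda>i. i \<in> {1, 4, 6}"]) (auto simp: TypeE6 doubleton_eq_iff)
qed

lemma adj_irrefl: "is_twisted T \<Longrightarrow> \<not> adj (dyn T) i i"
  using dynkin_bipartite by metis

lemma no_triangle: "is_twisted T \<Longrightarrow> adj (dyn T) i j \<Longrightarrow> adj (dyn T) j k \<Longrightarrow> \<not> adj (dyn T) k i"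
  using dynkin_bipartite by metis

lemma cartan_sym: "cartan X i j = cartan X j i"
  by (simp add: cartan_def adj_sym)

section \<open>Orbits of the diagram automorphism\<close>

locale twisted_data =
  fixes T :: twisted
  assumes T: "is_twisted T"
begin

abbreviation "\<sigma> \<equiv> aut T"
abbreviation "M \<equiv> ord_aut T"
abbreviation "C \<equiv> cartan (dyn T)"

lemma M_cases: "M = 2 \<or> M = 3"
  using T by (simp add: is_twisted_def)

lemma finite_nodes: "finite (nodes T)"
  by (cases "dyn T") simp_all

lemma nodes_pos: "i \<in> nodes T \<Longrightarrow> i > 0"
  by (cases "dyn T") auto

lemma bij: "bij_betw \<sigma> (nodes T) (nodes T)"
  using T by (simp add: is_twisted_def)

lemma aut_nodes [simp]: "i \<in> nodes T \<Longrightarrow> \<sigma> i \<in> nodes T"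
  using bij bij_betwE by blast

lemma aut_pow_nodes [simp]: "i \<in> nodes T \<Longrightarrow> (\<sigma> ^^ r) i \<in> nodes T"
  by (induction r) simp_all

lemma aut_inj: "i \<in> nodes T \<Longrightarrow> j \<in> nodes T \<Longrightarrow> \<sigma> i = \<sigma> j \<longleftrightarrow> i = j"
  using bij by (auto simp: bij_betw_def inj_on_def)

lemma aut_cartan: "i \<in> nodes T \<Longrightarrow> j \<in> nodes T \<Longrightarrow> C (\<sigma> i) (\<sigma> j) = C i j"
  using T by (simp add: is_twisted_def)

lemma aut_pow_cartan: "i \<in> nodes T \<Longrightarrow> j \<in> nodes T \<Longrightarrow> C ((\<sigma> ^^ r) i) ((\<sigma> ^^ r) j) = C i j"
  by (induction r) (simp_all add: aut_cartan)

lemma aut_adj: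
  assumes "i \<in> nodes T" "j \<in> nodes T"
  shows "adj (dyn T) (\<sigma> i) (\<sigma> j) \<longleftrightarrow> adj (dyn T) i j"
proof -
  have "adj (dyn T) i j \<longleftrightarrow> C i j = -1" for i j
    using adj_irrefl[OF T] by (auto simp: cartan_def)
  then show ?thesis using aut_cartan[OF assms] by simp
qed

text \<open>\<open>ord_aut\<close> is a \<open>LEAST\<close>, so some positive power of \<sigma>
  fixing all nodes has to be exhibited. Extended by the identity, \<sigma> permutes a finite set and
  hence has finite order.\<close>

lemma aut_M:
  assumes "i \<in> nodes T" shows "(\<sigma> ^^ M) i = i"
proof -
  define p where "p j = (if j \<in> nodes T then \<sigma> j else j)" for j
  have "p permutes nodes T"
  proof (rule bij_imp_permutes)
    show "bij_betw p (nodes T) (nodes T)"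
      by (rule iffD1[OF bij_betw_cong bij]) (simp add: p_def)
  qed (simp add: p_def)
  then have "permutation p"
    using finite_nodes by (auto simp: permutation_permutes)
  then obtain r where r: "p ^^ r = id" "r > 0"
    using permutation_is_nilpotent by blast
  have "(p ^^ r) j = (\<sigma> ^^ r) j" if "j \<in> nodes T" for j r
    using that by (induction r) (simp_all add: p_def)
  then have "\<forall>j\<in>nodes T. (\<sigma> ^^ r) j = j"
    using r by (metis id_apply)
  then have *: "r > 0 \<and> (\<forall>j\<in>nodes T. (\<sigma> ^^ r) j = j)"
    using r by blast
  have "M > 0 \<and> (\<forall>i\<in>nodes T. (\<sigma> ^^ M) i = i)"
    unfolding ord_aut_def using * by (rule LeastI)
  then show ?thesis using assms by blast
qed

text \<open>Applying a power of \<sigma> to both entries turns the summand for r into the transposed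
  summand for M - r.\<close>

lemma cartan_sum_sym:
  assumes "i \<in> nodes T" "j \<in> nodes T"
  shows "cartan_sum T i j = cartan_sum T j i"
proof -
  have M_pow: "(\<sigma> ^^ M) i = i" "(\<sigma> ^^ M) j = j" using assms aut_M by auto
  show ?thesis
  proof (cases "M = 2")
    case True
    have "C i (\<sigma> j) = C (\<sigma> i) (\<sigma> (\<sigma> j))" using assms by (simp add: aut_cartan)
    then show ?thesis
      using True M_pow by (simp add: cartan_sum_def numeral_eq_Suc cartan_sym)
  next
    case False
    then have "M = 3" using M_cases by simp
    moreover have "C i (\<sigma> j) = C (\<sigma> (\<sigma> i)) (\<sigma> (\<sigma> (\<sigma> j)))"
      "C i (\<sigma> (\<sigma> j)) = C (\<sigma> i) (\<sigma> (\<sigma> (\<sigma> j)))" using assms by (simp_all add: aut_cartan)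
    ultimately show ?thesis
      using M_pow by (simp add: cartan_sum_def numeral_eq_Suc cartan_sym)
  qed
qed

lemma cartan_sum_fixed:
  assumes "i \<in> nodes T" "j \<in> nodes T" "\<sigma> i = i"
  shows "cartan_sum T i j = int M * C i j"
proof -
  have "(\<sigma> ^^ r) i = i" for r by (induction r) (simp_all add: assms)
  then have "C i ((\<sigma> ^^ r) j) = C i j" for r
    using aut_pow_cartan[OF assms(1,2), of r] by simp
  then show ?thesis by (simp add: cartan_sum_def)
qed

lemma orbit_3:
  assumes "i \<in> nodes T" "\<sigma> i \<noteq> i" "M = 3"
  shows "\<sigma> (\<sigma> i) \<noteq> i" "\<sigma> (\<sigma> (\<sigma> i)) = i"
proof -
  show *: "\<sigma> (\<sigma> (\<sigma> i)) = i"
    using aut_M[OF assms(1)] assms(3) by (simp add: numeral_eq_Suc)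
  show "\<sigma> (\<sigma> i) \<noteq> i" using * assms(2) by auto
qed

text \<open>Two adjacent nodes in an orbit of size three would make all three pairwise adjacent,
  which \<open>no_triangle\<close> forbids.\<close>

lemma cartan_sum_moved_3:
  assumes "i \<in> nodes T" "\<sigma> i \<noteq> i" "M = 3"
  shows "cartan_sum T i i = 2"
proof -
  note o = orbit_3[OF assms]
  have ss: "\<sigma> (\<sigma> i) \<noteq> \<sigma> i" using assms aut_inj by simp
  have "adj (dyn T) (\<sigma> i) (\<sigma> (\<sigma> i)) = adj (dyn T) i (\<sigma> i)"
    "adj (dyn T) (\<sigma> (\<sigma> i)) (\<sigma> (\<sigma> (\<sigma> i))) = adj (dyn T) (\<sigma> i) (\<sigma> (\<sigma> i))"
    using assms(1) by (simp_all add: aut_adj)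
  then have "\<not> adj (dyn T) i (\<sigma> i)" "\<not> adj (dyn T) i (\<sigma> (\<sigma> i))"
    using no_triangle[OF T, of i "\<sigma> i" "\<sigma> (\<sigma> i)"] o adj_sym by metis+
  then show ?thesis
    using assms o by (simp add: cartan_sum_def numeral_eq_Suc cartan_def)
qed

lemma cartan_sum_moved_2:
  assumes "i \<in> nodes T" "\<sigma> i \<noteq> i" "M = 2"
  shows "cartan_sum T i i = (if adj (dyn T) i (\<sigma> i) then 1 else 2)"
  using assms aut_M[OF assms(1)] by (simp add: cartan_sum_def numeral_eq_Suc cartan_def)

text \<open>These are the possible values of 2 d_i; the value 1 occurs when a node is joined to its
  image under \<sigma>. The list is what makes the division in \<open>Csig\<close> exact.\<close>

lemma cartan_sum_self:
  assumes "i \<in> nodes T"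
  shows "(\<sigma> i = i \<and> cartan_sum T i i = 2 * int M) \<or> cartan_sum T i i = 1 \<or> cartan_sum T i i = 2"
  using cartan_sum_fixed[OF assms assms] cartan_sum_moved_3[OF assms] cartan_sum_moved_2[OF assms]
    M_cases by (cases "\<sigma> i = i") (auto simp: cartan_def split: if_splits)

lemma rep_orbit: "\<exists>r. rep T j = (\<sigma> ^^ r) j"
  unfolding rep_def by (rule LeastI_ex) blast

lemma rep_nodes: "j \<in> nodes T \<Longrightarrow> rep T j \<in> nodes T"
  using rep_orbit[of j] by auto

lemma rep_aut_pow:
  assumes "j \<in> nodes T" shows "rep T ((\<sigma> ^^ r) j) = rep T j"
proof -
  have M0: "M > 0" using M_cases by auto
  have returns: "\<exists>s. (\<sigma> ^^ s) ((\<sigma> ^^ r) j) = j"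
  proof -
    have "((\<sigma> ^^ M) ^^ r) j = j"
      by (induction r) (simp_all add: assms aut_M)
    then have "(\<sigma> ^^ (r * M)) j = j" by (simp add: funpow_mult mult.commute)
    moreover have "r * M = (r * M - r) + r" using M0 by (cases M) simp_all
    ultimately have "(\<sigma> ^^ (r * M - r)) ((\<sigma> ^^ r) j) = j"
      by (metis comp_apply funpow_add)
    then show ?thesis by blast
  qed
  then obtain s where s: "(\<sigma> ^^ s) ((\<sigma> ^^ r) j) = j" by blast
  have "(\<exists>t. i = (\<sigma> ^^ t) ((\<sigma> ^^ r) j)) \<longleftrightarrow> (\<exists>t. i = (\<sigma> ^^ t) j)" for i
    by (metis comp_apply funpow_add s)
  then show ?thesis by (simp add: rep_def)
qed

lemma Isig_nodes: "Isig T \<subseteq> nodes T"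
  by (auto simp: Isig_def rep_nodes)

lemma rep_Isig: "j \<in> Isig T \<Longrightarrow> rep T j = j"
  using rep_orbit rep_aut_pow by (auto simp: Isig_def) metis

lemma Isig_orbit_distinct:
  assumes "i \<in> Isig T" "j \<in> Isig T" "i \<noteq> j" shows "(\<sigma> ^^ r) j \<noteq> i"
  using assms rep_Isig rep_aut_pow Isig_nodes by (metis subsetD)

lemma eps_notin_Isig: "0 \<notin> Isig T"
  using nodes_pos Isig_nodes by blast

lemma finite_hatI: "finite (hatI T)"
  using finite_nodes by (simp add: hatI_def Isig_def)

end

section \<open>Symmetrizing the twisted Cartan matrix\<close>

context twisted_data
begin

text \<open>For a fixed node the numerator in \<open>Csig\<close> is 2M times a Cartan entry and the
  divisor is 2M; otherwise the divisor is 1 or 2 and the numerator is even.\<close>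

lemma dd_Csig:
  assumes "i \<in> Isig T" "j \<in> Isig T"
  shows "dd T i * of_int (Csig T i j) = of_int (cartan_sum T i j)"
proof -
  have nodes: "i \<in> nodes T" "j \<in> nodes T" and nz: "i \<noteq> 0" "j \<noteq> 0"
    using assms Isig_nodes eps_notin_Isig by (blast, blast, metis, metis)
  have M0: "int M > 0" using M_cases by auto
  consider "\<sigma> i = i" "cartan_sum T i i = 2 * int M" | "cartan_sum T i i = 1" | "cartan_sum T i i = 2"
    using cartan_sum_self[OF nodes(1)] by blast
  then show ?thesis
  proof cases
    case 1
    have "cartan_sum T i j = int M * C i j" by (rule cartan_sum_fixed[OF nodes 1(1)])
    then show ?thesis using 1 nz M0 by (simp add: dd_def Csig_def)
  qed (use nz in \<open>simp_all add: dd_def Csig_def\<close>)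
qed

lemma dd_Isig:
  assumes "i \<in> Isig T"
  shows "dd T i = 1 / 2 \<or> dd T i = 1 \<or> dd T i = of_nat M"
proof -
  have "i \<in> nodes T" "i \<noteq> 0"
    using assms Isig_nodes eps_notin_Isig by (blast, metis)
  then show ?thesis using cartan_sum_self[of i] by (auto simp: dd_def)
qed

lemma dd_eps: "dd T 0 = 1 \<or> dd T 0 = 2"
  by (simp add: dd_def split: dynkin.split)

text \<open>The exponent of q_i with respect to the fixed square root of q. As d_i may be 1/2,
  exponents are handled as integer powers of \<open>sqrt_q T\<close>.\<close>

definition d2 :: "nat \<Rightarrow> nat" where "d2 i = nat \<lfloor>2 * dd T i\<rfloor>"

lemma d2:
  assumes "i \<in> hatI T" shows "d2 i > 0" "2 * dd T i = of_nat (d2 i)"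
proof -
  have "dd T i = 1 / 2 \<or> dd T i = 1 \<or> dd T i = 2 \<or> dd T i = 3"
    using assms dd_Isig[of i] dd_eps M_cases by (auto simp: hatI_def)
  then have "2 * dd T i \<in> of_nat ` {1, 2, 4, 6}" by (elim disjE) simp_all
  then obtain n :: nat where n: "2 * dd T i = of_nat n" "n > 0" by auto
  then show "d2 i > 0" "2 * dd T i = of_nat (d2 i)" by (simp_all only: d2_def) simp_all
qed

lemma dd_pos: "i \<in> hatI T \<Longrightarrow> dd T i > 0"
  using d2[of i] by (metis mult_pos_pos of_nat_0_less_iff zero_less_mult_pos zero_less_numeral)

lemma Csig_self: "i \<in> hatI T \<Longrightarrow> Csig T i i = 2"
proof (cases "i = 0")
  case False
  assume "i \<in> hatI T"
  then have i: "i \<in> Isig T" using False by (simp add: hatI_def)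
  then have "cartan_sum T i i > 0"
    using cartan_sum_self[OF subsetD[OF Isig_nodes i]] M_cases by auto
  then show ?thesis using False by (simp add: Csig_def)
qed (simp add: Csig_def)

lemma cartan_sum_nonpos:
  assumes "i \<in> Isig T" "j \<in> Isig T" "i \<noteq> j" shows "cartan_sum T i j \<le> 0"
proof -
  have "C i ((\<sigma> ^^ r) j) \<le> 0" for r
    using Isig_orbit_distinct[OF assms, of r] by (simp add: cartan_def)
  then show ?thesis by (simp add: cartan_sum_def sum_nonpos)
qed

lemma eps_entries_nonpos: "fst (eps_entries T) \<le> 0" "snd (eps_entries T) \<le> 0"
  by (simp_all add: eps_entries_def split: dynkin.split)

lemma Csig_nonpos:
  assumes "i \<in> hatI T" "j \<in> hatI T" "i \<noteq> j" shows "Csig T i j \<le> 0"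
proof (cases "i = 0 \<or> j = 0")
  case True
  then show ?thesis using assms eps_entries_nonpos by (auto simp: Csig_def)
next
  case False
  then have ij: "i \<in> Isig T" "j \<in> Isig T" using assms by (simp_all add: hatI_def)
  have "dd T i * of_int (Csig T i j) \<le> 0"
    unfolding dd_Csig[OF ij] using cartan_sum_nonpos[OF ij assms(3)] by simp
  then show ?thesis using dd_pos[OF assms(1)] by (simp add: mult_le_0_iff)
qed

text \<open>A node with at least two neighbours. Being one is compatible with \<sigma>, so end nodes
  go to end nodes; this locates the images of the nodes near \<epsilon>.\<close>

definition branch :: "nat \<Rightarrow> bool" where
  "branch j \<longleftrightarrow> (\<exists>a\<in>nodes T. \<exists>b\<in>nodes T. a \<noteq> b \<and> adj (dyn T) j a \<and> adj (dyn T) j b)"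

lemma branch_aut:
  assumes "j \<in> nodes T" "branch (\<sigma> j)" shows "branch j"
proof -
  from assms(2) obtain a b where ab: "a \<in> nodes T" "b \<in> nodes T" "a \<noteq> b"
    "adj (dyn T) (\<sigma> j) a" "adj (dyn T) (\<sigma> j) b" unfolding branch_def by blast
  moreover from ab obtain a' b' where "a = \<sigma> a'" "a' \<in> nodes T" "b = \<sigma> b'" "b' \<in> nodes T"
    using bij by (metis bij_betw_imp_surj_on imageE)
  ultimately have "adj (dyn T) j a'" "adj (dyn T) j b'" "a' \<noteq> b'" "a' \<in> nodes T" "b' \<in> nodes T"
    using aut_adj[OF assms(1)] by auto
  then show ?thesis unfolding branch_def by blast
qed

text \<open>A fixed node t of the chain has at most t + 1 and t - 1 as neighbours. The image of t +
  1 is one of them, and it cannot be t - 1, which is already fixed.\<close>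

lemma aut_fixes_chain:
  assumes "1 \<in> nodes T" "\<sigma> 1 = 1"
    and chain: "\<And>i. 1 \<le> i \<Longrightarrow> i < k \<Longrightarrow> i + 1 \<in> nodes T \<and> adj (dyn T) i (i + 1) \<and>
      (\<forall>b\<in>nodes T. adj (dyn T) i b \<longrightarrow> b = i + 1 \<or> b + 1 = i)"
    and "1 \<le> i" "i \<le> k"
  shows "i \<in> nodes T \<and> \<sigma> i = i"
  using assms(4,5)
proof (induction i rule: less_induct)
  case (less i)
  show ?case
  proof (cases "i = 1")
    case False
    define t where "t = i - 1"
    have t: "i = t + 1" "1 \<le> t" "t < k" using less False by (simp_all add: t_def)
    have tn: "t \<in> nodes T" "\<sigma> t = t" using less.IH[of t] t by simp_all
    note c = chain[OF t(2,3)]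
    then have "adj (dyn T) t (\<sigma> (t + 1))"
      using aut_adj[of t "t + 1"] tn by simp
    then have "\<sigma> i = i \<or> \<sigma> i + 1 = t" using c t(1) by simp
    moreover have False if "\<sigma> i + 1 = t"
    proof -
      have n: "i \<in> nodes T" using c t(1) by simp
      then have "\<sigma> i \<in> nodes T" by simp
      then have "\<sigma> i \<ge> 1" using nodes_pos[of "\<sigma> i"] by simp
      then have "\<sigma> i \<in> nodes T" "\<sigma> (\<sigma> i) = \<sigma> i"
        using less.IH[of "\<sigma> i"] that t less.prems by simp_all
      then have "\<sigma> i = i" using n aut_inj by blast
      then show False using that t by simp
    qed
    ultimately show ?thesis using c t(1) by auto
  qed (use assms in simp)
qed

lemma aut_nontrivial: "\<exists>i\<in>nodes T. \<sigma> i \<noteq> i"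
  using T by (simp add: is_twisted_def)

lemma dd_moved_apart:
  assumes "i \<in> nodes T" "\<sigma> i \<noteq> i" "\<not> adj (dyn T) i (\<sigma> i)"
  shows "dd T i = 1"
  using assms cartan_sum_moved_2[OF assms(1,2)] cartan_sum_moved_3[OF assms(1,2)] M_cases
    nodes_pos[OF assms(1)] by (auto simp: dd_def)

lemma dd_fixed:
  assumes "i \<in> nodes T" "\<sigma> i = i" shows "dd T i = of_nat M"
  using assms cartan_sum_fixed[OF assms(1) assms(1,2)] nodes_pos[OF assms(1)]
  by (auto simp: dd_def cartan_def)

text \<open>If node 1 were fixed, the whole chain would be. As end nodes go to end nodes, \<sigma>
  exchanges 1 and m, and an orbit of size two excludes M = 3.\<close>

lemma aut_TypeA:
  assumes A: "dyn T = TypeA m"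
  shows "m \<ge> 2" "\<sigma> 1 = m" "\<sigma> m = 1" "M = 2"
proof -
  show m: "m \<ge> 2" using T A by (simp add: is_twisted_def)
  have N: "nodes T = {1..m}" by (simp add: A)
  have inner: "branch j" if "1 < j" "j < m" for j
    unfolding branch_def N using that
    by (intro bexI[of _ "j - 1"] bexI[of _ "j + 1"]) (auto simp: A)
  have outer: "\<not> branch 1" "\<not> branch m"
    by (auto simp: branch_def A)
  have ends: "\<sigma> j \<in> {1, m}" if "j \<in> {1, m}" for j
  proof (rule ccontr)
    assume *: "\<sigma> j \<notin> {1, m}"
    have j: "j \<in> nodes T" using that m by (auto simp: N)
    have "\<sigma> j \<in> {1..m}" using aut_nodes[OF j] by (simp add: N)
    then have "branch (\<sigma> j)" using * by (intro inner) auto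
    then show False using branch_aut[OF j] outer that by blast
  qed
  have "\<sigma> 1 \<noteq> 1"
  proof
    assume *: "\<sigma> 1 = 1"
    have "\<sigma> i = i" if "1 \<le> i" "i \<le> m" for i
      using aut_fixes_chain[of m i] * that m by (auto simp: A)
    then show False using aut_nontrivial by (auto simp: N)
  qed
  then show 1: "\<sigma> 1 = m" using ends[of 1] by simp
  have "\<sigma> m \<noteq> \<sigma> 1" using aut_inj[of m 1] m by (simp add: N)
  then show 2: "\<sigma> m = 1" using ends[of m] 1 by auto
  show "M = 2" using orbit_3[of 1] 1 2 m M_cases by (auto simp: N)
qed

text \<open>The exceptional entries come from small m: for m = 2 the nodes 1 and 2 form an orbit of
  adjacent nodes, so d_1 = 1/2; for m = 3 node 2 is fixed, so d_2 = 2.\<close>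

lemma eps_symmetric_A:
  assumes A: "dyn T = TypeA m"
  shows "dd T 0 * of_int (fst (eps_entries T)) = dd T (eps_nb T) * of_int (snd (eps_entries T))"
proof -
  note a = aut_TypeA[OF A]
  have N: "nodes T = {1..m}" by (simp add: A)
  show ?thesis
  proof (cases "even m")
    case True
    have "dd T 1 = (if m = 2 then 1 / 2 else 1)"
    proof (cases "m = 2")
      case True
      then show ?thesis
        using a cartan_sum_moved_2[of 1] by (simp add: N dd_def A)
    next
      case False
      then show ?thesis using a dd_moved_apart[of 1] by (simp add: N A)
    qed
    then show ?thesis using True by (simp add: A eps_entries_def eps_nb_def dd_def)
  next
    case False
    then have m3: "m \<ge> 3" using a(1) by presburger
    have "adj (dyn T) (\<sigma> 1) (\<sigma> 2)" using aut_adj[of 1 2] m3 by (simp add: A N)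
    moreover have "\<sigma> 2 \<in> {1..m}" using aut_nodes[of 2] m3 by (simp add: N)
    ultimately have s2: "\<sigma> 2 = m - 1" using a by (auto simp: A)
    have "dd T 2 = (if m = 3 then 2 else 1)"
    proof (cases "m = 3")
      case True
      then show ?thesis using a s2 dd_fixed[of 2] by (simp add: N)
    next
      case False
      moreover have "m \<noteq> 4" using \<open>odd m\<close> by auto
      ultimately show ?thesis using s2 m3 dd_moved_apart[of 2] by (simp add: N A)
    qed
    then show ?thesis using False by (simp add: A eps_entries_def eps_nb_def dd_def)
  qed
qed

text \<open>For order 3, fixing node 1 would fix the chain from 1 to m - 2 and leave two nodes to
  permute, too few for an orbit of size three. For order 2, an involution of the three end nodes
  fixes one of them, so the \<open>LEAST\<close> in \<open>eps_nb\<close> exists and d = 2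
  there.\<close>

lemma eps_symmetric_D:
  assumes D: "dyn T = TypeD m"
  shows "dd T 0 * of_int (fst (eps_entries T)) = dd T (eps_nb T) * of_int (snd (eps_entries T))"
proof -
  have m: "m \<ge> 4" using T D by (simp add: is_twisted_def)
  have N: "nodes T = {1..m}" by (simp add: D)
  show ?thesis
  proof (cases "M = 3")
    case True
    have "\<sigma> 1 \<noteq> 1"
    proof
      assume *: "\<sigma> 1 = 1"
      have fixed: "\<sigma> i = i" if "1 \<le> i" "i \<le> m - 2" for i
      proof -
        have "t + 1 \<in> nodes T \<and> adj (dyn T) t (t + 1) \<and>
            (\<forall>b\<in>nodes T. adj (dyn T) t b \<longrightarrow> b = t + 1 \<or> b + 1 = t)" if "1 \<le> t" "t < m - 2" for t
          using that by (auto simp: D doubleton_eq_iff)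
        moreover have "1 \<in> nodes T" using m by (simp add: N)
        ultimately show ?thesis using aut_fixes_chain[of "m - 2" i] * that by blast
      qed
      have tail: "\<sigma> i \<in> {m - 1, m}" if i: "i \<in> {m - 1, m}" for i
      proof (rule ccontr)
        assume "\<sigma> i \<notin> {m - 1, m}"
        moreover have in1: "i \<in> nodes T" using i m by (auto simp: N)
        moreover have "\<sigma> i \<in> {1..m}" using aut_nodes[OF in1] by (simp add: N)
        ultimately have "\<sigma> (\<sigma> i) = \<sigma> i" using fixed[of "\<sigma> i"] by auto
        then have "\<sigma> i = i" using aut_inj in1 aut_nodes by blast
        then show False using \<open>\<sigma> i \<notin> {m - 1, m}\<close> i by simp
      qed
      have last: "\<sigma> i = i" if i: "i \<in> {m - 1, m}" for i
      proof (rule ccontr)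
        assume ne: "\<sigma> i \<noteq> i"
        have in1: "i \<in> nodes T" using i m by (auto simp: N)
        have "\<sigma> (\<sigma> i) \<in> {m - 1, m}" "\<sigma> (\<sigma> i) \<noteq> \<sigma> i" "\<sigma> i \<in> {m - 1, m}"
          using tail i ne aut_inj in1 aut_nodes by blast+
        then have "\<sigma> (\<sigma> i) = i" using i ne by auto
        then show False using orbit_3[OF in1 ne True] by simp
      qed
      then have "\<sigma> i = i" if "i \<in> nodes T" for i
      proof (cases "i \<le> m - 2")
        case False
        then have "i \<in> {m - 1, m}" using that by (auto simp: N)
        then show ?thesis by (rule last)
      qed (use fixed that in \<open>simp add: N\<close>)
      then show False using aut_nontrivial by blast
    qed
    then have "dd T 1 = 1"
      using cartan_sum_moved_3[of 1] True m by (simp add: N dd_def)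
    then show ?thesis using True by (simp add: D eps_entries_def eps_nb_def dd_def)
  next
    case False
    then have M2: "M = 2" using M_cases by simp
    have inner: "branch j" if "1 < j" "j < m - 1" for j
      unfolding branch_def N using that
      by (intro bexI[of _ "j - 1"] bexI[of _ "j + 1"]) (auto simp: D)
    have nbs: "{i \<in> nodes T. adj (dyn T) j i} = {if j = 1 then 2 else m - 2}" if "j \<in> {1, m - 1, m}" for j
      using that m by (auto simp: D doubleton_eq_iff)
    have outer: "\<not> branch j" if "j \<in> {1, m - 1, m}" for j
    proof
      assume "branch j"
      then obtain a b where ab: "a \<noteq> b" "a \<in> {i \<in> nodes T. adj (dyn T) j i}"
        "b \<in> {i \<in> nodes T. adj (dyn T) j i}" unfolding branch_def by blast
      then show False unfolding nbs[OF that] by simp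
    qed
    have leaf: "\<sigma> j \<in> {1, m - 1, m}" if "j \<in> {1, m - 1, m}" for j
    proof -
      have j: "j \<in> nodes T" using that m by (auto simp: N)
      then have "\<not> branch (\<sigma> j)" using branch_aut outer[OF that] by blast
      then show ?thesis using inner[of "\<sigma> j"] aut_nodes[OF j] by (fastforce simp: N)
    qed
    have invol: "\<sigma> (\<sigma> j) = j" if "j \<in> nodes T" for j
      using aut_M[OF that] by (simp add: M2 numeral_eq_Suc)
    have n: "1 \<in> nodes T" "m - 1 \<in> nodes T" "m \<in> nodes T" "(1::nat) \<noteq> m - 1" "m \<noteq> 1" "m \<noteq> m - 1"
      using m by (auto simp: N)
    have "\<exists>j\<in>{1, m - 1, m}. \<sigma> j = j"
    proof (rule ccontr)
      assume no: "\<not> ?thesis"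
      then have "\<sigma> 1 = m - 1 \<or> \<sigma> 1 = m" using leaf[of 1] by auto
      then show False
      proof
        assume *: "\<sigma> 1 = m - 1"
        then have "\<sigma> m = 1 \<or> \<sigma> m = m - 1" using no leaf[of m] by auto
        then show False using * invol[of m] invol[of 1] n aut_inj[of m 1] by auto
      next
        assume *: "\<sigma> 1 = m"
        then have "\<sigma> (m - 1) = 1 \<or> \<sigma> (m - 1) = m" using no leaf[of "m - 1"] by auto
        then show False using * invol[of "m - 1"] invol[of 1] n aut_inj[of "m - 1" 1] by auto
      qed
    qed
    then obtain j where j: "j \<in> {1, m - 1, m}" "\<sigma> j = j" by blast
    let ?P = "\<lambda>j. j \<in> nodes T \<and> \<sigma> j = j \<and> card {i \<in> nodes T. adj (dyn T) j i} = 1"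
    have "?P j" using j n nbs[OF j(1)] by auto
    then have "?P (LEAST j. ?P j)" by (rule LeastI)
    then have "eps_nb T \<in> nodes T" "\<sigma> (eps_nb T) = eps_nb T"
      using M2 by (simp_all add: eps_nb_def D)
    then have "dd T (eps_nb T) = 2" using dd_fixed M2 by simp
    then show ?thesis using M2 by (simp add: D eps_entries_def dd_def)
  qed
qed

text \<open>The value d_1 = 1 requires that node 1 is moved and, for order 2, that it is not joined
  to its image. Both follow by tracing images along edges: a fixed node 1 would force 3, 4, 5, 2 and
  6 to be fixed in turn.\<close>

lemma eps_symmetric_E:
  assumes E: "dyn T = TypeE6"
  shows "dd T 0 * of_int (fst (eps_entries T)) = dd T (eps_nb T) * of_int (snd (eps_entries T))"
proof -
  have N: "nodes T = {1..6}" by (simp add: E)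
  have N': "j \<in> nodes T \<longleftrightarrow> j \<in> {1, 2, 3, 4, 5, 6}" for j by (auto simp: N)
  have nbs: "adj (dyn T) 1 j \<Longrightarrow> j = 3" "adj (dyn T) 3 j \<Longrightarrow> j = 1 \<or> j = 4"
    "adj (dyn T) 4 j \<Longrightarrow> j = 2 \<or> j = 3 \<or> j = 5" "adj (dyn T) 2 j \<Longrightarrow> j = 4" for j
    by (auto simp: E doubleton_eq_iff)
  have a: "adj (dyn T) (\<sigma> 1) (\<sigma> 3)" "adj (dyn T) (\<sigma> 3) (\<sigma> 4)" "adj (dyn T) (\<sigma> 4) (\<sigma> 5)"
    "adj (dyn T) (\<sigma> 5) (\<sigma> 6)" "adj (dyn T) (\<sigma> 4) (\<sigma> 2)"
    using aut_adj[of 1 3] aut_adj[of 3 4] aut_adj[of 4 5] aut_adj[of 5 6] aut_adj[of 4 2]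
    by (simp_all add: N E doubleton_eq_iff)
  have inj: "\<sigma> i = \<sigma> j \<longleftrightarrow> i = j" if "i \<in> {1..6}" "j \<in> {1..6}" for i j
    using aut_inj that by (simp add: N)
  have "\<sigma> 1 \<noteq> 1"
  proof
    assume 1: "\<sigma> 1 = 1"
    then have 3: "\<sigma> 3 = 3" using a nbs by metis
    then have 4: "\<sigma> 4 = 4" using a(2) nbs(2)[of "\<sigma> 4"] 1 inj[of 4 1] by auto
    have 5: "\<sigma> 5 = 2 \<or> \<sigma> 5 = 5" using a(3) nbs(3)[of "\<sigma> 5"] 3 4 inj[of 5 3] by auto
    \<comment> \<open>If 5 went to 2, the image of 6 would be the only neighbour of 2, namely 4,
      which is already the image of 4.\<close>
    have "\<sigma> 5 \<noteq> 2" using a(4) nbs(4)[of "\<sigma> 6"] 4 inj[of 6 4] by auto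
    then have 5: "\<sigma> 5 = 5" using 5 by simp
    have 2: "\<sigma> 2 = 2" using a(5) nbs(3)[of "\<sigma> 2"] 3 4 5 inj[of 2 3] inj[of 2 5] by auto
    have "\<sigma> 6 = 6"
      using aut_nodes[of 6] 1 2 3 4 5 inj[of 6 1] inj[of 6 2] inj[of 6 3] inj[of 6 4] inj[of 6 5]
      by (auto simp: N')
    then show False using aut_nontrivial 1 2 3 4 5 by (auto simp: N')
  qed
  have "\<not> adj (dyn T) 1 (\<sigma> 1)" if "M = 2"
  proof
    assume "adj (dyn T) 1 (\<sigma> 1)"
    then have 1: "\<sigma> 1 = 3" using nbs(1) by blast
    have "\<sigma> (\<sigma> 1) = 1" using aut_M[of 1] by (simp add: that numeral_eq_Suc N)
    then have 3: "\<sigma> 3 = 1" using 1 by simp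
    then show False using a(2) nbs(1)[of "\<sigma> 4"] 1 inj[of 4 1] by auto
  qed
  then have "dd T 1 = 1"
    using \<open>\<sigma> 1 \<noteq> 1\<close> cartan_sum_moved_2[of 1] cartan_sum_moved_3[of 1] M_cases
    by (auto simp: N dd_def)
  then show ?thesis by (simp add: E eps_entries_def eps_nb_def dd_def)
qed

lemma dd_Csig_sym:
  assumes "i \<in> hatI T" "j \<in> hatI T"
  shows "dd T i * of_int (Csig T i j) = dd T j * of_int (Csig T j i)"
proof -
  have eps: "dd T 0 * of_int (fst (eps_entries T)) = dd T (eps_nb T) * of_int (snd (eps_entries T))"
    using eps_symmetric_A eps_symmetric_D eps_symmetric_E by (cases "dyn T") auto
  have *: "dd T 0 * of_int (Csig T 0 j) = dd T j * of_int (Csig T j 0)" for j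
    using eps by (simp add: Csig_def)
  show ?thesis
  proof (cases "i = 0 \<or> j = 0")
    case True
    then show ?thesis using * by auto
  next
    case False
    then have ij: "i \<in> Isig T" "j \<in> Isig T" using assms by (simp_all add: hatI_def)
    then show ?thesis
      using cartan_sum_sym[of i j] Isig_nodes dd_Csig by auto
  qed
qed

end

section \<open>Representations of the Borel part\<close>

lemma skew_commute_inverse:
  fixes k k' x :: "'a::unital_algebra"
  assumes "k * k' = 1" "k' * k = 1" "k * x = a *\<^sub>C (x * k)" "a \<noteq> 0"
  shows "k' * x = inverse a *\<^sub>C (x * k')"
proof -
  have "x * k' = (k' * k) * x * k'" by (simp add: assms)
  also have "\<dots> = k' * (k * x) * k'" by (simp add: mult.assoc)
  also have "\<dots> = a *\<^sub>C (k' * x)"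
    by (simp add: assms(3) scaleC_mult_left scaleC_mult_right mult.assoc assms(1))
  finally show ?thesis using assms(4) by (simp add: scaleC_scaleC)
qed

context twisted_data
begin

lemma generic_sqrt_q: "generic (sqrt_q T)"
proof -
  have "sqrt_q T ^ m \<noteq> 1" if "m > 0" for m
  proof
    assume "sqrt_q T ^ m = 1"
    then have "qq T ^ m = 1" by (simp add: power_mult[symmetric] mult.commute[of 2] power_mult)
    then show False using T that by (simp add: is_twisted_def)
  qed
  then show ?thesis using T by (simp add: generic_def is_twisted_def)
qed

lemma sqrt_q_nonzero: "sqrt_q T \<noteq> 0"
  using generic_sqrt_q by (simp add: generic_def)

lemma qi_eq: "i \<in> hatI T \<Longrightarrow> qi T i = sqrt_q T ^ d2 i"
  using d2[of i] by (simp add: qi_def qpow_def)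

lemma generic_qi: "i \<in> hatI T \<Longrightarrow> generic (qi T i)"
  using generic_power[OF generic_sqrt_q] d2[of i] by (simp add: qi_eq)

lemma qi_powi: "i \<in> hatI T \<Longrightarrow> qi T i powi n = sqrt_q T powi (int (d2 i) * n)"
  by (simp add: qi_eq power_int_mult)

text \<open>Turns the factor of k_j against e_i into a power of q_i, the parameter of the Serre
  element of e_i and e_j.\<close>

lemma qi_powi_Csig_sym:
  assumes "i \<in> hatI T" "j \<in> hatI T"
  shows "qi T i powi Csig T i j = qi T j powi Csig T j i"
proof -
  have "(2 * dd T i) * of_int (Csig T i j) = (2 * dd T j) * of_int (Csig T j i)"
    using dd_Csig_sym[OF assms] by simp
  then have "rat_of_int (int (d2 i) * Csig T i j) = rat_of_int (int (d2 j) * Csig T j i)"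
    using d2 assms by simp
  then show ?thesis using assms by (simp only: qi_powi of_int_eq_iff)
qed

text \<open>The product of the k_i^(a_i) commutes with every e_j, because the total exponent
  vanishes by the equation defining the marks. This is needed for functions on words and again for
  \<epsilon> in the limit.\<close>

lemma marks_power:
  assumes marks: "is_marks T a" and "j \<in> hatI T"
  shows "(\<Prod>i\<in>hatI T. (qi T i powi Csig T i j) ^ a i) = 1"
proof -
  have "(\<Sum>i\<in>hatI T. of_nat (a i) * (2 * dd T i) * of_int (Csig T i j)) =
      2 * (\<Sum>i\<in>hatI T. of_nat (a i) * dd T i * of_int (Csig T i j))"
    by (simp add: sum_distrib_left algebra_simps)
  also have "\<dots> = 0" using marks assms by (simp add: is_marks_def)
  also have "(\<Sum>i\<in>hatI T. of_nat (a i) * (2 * dd T i) * of_int (Csig T i j)) =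
      rat_of_int (\<Sum>i\<in>hatI T. int (d2 i) * Csig T i j * int (a i))"
    unfolding of_int_sum
  proof (rule sum.cong[OF refl])
    fix i assume "i \<in> hatI T"
    then show "of_nat (a i) * (2 * dd T i) * of_int (Csig T i j) =
        rat_of_int (int (d2 i) * Csig T i j * int (a i))"
      by (simp only: d2(2)) simp
  qed
  finally have sum: "(\<Sum>i\<in>hatI T. int (d2 i) * Csig T i j * int (a i)) = 0"
    by (simp only: of_int_eq_0_iff)
  have "(\<Prod>i\<in>hatI T. (qi T i powi Csig T i j) ^ a i) =
      (\<Prod>i\<in>hatI T. sqrt_q T powi (int (d2 i) * Csig T i j * int (a i)))"
    by (intro prod.cong) (simp_all add: qi_powi power_int_mult)
  also have "\<dots> = sqrt_q T powi (\<Sum>i\<in>hatI T. int (d2 i) * Csig T i j * int (a i))"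
    using finite_hatI by (induction rule: finite_induct) (simp_all add: power_int_add sqrt_q_nonzero)
  finally show ?thesis by (simp add: sum)
qed

lemma qint_eq:
  assumes "i \<in> hatI T" shows "qint T (dd T i) (of_nat m) = qnum (qi T i) m"
proof -
  have dd: "dd T i = of_nat (d2 i) / 2" using d2(2)[OF assms] by simp
  have "\<lfloor>- rat_of_nat n\<rfloor> = - int n" for n
    using floor_of_int[of "- int n", where 'a = rat] by simp
  then have "\<lfloor>2 * (dd T i * of_nat m)\<rfloor> = int (d2 i * m)" "\<lfloor>2 * (- dd T i * of_nat m)\<rfloor> = - int (d2 i * m)"
    "\<lfloor>2 * dd T i\<rfloor> = int (d2 i)" "\<lfloor>2 * - dd T i\<rfloor> = - int (d2 i)"
    unfolding dd by (simp_all flip: of_nat_mult)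
  then show ?thesis
    unfolding qint_def qpow_def qnum_def qi_eq[OF assms]
    by (simp only: power_int_minus power_int_of_nat power_mult power_inverse)
qed

lemma qbinom_eq: "i \<in> hatI T \<Longrightarrow> qbinom T (dd T i) n r = qbin (qi T i) n r"
  by (simp add: qbinom_def qbin_def qfact_def qfac_def qint_eq)

text \<open>One less than the degree in e_i of the Serre relation, to match the form
  \<open>Suc n\<close> in the commutation lemmas.\<close>

definition serre_order :: "nat \<Rightarrow> nat \<Rightarrow> nat" where
  "serre_order i j = nat (- Csig T i j)"

lemma serre_order:
  assumes "i \<in> hatI T" "j \<in> hatI T" "i \<noteq> j"
  shows "nat (1 - Csig T i j) = Suc (serre_order i j)" "Csig T i j = - int (serre_order i j)"
  using Csig_nonpos[OF assms] by (simp_all add: serre_order_def)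

lemma word_eval_serre:
  assumes "i \<in> hatI T" "j \<in> hatI T" "i \<noteq> j"
  shows "word_eval g (serre T s i j) = qserre (qi T i) (Suc (serre_order i j)) (g (E s i)) (g (E s j))"
  using assms
  by (simp add: serre_def Let_def serre_order(1) qserre_def word_eval_hom qbinom_eq scaleC_mult_left
      del: sum.atMost_Suc)

definition borel_letters :: "gen set" where
  "borel_letters = (\<Union>j\<in>hatI T. {E Plus j, K Plus j, K Minus j})"

lemma Uq_borel_eq: "Uq_borel T g = gen_subalgebra (g ` borel_letters)"
  by (simp add: Uq_borel_def borel_letters_def image_UN)

text \<open>The defining relations that involve Borel generators only. That they account for all
  relations of the subalgebra is the content of \<open>borel_kernel\<close>.\<close>

definition borel_rep :: "(nat \<Rightarrow> nat) \<Rightarrow> (gen \<Rightarrow> 'a::unital_algebra) \<Rightarrow> bool" where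
  "borel_rep a X \<longleftrightarrow>
    (\<forall>i\<in>hatI T. X (K Plus i) * X (K Minus i) = 1 \<and> X (K Minus i) * X (K Plus i) = 1) \<and>
    (\<forall>i\<in>hatI T. \<forall>j\<in>hatI T. X (K Plus i) * X (K Plus j) = X (K Plus j) * X (K Plus i)) \<and>
    (\<forall>i\<in>hatI T. \<forall>j\<in>hatI T. X (K Plus i) * X (E Plus j) =
       (qi T i powi Csig T i j) *\<^sub>C (X (E Plus j) * X (K Plus i))) \<and>
    (\<forall>i\<in>hatI T. \<forall>j\<in>hatI T. i \<noteq> j \<longrightarrow>
       qserre (qi T i) (Suc (serre_order i j)) (X (E Plus i)) (X (E Plus j)) = 0) \<and>
    prod_list (map (\<lambda>i. X (K Plus i) ^ a i) (sorted_list_of_set (hatI T))) = 1"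

text \<open>Applied to the e_j with z = f_l, and to the f_j with z = e_l. The second use exchanges
  \<open>k\<close> and \<open>k'\<close>, which absorbs the sign of the commutator.\<close>

lemma serre_commute:
  fixes e f k k' :: "nat \<Rightarrow> 'a::unital_algebra"
  assumes ij: "i \<in> hatI T" "j \<in> hatI T" "i \<noteq> j"
    and kk': "\<And>l. l \<in> {i, j} \<Longrightarrow> k l * k' l = 1" "\<And>l. l \<in> {i, j} \<Longrightarrow> k' l * k l = 1"
    and ke: "\<And>l m. l \<in> {i, j} \<Longrightarrow> m \<in> {i, j} \<Longrightarrow> k l * e m = (qi T l powi Csig T l m) *\<^sub>C (e m * k l)"
    and ef: "\<And>m. m \<in> {i, j} \<Longrightarrow> e m * z = z * e m + (if m = l then c *\<^sub>C (k l - k' l) else 0)"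
  shows "qserre (qi T i) (Suc (serre_order i j)) (e i) (e j) * z =
    z * qserre (qi T i) (Suc (serre_order i j)) (e i) (e j)"
proof -
  let ?p = "qi T i" and ?n = "serre_order i j"
  have p: "generic ?p" using generic_qi ij by simp
  then have p0: "?p \<noteq> 0" by (simp add: generic_def)
  have C: "?p powi Csig T i j = inverse ?p ^ ?n"
    by (simp add: serre_order(2)[OF ij] power_int_minus power_inverse)
  have inv: "inverse (inverse ?p ^ ?n) = ?p ^ ?n" by (simp add: power_inverse)
  consider "l = i" | "l = j" | "l \<notin> {i, j}" by blast
  then show ?thesis
  proof cases
    case 1
    have kx: "k i * e i = ?p\<^sup>2 *\<^sub>C (e i * k i)"
      using ke[of i i] Csig_self[OF ij(1)] by simp
    have ky: "k i * e j = inverse ?p ^ ?n *\<^sub>C (e j * k i)"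
      using ke[of i j] by (simp add: C)
    have k'x: "k' i * e i = (inverse ?p)\<^sup>2 *\<^sub>C (e i * k' i)"
      using skew_commute_inverse[OF kk'(1) kk'(2) kx] p0 by (simp add: power_inverse)
    have k'y: "k' i * e j = ?p ^ ?n *\<^sub>C (e j * k' i)"
      using skew_commute_inverse[OF kk'(1) kk'(2) ky] p0 by (simp add: inv)
    show ?thesis
      by (rule qserre_commute_first[OF p _ _ kx k'x ky k'y, of z c]) (use ef[of i] ef[of j] 1 ij in simp_all)
  next
    case 2
    have kx: "k j * e i = inverse ?p ^ ?n *\<^sub>C (e i * k j)"
      using ke[of j i] by (simp add: C[symmetric] qi_powi_Csig_sym[OF ij(1,2)])
    have k'x: "k' j * e i = ?p ^ ?n *\<^sub>C (e i * k' j)"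
      using skew_commute_inverse[OF kk'(1) kk'(2) kx] p0 by (simp add: inv)
    show ?thesis
      by (rule qserre_commute_second[OF p _ _ kx k'x, of z _ c]) (use ef[of i] ef[of j] 2 ij in simp_all)
  next
    case 3
    then show ?thesis using ef[of i] ef[of j] by (intro commute_qserre) auto
  qed
qed

end

section \<open>Coinduction from the Borel part\<close>

text \<open>For a representation \<open>X\<close> of the Borel part, the functions from words in the \<open>f\<^sub>j = e\<^sub>j\<^sup>-\<close> to the
  representation space model the left \<open>\<U>(\<bb>)\<close>-linear maps from the full algebra: \<open>F w\<close> is the value
  at the product of the \<open>f\<^sub>j\<close> with the first letter of \<open>w\<close> rightmost, and the full algebra acts by right
  translation.\<close>

locale coinduction = twisted_data +
  fixes a :: "nat \<Rightarrow> nat" and X :: "gen \<Rightarrow> 'w::complex_vector endo"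
  assumes marks: "is_marks T a" and X: "borel_rep a X"
begin

text \<open>The value \<open>1\<close> outside \<open>hatI T\<close> makes the relation between the \<open>k\<^sub>i\<close> hold at words with
  arbitrary letters.\<close>

definition cf :: "nat \<Rightarrow> nat \<Rightarrow> complex" where
  "cf i j = (if i \<in> hatI T \<and> j \<in> hatI T then qi T i powi Csig T i j else 1)"

lemma cf_hat: "i \<in> hatI T \<Longrightarrow> j \<in> hatI T \<Longrightarrow> cf i j = qi T i powi Csig T i j"
  by (simp add: cf_def)

lemma cf_nonzero [simp]: "cf i j \<noteq> 0"
  using generic_qi by (auto simp: cf_def generic_def)

text \<open>The factor that arises when k_i is moved from the right of the product encoded by the
  word to its left.\<close>

primrec wt :: "nat \<Rightarrow> nat list \<Rightarrow> complex" where
  "wt i [] = 1"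
| "wt i (j # w) = cf i j * wt i w"

lemma wt_nonzero [simp]: "wt i w \<noteq> 0"
  by (induction w) simp_all

text \<open>Right translation by k_i or its inverse: once the element has passed the word, Borel
  linearity lets it act through \<open>X\<close>.\<close>

lift_definition kop :: "sign \<Rightarrow> nat \<Rightarrow> (nat list \<Rightarrow> 'w) endo" is
  "\<lambda>s i F w. wt i w powi sg s *\<^sub>C app (X (K s i)) (F w)"
  by (intro linear_onI) (simp_all add: fun_eq_iff app_add app_scale scaleC_apply scaleC_add_right
      scaleC_scaleC mult.commute)

lift_definition fop :: "nat \<Rightarrow> (nat list \<Rightarrow> 'w) endo" is "\<lambda>j F w. F (j # w)"
  by (intro linear_onI) (simp_all add: fun_eq_iff scaleC_apply)

definition cc :: "nat \<Rightarrow> complex" where "cc i = 1 / (qi T i - 1 / qi T i)"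

text \<open>Right translation by e_i, computed from f_j e_i = e_i f_j - [e_i, f_j]: the recursion
  moves e_i to the left through the word, where it acts through \<open>X\<close>.\<close>

primrec eact :: "nat \<Rightarrow> nat list \<Rightarrow> (nat list \<Rightarrow> 'w) \<Rightarrow> 'w" where
  "eact i [] F = app (X (E Plus i)) (F [])"
| "eact i (j # w) F = eact i w (app (fop j) F) -
     (if i = j then cc i *\<^sub>C (app (kop Plus i) F w - app (kop Minus i) F w) else 0)"

lemma eact_add: "eact i w (F + G) = eact i w F + eact i w G"
  by (induction w arbitrary: F G) (simp_all add: app_add scaleC_add_right cv.scale_right_diff_distrib)

lemma eact_scale: "eact i w (c *\<^sub>C F) = c *\<^sub>C eact i w F"
  by (induction w arbitrary: F)
    (simp_all add: app_scale scaleC_apply cv.scale_right_diff_distrib scaleC_scaleC mult.commute)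

lift_definition eop :: "nat \<Rightarrow> (nat list \<Rightarrow> 'w) endo" is "\<lambda>i F w. eact i w F"
  by (intro linear_onI) (simp_all add: fun_eq_iff eact_add eact_scale scaleC_apply)

lemma app_kop: "app (kop s i) F w = wt i w powi sg s *\<^sub>C app (X (K s i)) (F w)"
  by (simp add: kop.rep_eq)

lemma app_fop: "app (fop j) F w = F (j # w)"
  by (simp add: fop.rep_eq)

lemma app_eop_Nil: "app (eop i) F [] = app (X (E Plus i)) (F [])"
  by (simp add: eop.rep_eq)

lemma eop_fop: "eop i * fop j = fop j * eop i + (if i = j then cc i *\<^sub>C (kop Plus i - kop Minus i) else 0)"
  by (rule endo_eqI, rule ext)
    (simp add: eop.rep_eq fop.rep_eq scaleC_apply)

lemma X_kk: "i \<in> hatI T \<Longrightarrow> X (K Plus i) * X (K Minus i) = 1"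
    "i \<in> hatI T \<Longrightarrow> X (K Minus i) * X (K Plus i) = 1"
  and X_kcomm: "i \<in> hatI T \<Longrightarrow> j \<in> hatI T \<Longrightarrow> X (K Plus i) * X (K Plus j) = X (K Plus j) * X (K Plus i)"
  and X_ke: "i \<in> hatI T \<Longrightarrow> j \<in> hatI T \<Longrightarrow>
    X (K Plus i) * X (E Plus j) = (qi T i powi Csig T i j) *\<^sub>C (X (E Plus j) * X (K Plus i))"
  and X_serre: "i \<in> hatI T \<Longrightarrow> j \<in> hatI T \<Longrightarrow> i \<noteq> j \<Longrightarrow>
    qserre (qi T i) (Suc (serre_order i j)) (X (E Plus i)) (X (E Plus j)) = 0"
  and X_prod: "prod_list (map (\<lambda>i. X (K Plus i) ^ a i) (sorted_list_of_set (hatI T))) = 1"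
  using X by (auto simp: borel_rep_def)

lemma kop_kop:
  assumes "i \<in> hatI T"
  shows "kop Plus i * kop Minus i = 1" "kop Minus i * kop Plus i = 1"
proof -
  have "app (X (K Plus i)) (app (X (K Minus i)) v) = v" "app (X (K Minus i)) (app (X (K Plus i)) v) = v" for v
    using X_kk[OF assms] by (metis app_endo(2,6))+
  then show "kop Plus i * kop Minus i = 1" "kop Minus i * kop Plus i = 1"
    by (intro endo_eqI ext, simp add: app_kop app_scale scaleC_scaleC power_int_minus)+
qed

lemma kop_commute:
  assumes "i \<in> hatI T" "j \<in> hatI T"
  shows "kop Plus i * kop Plus j = kop Plus j * kop Plus i"
proof -
  have "app (X (K Plus i)) (app (X (K Plus j)) v) = app (X (K Plus j)) (app (X (K Plus i)) v)" for v
    using X_kcomm[OF assms] by (metis app_endo(6))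
  then show ?thesis
    by (intro endo_eqI ext) (simp add: app_kop app_scale scaleC_scaleC mult.commute)
qed

lemma kop_fop: "kop Plus i * fop j = inverse (cf i j) *\<^sub>C (fop j * kop Plus i)"
  by (intro endo_eqI ext) (simp add: app_kop app_fop scaleC_apply scaleC_scaleC)

lemma fop_kop: "fop j * kop Plus i = cf i j *\<^sub>C (kop Plus i * fop j)"
  by (simp add: kop_fop scaleC_scaleC)

lemma kop_Minus_fop: "i \<in> hatI T \<Longrightarrow> kop Minus i * fop j = cf i j *\<^sub>C (fop j * kop Minus i)"
  using skew_commute_inverse[OF kop_kop kop_fop] by simp

text \<open>The value of a function at \<open>l # w\<close> is the value at \<open>w\<close> of its
  translate by f_l. Induction on the word thus reduces operator identities to the empty word, that
  is, to the relations of \<open>X\<close>.\<close>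

lemma endo_eq_0:
  assumes Nil: "\<And>F. app A F [] = 0" and skew: "\<And>l. fop l * A = c l *\<^sub>C (A * fop l)"
  shows "A = 0"
proof -
  have "app A F w = 0" for F w
  proof (induction w arbitrary: F)
    case (Cons l w)
    have "app A F (l # w) = app (fop l * A) F w" by (simp add: app_fop)
    also have "\<dots> = 0" by (simp only: skew) (simp add: scaleC_apply Cons)
    finally show ?case .
  qed (rule Nil)
  then show ?thesis by (intro endo_eqI) (simp add: fun_eq_iff)
qed

lemma kop_eop:
  assumes ij: "i \<in> hatI T" "j \<in> hatI T"
  shows "kop Plus i * eop j = cf i j *\<^sub>C (eop j * kop Plus i)"
proof -
  have "kop Plus i * eop j - cf i j *\<^sub>C (eop j * kop Plus i) = 0" (is "?A = 0")
  proof (rule endo_eq_0[of _ "cf i"])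
    fix F :: "nat list \<Rightarrow> 'w"
    have "app (X (K Plus i) * X (E Plus j)) v = app (cf i j *\<^sub>C (X (E Plus j) * X (K Plus i))) v" for v
      by (simp only: X_ke[OF ij] cf_hat[OF ij])
    then show "app ?A F [] = 0"
      by (simp add: app_kop app_eop_Nil scaleC_apply)
  next
    fix l
    let ?d = "if j = l then cc j *\<^sub>C (kop Plus j - kop Minus j) else 0"
    have fe: "fop l * eop j = eop j * fop l - ?d" using eop_fop[of j l] by simp
    have km: "kop Plus i * kop Minus j = kop Minus j * kop Plus i"
    proof -
      have "kop Plus j * kop Plus i = 1 *\<^sub>C (kop Plus i * kop Plus j)"
        by (simp add: kop_commute[OF ij])
      from skew_commute_inverse[OF kop_kop[OF ij(2)] this] show ?thesis by simp
    qed
    have kd: "kop Plus i * ?d = ?d * kop Plus i"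
      using kop_commute[OF ij] km
      by (auto simp: scaleC_mult_left scaleC_mult_right left_diff_distrib right_diff_distrib)
    have "fop l * ?A = (fop l * kop Plus i) * eop j - cf i j *\<^sub>C ((fop l * eop j) * kop Plus i)"
      by (simp only: right_diff_distrib scaleC_mult_right mult.assoc)
    also have "\<dots> = cf i l *\<^sub>C (kop Plus i * (fop l * eop j)) - cf i j *\<^sub>C ((fop l * eop j) * kop Plus i)"
      by (simp only: fop_kop scaleC_mult_left mult.assoc)
    also have "\<dots> = cf i l *\<^sub>C (kop Plus i * eop j * fop l) - cf i j *\<^sub>C (eop j * (fop l * kop Plus i))
        - (cf i l *\<^sub>C (kop Plus i * ?d) - cf i j *\<^sub>C (?d * kop Plus i))"
      by (simp only: fe left_diff_distrib right_diff_distrib cv.scale_right_diff_distrib mult.assoc) simp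
    \<comment> \<open>Either \<open>?d\<close> is 0, or j = l and the two scalars agree.\<close>
    also have "cf i l *\<^sub>C (kop Plus i * ?d) - cf i j *\<^sub>C (?d * kop Plus i) = 0"
      by (simp only: kd) simp
    also have "cf i l *\<^sub>C (kop Plus i * eop j * fop l) - cf i j *\<^sub>C (eop j * (fop l * kop Plus i)) - 0 =
        cf i l *\<^sub>C (?A * fop l)"
      by (simp add: fop_kop scaleC_mult_left scaleC_mult_right scaleC_scaleC left_diff_distrib
          cv.scale_right_diff_distrib mult.assoc mult.commute)
    finally show "fop l * ?A = cf i l *\<^sub>C (?A * fop l)" .
  qed
  then show ?thesis by simp
qed

lemma app_power_eop_Nil: "app (eop i ^ n) F [] = app (X (E Plus i) ^ n) (F [])"
  by (induction n) (simp_all add: app_eop_Nil)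

text \<open>At the empty word this is the Serre relation of \<open>X\<close>; commutation with every
  \<open>fop l\<close> propagates it to all words.\<close>

lemma eop_serre:
  assumes ij: "i \<in> hatI T" "j \<in> hatI T" "i \<noteq> j"
  shows "qserre (qi T i) (Suc (serre_order i j)) (eop i) (eop j) = 0" (is "?S = 0")
proof (rule endo_eq_0[of _ "\<lambda>_. 1"])
  fix F :: "nat list \<Rightarrow> 'w"
  have "app ?S F [] = app (qserre (qi T i) (Suc (serre_order i j)) (X (E Plus i)) (X (E Plus j))) (F [])"
    unfolding qserre_def app_sum sum_fun_apply
    by (simp add: scaleC_apply app_power_eop_Nil app_eop_Nil del: sum.atMost_Suc)
  then show "app ?S F [] = 0" using X_serre[OF ij] by simp
next
  fix l
  have "?S * fop l = fop l * ?S"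
    by (rule serre_commute[where k = "kop Plus" and k' = "kop Minus" and c = "cc l" and l = l])
      (use ij in \<open>auto simp: kop_kop kop_eop cf_hat eop_fop\<close>)
  then show "fop l * ?S = 1 *\<^sub>C (?S * fop l)" by simp
qed

lemma fop_serre_commute_eop:
  assumes ij: "i \<in> hatI T" "j \<in> hatI T" "i \<noteq> j"
  shows "qserre (qi T i) (Suc (serre_order i j)) (fop i) (fop j) * eop l =
    eop l * qserre (qi T i) (Suc (serre_order i j)) (fop i) (fop j)"
  by (rule serre_commute[where k = "kop Minus" and k' = "kop Plus" and c = "cc l" and l = l])
    (use ij in \<open>auto simp: kop_kop kop_Minus_fop cf_hat eop_fop cv.scale_right_diff_distrib\<close>)

lemma wt_marks: "(\<Prod>i\<in>hatI T. wt i w ^ a i) = 1"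
proof (induction w)
  case (Cons j w)
  have "(\<Prod>i\<in>hatI T. cf i j ^ a i) = 1"
    using marks_power[OF marks, of j] by (cases "j \<in> hatI T") (simp_all add: cf_def)
  then show ?case using Cons by (simp add: power_mult_distrib prod.distrib)
qed simp

lemma app_kop_power: "app (kop Plus i ^ n) F w = wt i w ^ n *\<^sub>C app (X (K Plus i) ^ n) (F w)"
  by (induction n) (simp_all add: app_kop app_scale scaleC_scaleC scaleC_one)

lemma app_kop_prod: "app (prod_list (map (\<lambda>i. kop Plus i ^ a i) is)) F w =
    prod_list (map (\<lambda>i. wt i w ^ a i) is) *\<^sub>C app (prod_list (map (\<lambda>i. X (K Plus i) ^ a i) is)) (F w)"
  by (induction "is" arbitrary: F)
    (simp_all add: app_kop_power app_scale scaleC_scaleC scaleC_one)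

lemma kop_prod: "prod_list (map (\<lambda>i. kop Plus i ^ a i) (sorted_list_of_set (hatI T))) = 1"
proof -
  have "prod_list (map (\<lambda>i. wt i w ^ a i) (sorted_list_of_set (hatI T))) = 1" for w
    using wt_marks[of w] finite_hatI
    by (simp add: prod.distinct_set_conv_list[symmetric])
  then show ?thesis
    by (intro endo_eqI ext) (simp add: app_kop_prod X_prod scaleC_one)
qed

end

section \<open>The action of the full algebra and its invariant subspace\<close>

context coinduction
begin

fun act_full :: "gen \<Rightarrow> (nat list \<Rightarrow> 'w) endo" where
  "act_full (E Plus i) = eop i"
| "act_full (E Minus i) = fop i"
| "act_full (K s i) = kop s i"

definition fserre :: "nat \<Rightarrow> nat \<Rightarrow> (nat list \<Rightarrow> 'w) endo" where
  "fserre i j = qserre (qi T i) (Suc (serre_order i j)) (fop i) (fop j)"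

definition fprod :: "nat list \<Rightarrow> (nat list \<Rightarrow> 'w) endo" where
  "fprod ys = prod_list (map fop ys)"

text \<open>The Serre relations of the \<open>f\<^sub>j\<close> only hold on a subspace. It is invariant as the Serre
  elements of the \<open>f\<^sub>j\<close> commute with the \<open>e\<^sub>i\<close>.\<close>

definition W :: "(nat list \<Rightarrow> 'w) set" where
  "W = {F. \<forall>ys. \<forall>i\<in>hatI T. \<forall>j\<in>hatI T. i \<noteq> j \<longrightarrow> app (fserre i j * fprod ys) F = 0}"

lemma W_I:
  assumes "\<And>ys i j. i \<in> hatI T \<Longrightarrow> j \<in> hatI T \<Longrightarrow> i \<noteq> j \<Longrightarrow> app (fserre i j * fprod ys) F = 0"
  shows "F \<in> W"
  using assms by (simp add: W_def)

lemma W_D: "F \<in> W \<Longrightarrow> i \<in> hatI T \<Longrightarrow> j \<in> hatI T \<Longrightarrow> i \<noteq> j \<Longrightarrow> app (fserre i j * fprod ys) F = 0"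
  by (simp add: W_def)

lemma W_serre: "F \<in> W \<Longrightarrow> i \<in> hatI T \<Longrightarrow> j \<in> hatI T \<Longrightarrow> i \<noteq> j \<Longrightarrow> app (fserre i j) F = 0"
  using W_D[of F i j "[]"] by (simp add: fprod_def)

lemma W_scale: "F \<in> W \<Longrightarrow> c *\<^sub>C F \<in> W"
  by (simp add: W_def app_scale)

lemma W_diff: "F \<in> W \<Longrightarrow> G \<in> W \<Longrightarrow> F - G \<in> W"
  by (simp add: W_def app_diff)

lemma fprod_snoc: "fprod (ys @ [l]) = fprod ys * fop l"
  by (simp add: fprod_def)

lemma W_fop:
  assumes "F \<in> W" shows "app (fop l) F \<in> W"
proof (rule W_I)
  fix ys i j assume "i \<in> hatI T" "j \<in> hatI T" "i \<noteq> j"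
  then have "app (fserre i j * fprod (ys @ [l])) F = 0" by (rule W_D[OF assms])
  then show "app (fserre i j * fprod ys) (app (fop l) F) = 0" by (simp add: fprod_snoc)
qed

lemma W_kop:
  assumes "F \<in> W" "l \<in> hatI T" shows "app (kop s l) F \<in> W"
proof (rule W_I)
  fix ys i j assume ij: "i \<in> hatI T" "j \<in> hatI T" "i \<noteq> j"
  have "\<exists>c. c \<noteq> 0 \<and> kop s l * fop m = c *\<^sub>C (fop m * kop s l)" for m
    using kop_fop[of l m] kop_Minus_fop[OF assms(2), of m] cf_nonzero by (cases s) (metis inverse_nonzero_iff_nonzero)+
  then obtain c where c: "\<And>m. c m \<noteq> 0" "\<And>m. kop s l * fop m = c m *\<^sub>C (fop m * kop s l)"
    by metis
  have fk: "fop m * kop s l = inverse (c m) *\<^sub>C (kop s l * fop m)" for m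
    by (simp add: c scaleC_scaleC)
  define d where "d = c i ^ Suc (serre_order i j) * c j"
  have d: "d \<noteq> 0" "kop s l * fserre i j = d *\<^sub>C (fserre i j * kop s l)"
    unfolding fserre_def d_def using c(1) by (simp, intro skew_commute_qserre c(2))
  have "app (fserre i j * fprod ys) (app (kop s l) F) = 0" if "F \<in> W" for F
    using that
  proof (induction ys arbitrary: F rule: rev_induct)
    case Nil
    have "d *\<^sub>C app (fserre i j) (app (kop s l) F) = app (kop s l * fserre i j) F"
      unfolding d(2) by simp
    also have "\<dots> = 0" using W_serre[OF Nil ij] by simp
    finally show ?case using d(1) by (simp add: fprod_def)
  next
    case (snoc m ys)
    have "app (fserre i j * fprod (ys @ [m])) (app (kop s l) F) =
        app (fserre i j * fprod ys) (app (fop m * kop s l) F)" by (simp add: fprod_snoc)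
    also have "\<dots> = inverse (c m) *\<^sub>C app (fserre i j * fprod ys) (app (kop s l) (app (fop m) F))"
      unfolding fk by (simp add: app_scale)
    also have "\<dots> = 0" by (simp only: snoc.IH[OF W_fop[OF snoc.prems]] cv.scale_zero_right)
    finally show ?case .
  qed
  then show "app (fserre i j * fprod ys) (app (kop s l) F) = 0" using assms(1) .
qed

text \<open>Moving e_l to the left past the factors of \<open>fprod ys\<close> leaves corrections in
  k_l and its inverse, which stay in \<open>W\<close> by \<open>W_kop\<close>; past the Serre
  element e_l commutes.\<close>

lemma W_eop:
  assumes "F \<in> W" "l \<in> hatI T" shows "app (eop l) F \<in> W"
proof (rule W_I)
  fix ys i j assume ij: "i \<in> hatI T" "j \<in> hatI T" "i \<noteq> j"
  have "app (fserre i j * fprod ys) (app (eop l) F) = 0" if "F \<in> W" for F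
    using that
  proof (induction ys arbitrary: F rule: rev_induct)
    case Nil
    have "app (fserre i j) (app (eop l) F) = app (fserre i j * eop l) F" by simp
    also have "fserre i j * eop l = eop l * fserre i j"
      unfolding fserre_def by (rule fop_serre_commute_eop[OF ij])
    also have "app (eop l * fserre i j) F = app (eop l) (app (fserre i j) F)" by simp
    also have "\<dots> = 0" using W_serre[OF Nil ij] by simp
    finally show ?case by (simp add: fprod_def)
  next
    case (snoc m ys)
    define G where "G = (if l = m then cc l *\<^sub>C (app (kop Plus l) F - app (kop Minus l) F) else 0)"
    have G: "G \<in> W"
    proof (cases "l = m")
      case True
      have "cc l *\<^sub>C (app (kop Plus l) F - app (kop Minus l) F) \<in> W"
        by (intro W_scale W_diff W_kop snoc.prems assms(2))
      then show ?thesis using True by (simp add: G_def)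
    qed (simp add: G_def W_def)
    have "app (fop m) (app (eop l) F) = app (eop l) (app (fop m) F) - G"
      using arg_cong[OF eop_fop[of l m], of "\<lambda>A. app A F"] by (simp add: G_def split: if_splits)
    then have "app (fserre i j * fprod (ys @ [m])) (app (eop l) F) =
        app (fserre i j * fprod ys) (app (eop l) (app (fop m) F)) - app (fserre i j * fprod ys) G"
      by (simp add: fprod_snoc app_diff)
    also have "\<dots> = 0" by (simp only: snoc.IH[OF W_fop[OF snoc.prems]] W_D[OF G ij] diff_self)
    finally show ?case .
  qed
  then show "app (fserre i j * fprod ys) (app (eop l) F) = 0" using assms(1) .
qed

lemma W_letters:
  assumes "set ls \<subseteq> gens T" "F \<in> W" shows "app (prod_list (map act_full ls)) F \<in> W"
  using assms(1)
proof (induction ls)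
  case (Cons x ls)
  then have "app (prod_list (map act_full ls)) F \<in> W" by simp
  moreover have "app (act_full x) G \<in> W" if "G \<in> W" for G
  proof (cases x)
    case (E s i)
    then show ?thesis using Cons.prems that W_eop W_fop by (cases s) (auto simp: gens_def)
  next
    case (K s i)
    then show ?thesis using Cons.prems that W_kop by (auto simp: gens_def)
  qed
  ultimately show ?case by simp
qed (simp add: assms(2))

lemma W_word_eval:
  assumes "p \<in> free_on (gens T)" "F \<in> W" shows "app (word_eval act_full p) F \<in> W"
proof -
  have "cv.subspace W"
    unfolding cv.subspace_def by (simp add: W_def app_add app_scale)
  then show ?thesis
    unfolding app_word_eval using assms
    by (intro cv.subspace_sum cv.subspace_scale W_letters) (auto simp: free_on_def)
qed

text \<open>Membership in \<open>W\<close> enters only for the Serre relators of the f_j; all other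
  relators act as 0 on every function.\<close>

lemma act_full_relator:
  assumes "r \<in> relators T a" "F \<in> W"
  shows "app (word_eval act_full r) F = 0"
  using assms(1) unfolding relators_def Un_iff
proof (elim disjE)
  assume "r \<in> {Kv Plus i * Kv Minus i - 1 |i. i \<in> hatI T}"
  then show ?thesis by (auto simp: word_eval_hom kop_kop)
next
  assume "r \<in> {Kv Minus i * Kv Plus i - 1 |i. i \<in> hatI T}"
  then show ?thesis by (auto simp: word_eval_hom kop_kop)
next
  assume "r \<in> {Kv Plus i * Kv Plus j - Kv Plus j * Kv Plus i |i j. i \<in> hatI T \<and> j \<in> hatI T}"
  then obtain i j where "i \<in> hatI T" "j \<in> hatI T" "r = Kv Plus i * Kv Plus j - Kv Plus j * Kv Plus i" by blast
  then have "word_eval act_full r = 0" using kop_commute[of i j] by (simp add: word_eval_hom)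
  then show ?thesis by simp
next
  assume "r \<in> {Kv Plus i * Ev s j - free_const (qi T i powi (sg s * Csig T i j)) * Ev s j * Kv Plus i
     |s i j. i \<in> hatI T \<and> j \<in> hatI T}"
  then obtain s i j where ij: "i \<in> hatI T" "j \<in> hatI T"
    and r: "r = Kv Plus i * Ev s j - free_const (qi T i powi (sg s * Csig T i j)) * Ev s j * Kv Plus i" by blast
  have "word_eval act_full r = 0"
    using kop_eop[OF ij] kop_fop[of i j] unfolding r
    by (cases s) (simp_all add: word_eval_hom scaleC_mult_left cf_hat[OF ij] power_int_minus)
  then show ?thesis by simp
next
  assume "r \<in> {Ev Plus i * Ev Minus j - Ev Minus j * Ev Plus i -
      (if i = j then free_const (1 / (qi T i - 1 / qi T i)) * (Kv Plus i - Kv Minus i) else 0)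
     |i j. i \<in> hatI T \<and> j \<in> hatI T}"
  then obtain i j where
    r: "r = Ev Plus i * Ev Minus j - Ev Minus j * Ev Plus i -
      (if i = j then free_const (1 / (qi T i - 1 / qi T i)) * (Kv Plus i - Kv Minus i) else 0)" by blast
  have "word_eval act_full r = 0"
    using eop_fop[of i j] unfolding r
    by (simp add: word_eval_hom scaleC_mult_left cc_def)
  then show ?thesis by simp
next
  assume "r \<in> {serre T s i j |s i j. i \<in> hatI T \<and> j \<in> hatI T \<and> i \<noteq> j}"
  then obtain s i j where ij: "i \<in> hatI T" "j \<in> hatI T" "i \<noteq> j" and r: "r = serre T s i j" by blast
  show ?thesis
    unfolding r word_eval_serre[OF ij]
    using eop_serre[OF ij] W_serre[OF assms(2) ij] by (cases s) (simp_all add: fserre_def)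
next
  assume "r \<in> {prod_list (map (\<lambda>i. Kv Plus i ^ a i) (sorted_list_of_set (hatI T))) - 1}"
  then have "word_eval act_full r = 0"
    using kop_prod by (simp add: word_eval_hom comp_def)
  then show ?thesis by simp
qed

text \<open>Embeds the representation space into the functions on words; the value at the empty word
  recovers the vector.\<close>

definition delta :: "'w \<Rightarrow> nat list \<Rightarrow> 'w" where
  "delta v w = (if w = [] then v else 0)"

lemma app_fop_delta [simp]: "app (fop l) (delta v) = 0"
  by (simp add: fun_eq_iff app_fop delta_def)

text \<open>In every term of a Serre element, and in a nonempty \<open>fprod ys\<close>, the factor
  applied first is some \<open>fop\<close>, which kills \<open>delta v\<close>.\<close>

lemma delta_W: "delta v \<in> W"
proof (rule W_I)
  fix ys i j
  have pow: "app (fop i ^ r) (delta v) = 0" if "r > 0" for r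
    using that by (cases r) (simp_all add: power_Suc2 del: power_Suc)
  have "app (fop i ^ (n - r) * fop j * fop i ^ r) (delta v) = 0" for n r
    using pow[of r] by (cases "r = 0") simp_all
  then have "app (fserre i j) (delta v) = 0"
    by (simp add: fserre_def qserre_def app_sum del: sum.atMost_Suc)
  then show "app (fserre i j * fprod ys) (delta v) = 0"
    by (cases ys rule: rev_cases) (simp_all add: fprod_def)
qed

text \<open>For Borel letters the value at the empty word depends only on the previous value there,
  so evaluation at the empty word intertwines the coinduced action with \<open>X\<close>.\<close>

lemma app_act_full_Nil:
  assumes "set ls \<subseteq> borel_letters"
  shows "app (prod_list (map act_full ls)) F [] = app (prod_list (map X ls)) (F [])"
  using assms
proof (induction ls)
  case (Cons x ls)
  then have "x \<in> borel_letters" by simp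
  then have "app (act_full x) G [] = app (X x) (G [])" for G
    by (auto simp: borel_letters_def app_eop_Nil app_kop scaleC_one)
  then show ?case using Cons by simp
qed simp

lemma borel_kernel:
  fixes g :: "gen \<Rightarrow> 'u::complex_algebra_1"
  assumes g: "is_Uq T a g" and p: "p \<in> free_on borel_letters" "word_eval g p = 0"
  shows "word_eval X p = 0"
proof -
  \<comment> \<open>\<open>?J\<close> is closed under right multiplication because expressions in
    the generators preserve \<open>W\<close>.\<close>
  let ?J = "{p. \<forall>F\<in>W. app (word_eval act_full p) F = 0}"
  have "borel_letters \<subseteq> gens T" by (auto simp: borel_letters_def gens_def)
  then have "p \<in> {p \<in> free_on (gens T). free_eval g p = 0}"
    using p free_on_mono by (auto simp: free_eval_eq)
  then have "p \<in> ideal_in (free_on (gens T)) (relators T a)"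
    using g by (simp only: is_Uq_def presented_by_def)
  also have "\<dots> \<subseteq> ?J"
    by (rule ideal_in_subset)
      (auto simp: word_eval_hom act_full_relator W_word_eval)
  finally have 0: "app (word_eval act_full p) (delta v) = 0" for v
    using delta_W by blast
  show ?thesis
  proof (rule endo_eqI)
    fix v
    have "app (word_eval X p) v = app (word_eval act_full p) (delta v) []"
      unfolding app_word_eval sum_fun_apply scaleC_apply using p(1)
      by (intro sum.cong refl, subst app_act_full_Nil) (auto simp: free_on_def delta_def)
    then show "app (word_eval X p) v = app 0 v" by (simp add: 0)
  qed
qed

end

section \<open>Eliminating the affine Cartan generator\<close>

lemma skew_commute_prod_list:
  fixes k :: "'i \<Rightarrow> 'a::unital_algebra"
  assumes "\<And>i. i \<in> set is \<Longrightarrow> k i * x = c i *\<^sub>C (x * k i)"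
  shows "prod_list (map (\<lambda>i. k i ^ a i) is) * x =
    prod_list (map (\<lambda>i. c i ^ a i) is) *\<^sub>C (x * prod_list (map (\<lambda>i. k i ^ a i) is))"
  using assms
proof (induction "is")
  case (Cons i "is")
  have pow: "k i ^ n * x = c i ^ n *\<^sub>C (x * k i ^ n)" for n
  proof (induction n)
    case (Suc n)
    have "k i ^ Suc n * x = k i ^ n * (k i * x)" by (simp add: power_Suc2 mult.assoc del: power_Suc)
    also have "\<dots> = c i *\<^sub>C ((k i ^ n * x) * k i)"
      using Cons.prems by (simp add: scaleC_mult_right mult.assoc)
    also have "\<dots> = c i ^ Suc n *\<^sub>C (x * k i ^ Suc n)"
      by (simp add: Suc scaleC_mult_left scaleC_scaleC power_Suc2 mult.assoc del: power_Suc)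
    finally show ?case .
  qed (simp add: scaleC_one)
  let ?P = "prod_list (map (\<lambda>i. k i ^ a i) is)" and ?c = "prod_list (map (\<lambda>i. c i ^ a i) is)"
  have "k i ^ a i * ?P * x = k i ^ a i * (?P * x)" by (simp add: mult.assoc)
  also have "\<dots> = ?c *\<^sub>C ((k i ^ a i * x) * ?P)"
    using Cons by (simp add: scaleC_mult_right mult.assoc)
  also have "\<dots> = (c i ^ a i * ?c) *\<^sub>C (x * (k i ^ a i * ?P))"
    by (simp add: pow scaleC_mult_left scaleC_scaleC mult.assoc mult.commute)
  finally show ?case by simp
qed (simp add: scaleC_one)

lemma prod_list_power_inverse:
  fixes k k' :: "'i \<Rightarrow> 'a::unital_algebra"
  assumes "\<And>i. i \<in> set is \<Longrightarrow> k i * k' i = 1"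
    and "\<And>i j. i \<in> set is \<Longrightarrow> j \<in> set is \<Longrightarrow> k j * k' i = k' i * k j"
  shows "prod_list (map (\<lambda>i. k i ^ a i) is) * prod_list (map (\<lambda>i. k' i ^ a i) is) = 1"
  using assms
proof (induction "is")
  case (Cons i "is")
  let ?P = "prod_list (map (\<lambda>i. k i ^ a i) is)" and ?P' = "prod_list (map (\<lambda>i. k' i ^ a i) is)"
  have comm: "?P * k' i = k' i * ?P"
    using skew_commute_prod_list[of "is" k "k' i" "\<lambda>_. 1" a] Cons.prems(2)
    by (simp add: scaleC_one map_replicate_const)
  have "(k i ^ a i * ?P) * (k' i ^ a i * ?P') = k i ^ a i * (?P * k' i ^ a i) * ?P'"
    by (simp add: mult.assoc)
  also have "?P * k' i ^ a i = k' i ^ a i * ?P"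
    using power_commuting_commutes[OF comm[symmetric]] by simp
  also have "k i ^ a i * (k' i ^ a i * ?P) * ?P' = (k i ^ a i * k' i ^ a i) * (?P * ?P')"
    by (simp add: mult.assoc)
  also have "k i ^ a i * k' i ^ a i = 1"
    using Cons.prems(1) by (intro left_right_inverse_power) simp
  finally have "(k i ^ a i * ?P) * (k' i ^ a i * ?P') = ?P * ?P'" by simp
  then show ?case using Cons by simp
qed simp

context twisted_data
begin

text \<open>As the mark at \<epsilon> is 1, the product relation forces k_\<epsilon> to be the
  inverse of the product of the k_j^(a_j) over the other nodes.\<close>

definition borel_extend ::
  "(nat \<Rightarrow> nat) \<Rightarrow> (nat \<Rightarrow> 'a) \<Rightarrow> (nat \<Rightarrow> 'a) \<Rightarrow> (nat \<Rightarrow> 'a) \<Rightarrow> gen \<Rightarrow> 'a::unital_algebra" where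
  "borel_extend a e k k' x = (case x of
     E s i \<Rightarrow> e i
   | K Plus i \<Rightarrow>
       if i = 0 then prod_list (map (\<lambda>j. k' j ^ a j) (sorted_list_of_set (Isig T))) else k i
   | K Minus i \<Rightarrow>
       if i = 0 then prod_list (map (\<lambda>j. k j ^ a j) (sorted_list_of_set (Isig T))) else k' i)"

lemma borel_rep_extend:
  fixes e k k' :: "nat \<Rightarrow> 'a::unital_algebra"
  assumes marks: "is_marks T a"
    and kk': "\<And>i. i \<in> Isig T \<Longrightarrow> k i * k' i = 1" "\<And>i. i \<in> Isig T \<Longrightarrow> k' i * k i = 1"
    and kk: "\<And>i j. i \<in> Isig T \<Longrightarrow> j \<in> Isig T \<Longrightarrow> k i * k j = k j * k i"
    and ke: "\<And>i j. i \<in> Isig T \<Longrightarrow> j \<in> hatI T \<Longrightarrow> k i * e j = (qi T i powi Csig T i j) *\<^sub>C (e j * k i)"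
    and serre: "\<And>i j. i \<in> hatI T \<Longrightarrow> j \<in> hatI T \<Longrightarrow> i \<noteq> j \<Longrightarrow>
      qserre (qi T i) (Suc (serre_order i j)) (e i) (e j) = 0"
  shows "borel_rep a (borel_extend a e k k')"
proof -
  define "is" where "is = sorted_list_of_set (Isig T)"
  have finI: "finite (Isig T)" using finite_hatI by (simp add: hatI_def)
  have is_set: "set is = Isig T" "distinct is" by (simp_all add: is_def finI)
  \<comment> \<open>The affine node 0 is the smallest index, so its factor comes first in the
    product relation.\<close>
  have list: "sorted_list_of_set (hatI T) = 0 # is"
  proof -
    have "sorted_list_of_set (insert 0 (Isig T)) = insort 0 (sorted_list_of_set (Isig T - {0}))"
      using finI by (rule sorted_list_of_set_insert_remove)
    moreover have "insort 0 xs = 0 # xs" for xs :: "nat list" by (cases xs) simp_all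
    ultimately show ?thesis using eps_notin_Isig by (simp add: hatI_def is_def)
  qed
  define P where "P = prod_list (map (\<lambda>j. k j ^ a j) is)"
  define P' where "P' = prod_list (map (\<lambda>j. k' j ^ a j) is)"
  have nz: "i \<noteq> 0" if "i \<in> Isig T" for i using that eps_notin_Isig by metis
  let ?X = "borel_extend a e k k'"
  have XE: "?X (E s i) = e i" and X0: "?X (K Plus 0) = P'" "?X (K Minus 0) = P"
    and XK: "i \<noteq> 0 \<Longrightarrow> ?X (K Plus i) = k i" "i \<noteq> 0 \<Longrightarrow> ?X (K Minus i) = k' i" for s i
    by (simp_all add: borel_extend_def P_def P'_def is_def)
  have kk'_comm: "k j * k' i = k' i * k j" if "i \<in> Isig T" "j \<in> Isig T" for i j
  proof -
    have "k i * k j = 1 *\<^sub>C (k j * k i)" using kk that by (simp add: scaleC_one)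
    from skew_commute_inverse[OF kk' this] that show ?thesis by (simp add: scaleC_one)
  qed
  have PP': "P * P' = 1" "P' * P = 1"
    unfolding P_def P'_def using kk' kk'_comm is_set
    by (auto intro!: prod_list_power_inverse)
  have kP: "k i * P' = P' * k i" if "i \<in> Isig T" for i
    using skew_commute_prod_list[of "is" k' "k i" "\<lambda>_. 1" a] kk'_comm that is_set
    by (simp add: scaleC_one P'_def map_replicate_const)
  have Pe: "P' * e j = (qi T 0 powi Csig T 0 j) *\<^sub>C (e j * P')" if j: "j \<in> hatI T" for j
  proof -
    let ?c = "prod_list (map (\<lambda>i. (qi T i powi Csig T i j) ^ a i) is)"
    have "P * e j = ?c *\<^sub>C (e j * P)"
      unfolding P_def by (rule skew_commute_prod_list) (use ke j is_set in auto)
    \<comment> \<open>By \<open>marks_power\<close> the factor of k_\<epsilon> against e_j is the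
      inverse of the joint factor of the other k_i.\<close>
    moreover have c: "qi T 0 powi Csig T 0 j * ?c = 1"
    proof -
      have "(\<Prod>i\<in>insert 0 (Isig T). (qi T i powi Csig T i j) ^ a i) = 1"
        using marks_power[OF marks j] by (simp add: hatI_def)
      then show ?thesis
        using finI eps_notin_Isig marks is_set
        by (simp add: is_marks_def prod.distinct_set_conv_list[of "is", unfolded is_set, OF is_set(2)])
    qed
    then have "?c \<noteq> 0" by auto
    ultimately have "P' * e j = inverse ?c *\<^sub>C (e j * P')"
      using skew_commute_inverse[OF PP'] by blast
    moreover have "inverse ?c = qi T 0 powi Csig T 0 j"
      using c by (metis inverse_unique mult.commute)
    ultimately show ?thesis by simp
  qed
  have hat: "i \<in> hatI T \<Longrightarrow> i = 0 \<or> i \<in> Isig T" for i by (auto simp: hatI_def)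
  show ?thesis
    unfolding borel_rep_def
  proof (intro conjI ballI impI)
    fix i assume "i \<in> hatI T"
    then show "?X (K Plus i) * ?X (K Minus i) = 1" "?X (K Minus i) * ?X (K Plus i) = 1"
      using hat[of i] PP' kk' nz by (auto simp: X0 XK)
  next
    fix i j assume "i \<in> hatI T" "j \<in> hatI T"
    then show "?X (K Plus i) * ?X (K Plus j) = ?X (K Plus j) * ?X (K Plus i)"
      using hat[of i] hat[of j] kk kP nz by (auto simp: X0 XK)
  next
    fix i j assume "i \<in> hatI T" "j \<in> hatI T"
    then show "?X (K Plus i) * ?X (E Plus j) = (qi T i powi Csig T i j) *\<^sub>C (?X (E Plus j) * ?X (K Plus i))"
      using hat[of i] ke Pe nz by (auto simp: X0 XK XE)
  next
    fix i j assume "i \<in> hatI T" "j \<in> hatI T" "i \<noteq> j"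
    then show "qserre (qi T i) (Suc (serre_order i j)) (?X (E Plus i)) (?X (E Plus j)) = 0"
      using serre by (simp add: XE)
  next
    have "prod_list (map (\<lambda>i. ?X (K Plus i) ^ a i) is) = P"
      unfolding P_def by (intro arg_cong[of _ _ prod_list] map_cong) (use is_set nz XK in auto)
    then show "prod_list (map (\<lambda>i. ?X (K Plus i) ^ a i) (sorted_list_of_set (hatI T))) = 1"
      using marks PP' by (simp add: list X0 is_marks_def)
  qed
qed

end

section \<open>Constant terms of asymptotically polynomial sequences\<close>

text \<open>Degree and threshold are existential because both vary with the vector of the limit to
  which an operator is applied.\<close>

definition const_term :: "complex \<Rightarrow> (nat \<Rightarrow> 'w::complex_vector) \<Rightarrow> 'w \<Rightarrow> bool" where
  "const_term z F c \<longleftrightarrow>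
     (\<exists>n d. d 0 = c \<and> (\<forall>\<^sub>F k in sequentially. F k = (\<Sum>r\<le>n. z ^ (k * r) *\<^sub>C d r)))"

lemma const_termI:
  "\<forall>\<^sub>F k in sequentially. F k = (\<Sum>r\<le>n. z ^ (k * r) *\<^sub>C d r) \<Longrightarrow> const_term z F (d 0)"
  unfolding const_term_def by blast

lemma const_term_cong:
  assumes "const_term z F c" "\<forall>\<^sub>F k in sequentially. F k = G k" shows "const_term z G c"
proof -
  from assms(1) obtain n d where "d 0 = c" and
    *: "\<forall>\<^sub>F k in sequentially. F k = (\<Sum>r\<le>n. z ^ (k * r) *\<^sub>C d r)"
    unfolding const_term_def by blast
  moreover have "\<forall>\<^sub>F k in sequentially. G k = (\<Sum>r\<le>n. z ^ (k * r) *\<^sub>C d r)"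
    using * assms(2) by eventually_elim simp
  ultimately show ?thesis unfolding const_term_def by blast
qed

lemma const_term_const: "const_term z (\<lambda>_. c) c"
  using const_termI[where F = "\<lambda>_. c" and n = 0 and d = "\<lambda>_. c"] by (simp add: scaleC_one)

lemma const_term_pad:
  assumes "const_term z F c"
  shows "\<exists>n d. d 0 = c \<and> (\<forall>m\<ge>n. \<forall>\<^sub>F k in sequentially. F k = (\<Sum>r\<le>m. z ^ (k * r) *\<^sub>C d r))"
proof -
  from assms obtain n d where d: "d 0 = c"
    "\<forall>\<^sub>F k in sequentially. F k = (\<Sum>r\<le>n. z ^ (k * r) *\<^sub>C d r)"
    unfolding const_term_def by blast
  let ?d = "\<lambda>r. if r \<le> n then d r else 0"
  have sum: "(\<Sum>r\<le>m. z ^ (k * r) *\<^sub>C ?d r) = (\<Sum>r\<le>n. z ^ (k * r) *\<^sub>C d r)" if "m \<ge> n" for m k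
    using that by (intro sum.mono_neutral_cong_right) auto
  show ?thesis
    by (rule exI[of _ n], rule exI[of _ ?d]) (use d in \<open>simp add: sum\<close>)
qed

lemma const_term_add:
  assumes "const_term z F c" "const_term z G e"
  shows "const_term z (\<lambda>k. F k + G k) (c + e)"
proof -
  obtain n d where d: "d 0 = c"
    "\<forall>m\<ge>n. \<forall>\<^sub>F k in sequentially. F k = (\<Sum>r\<le>m. z ^ (k * r) *\<^sub>C d r)"
    using const_term_pad[OF assms(1)] by blast
  obtain n' d' where d': "d' 0 = e"
    "\<forall>m\<ge>n'. \<forall>\<^sub>F k in sequentially. G k = (\<Sum>r\<le>m. z ^ (k * r) *\<^sub>C d' r)"
    using const_term_pad[OF assms(2)] by blast
  let ?m = "max n n'"
  have "\<forall>\<^sub>F k in sequentially. F k = (\<Sum>r\<le>?m. z ^ (k * r) *\<^sub>C d r)"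
    "\<forall>\<^sub>F k in sequentially. G k = (\<Sum>r\<le>?m. z ^ (k * r) *\<^sub>C d' r)"
    using d(2) d'(2) by simp_all
  then have "\<forall>\<^sub>F k in sequentially. F k + G k = (\<Sum>r\<le>?m. z ^ (k * r) *\<^sub>C (d r + d' r))"
    by eventually_elim (simp add: scaleC_add_right sum.distrib)
  from const_termI[OF this] show ?thesis using d d' by simp
qed

lemma const_term_scale:
  assumes "const_term z F c" shows "const_term z (\<lambda>k. e *\<^sub>C F k) (e *\<^sub>C c)"
proof -
  from assms obtain n d where "d 0 = c" and
    *: "\<forall>\<^sub>F k in sequentially. F k = (\<Sum>r\<le>n. z ^ (k * r) *\<^sub>C d r)"
    unfolding const_term_def by blast
  moreover have "\<forall>\<^sub>F k in sequentially. e *\<^sub>C F k = (\<Sum>r\<le>n. z ^ (k * r) *\<^sub>C (e *\<^sub>C d r))"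
    using * by eventually_elim (simp add: cv.scale_sum_right scaleC_scaleC mult.commute)
  ultimately show ?thesis using const_termI by fastforce
qed

lemma const_term_shift:
  assumes "const_term z F c" shows "const_term z (\<lambda>k. z ^ k *\<^sub>C F k) 0"
proof -
  from assms obtain n d where
    *: "\<forall>\<^sub>F k in sequentially. F k = (\<Sum>r\<le>n. z ^ (k * r) *\<^sub>C d r)"
    unfolding const_term_def by blast
  define d' where "d' r = (case r of 0 \<Rightarrow> 0 | Suc r \<Rightarrow> d r)" for r
  have "\<forall>\<^sub>F k in sequentially. z ^ k *\<^sub>C F k = (\<Sum>r\<le>Suc n. z ^ (k * r) *\<^sub>C d' r)"
    using *
    by eventually_elim (simp add: sum.atMost_Suc_shift d'_def cv.scale_sum_right scaleC_scaleC
      power_add del: sum.atMost_Suc)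
  from const_termI[OF this] show ?thesis by (simp add: d'_def)
qed

lemma const_term_power_shift:
  assumes "const_term z F c"
  shows "const_term z (\<lambda>k. z ^ (k * r) *\<^sub>C F k) (if r = 0 then c else 0)"
proof (induction r)
  case 0
  then show ?case using assms by (simp add: scaleC_one)
next
  case (Suc r)
  show ?case
    using const_term_shift[OF Suc] by (simp add: scaleC_scaleC power_add)
qed

text \<open>The source of multiplicativity: when an operator is applied to the coefficients of a
  polynomial in z^k, those with r > 0 keep a factor z^(k r) and do not reach the constant
  term.\<close>

lemma const_term_sum:
  assumes "\<And>r. r \<le> n \<Longrightarrow> const_term z (F r) (c r)"
  shows "const_term z (\<lambda>k. \<Sum>r\<le>n. z ^ (k * r) *\<^sub>C F r k) (c 0)"
proof -
  have "const_term z (\<lambda>k. \<Sum>r\<le>m. z ^ (k * r) *\<^sub>C F r k) (\<Sum>r\<le>m. if r = 0 then c r else 0)" if "m \<le> n" for m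
    using that
  proof (induction m)
    case 0
    then show ?case using const_term_power_shift[OF assms[of 0], of 0] by simp
  next
    case (Suc m)
    then show ?case
      using const_term_add[OF Suc.IH const_term_power_shift[OF assms[OF Suc.prems], of "Suc m"]] by simp
  qed
  from this[of n] show ?thesis by (simp add: sum.delta)
qed

text \<open>Induction on the degree: with P(k) the sum, P(k+1) - z^(n+1) P(k) loses the top
  coefficient and multiplies the others by z^r - z^(n+1), which is nonzero. The top coefficient is
  then read off from a single k.\<close>

lemma eventually_polynomial_eq_0:
  assumes z: "generic z"
    and "\<forall>\<^sub>F k in sequentially. (\<Sum>r\<le>n. z ^ (k * r) *\<^sub>C d r) = (0 :: 'w::complex_vector)" "r \<le> n"
  shows "d r = 0"
  using assms(2,3)
proof (induction n arbitrary: d r)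
  case 0
  then show ?case by (simp add: scaleC_one)
next
  case (Suc n)
  have z0: "z \<noteq> 0" using z by (simp add: generic_def)
  let ?P = "\<lambda>k. \<Sum>r\<le>Suc n. z ^ (k * r) *\<^sub>C d r"
  have diff: "?P (Suc k) - z ^ Suc n *\<^sub>C ?P k = (\<Sum>r\<le>n. z ^ (k * r) *\<^sub>C ((z ^ r - z ^ Suc n) *\<^sub>C d r))" for k
  proof -
    have "?P (Suc k) - z ^ Suc n *\<^sub>C ?P k =
        (\<Sum>r\<le>Suc n. z ^ (Suc k * r) *\<^sub>C d r - z ^ Suc n *\<^sub>C z ^ (k * r) *\<^sub>C d r)"
      by (simp only: cv.scale_sum_right sum_subtractf)
    also have "\<dots> = (\<Sum>r\<le>Suc n. z ^ (k * r) *\<^sub>C ((z ^ r - z ^ Suc n) *\<^sub>C d r))"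
    proof (intro sum.cong refl)
      fix r
      have "z ^ (Suc k * r) = z ^ (k * r) * z ^ r"
        by (simp add: power_add mult.commute)
      then show "z ^ (Suc k * r) *\<^sub>C d r - z ^ Suc n *\<^sub>C z ^ (k * r) *\<^sub>C d r =
          z ^ (k * r) *\<^sub>C ((z ^ r - z ^ Suc n) *\<^sub>C d r)"
        by (simp only: cv.scale_left_diff_distrib cv.scale_right_diff_distrib scaleC_scaleC)
          (simp only: mult.commute)
    qed
    finally show ?thesis by simp
  qed
  have "\<forall>\<^sub>F k in sequentially. ?P (Suc k) = 0"
    using Suc.prems(1) by (subst eventually_sequentially_Suc)
  with Suc.prems(1)
  have "\<forall>\<^sub>F k in sequentially. (\<Sum>r\<le>n. z ^ (k * r) *\<^sub>C ((z ^ r - z ^ Suc n) *\<^sub>C d r)) = 0"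
    by eventually_elim (simp only: diff[symmetric] cv.scale_zero_right diff_self)
  then have low: "d r = 0" if "r \<le> n" for r
  proof -
    have "(z ^ r - z ^ Suc n) *\<^sub>C d r = 0"
      by (rule Suc.IH) (fact, fact)
    moreover have "z ^ r \<noteq> z ^ Suc n"
    proof
      assume "z ^ r = z ^ Suc n"
      also have "\<dots> = z ^ r * z ^ (Suc n - r)" using that by (simp flip: power_add)
      finally have "z ^ (Suc n - r) = 1" using z0 by simp
      moreover have "Suc n - r > 0" using that by simp
      ultimately show False using z unfolding generic_def by blast
    qed
    ultimately show ?thesis by simp
  qed
  obtain k where "?P k = 0"
    using eventually_happens[OF Suc.prems(1)] by auto
  then have "d (Suc n) = 0" using low z0 by simp
  then show ?case using low Suc.prems(2) by (cases "r = Suc n") simp_all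
qed

lemma const_term_unique:
  assumes z: "generic z" and "const_term z F c" "const_term z F e" shows "c = e"
proof -
  have "const_term z (\<lambda>k. F k + -1 *\<^sub>C F k) (c + -1 *\<^sub>C e)"
    by (intro const_term_add const_term_scale assms)
  then have "const_term z (\<lambda>_. 0) (c - e)" by simp
  then obtain n d where "d 0 = c - e" "\<forall>\<^sub>F k in sequentially. 0 = (\<Sum>r\<le>n. z ^ (k * r) *\<^sub>C d r)"
    unfolding const_term_def by blast
  then have "d 0 = c - e" "\<forall>\<^sub>F k in sequentially. (\<Sum>r\<le>n. z ^ (k * r) *\<^sub>C d r) = 0"
    by (simp_all only: eq_commute[of 0])
  then have "c - e = 0" using eventually_polynomial_eq_0[OF z, of d n 0] by simp
  then show ?thesis by simp
qed

section \<open>Asymptotic operators on an inductive limit\<close>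

locale asymptotic_limit =
  fixes V :: "nat \<Rightarrow> 'v::complex_vector set" and \<phi> :: "nat \<Rightarrow> nat \<Rightarrow> 'v \<Rightarrow> 'v"
    and \<psi> :: "nat \<Rightarrow> 'v \<Rightarrow> 'w::complex_vector" and \<rho> :: "nat \<Rightarrow> 'u::complex_algebra_1 \<Rightarrow> 'v \<Rightarrow> 'v"
    and z :: complex
  assumes system: "inductive_system V \<phi>" and limit: "is_inductive_limit V \<phi> \<psi>"
    and inj: "1 \<le> l \<Longrightarrow> l \<le> k \<Longrightarrow> inj_on (\<phi> l k) (V l)"
    and module: "1 \<le> k \<Longrightarrow> is_module UNIV (V k) (\<rho> k)"
    and z: "generic z"
begin

lemma subspace: "1 \<le> k \<Longrightarrow> cv.subspace (V k)"
  using module by (simp add: is_module_def)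

lemma phi_linear: "1 \<le> l \<Longrightarrow> l \<le> k \<Longrightarrow> linear_on (V l) (V k) (\<phi> l k)"
  using system by (simp add: inductive_system_def)

lemma phi_in: "1 \<le> l \<Longrightarrow> l \<le> k \<Longrightarrow> v \<in> V l \<Longrightarrow> \<phi> l k v \<in> V k"
  using phi_linear by (simp add: linear_on_def)

lemma psi_linear: "1 \<le> l \<Longrightarrow> linear_on (V l) UNIV (\<psi> l)"
  and psi_phi: "1 \<le> l \<Longrightarrow> l \<le> k \<Longrightarrow> v \<in> V l \<Longrightarrow> \<psi> k (\<phi> l k v) = \<psi> l v"
  and psi_surj: "\<exists>l\<ge>1. \<exists>v\<in>V l. w = \<psi> l v"
  and psi_zero: "1 \<le> l \<Longrightarrow> v \<in> V l \<Longrightarrow> \<psi> l v = 0 \<Longrightarrow> \<exists>k\<ge>l. \<phi> l k v = 0"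
  using limit unfolding is_inductive_limit_def by blast+

lemma psi_inj: assumes "1 \<le> l" shows "inj_on (\<psi> l) (V l)"
proof (rule linear_on_inj[OF psi_linear subspace])
  fix v assume v: "v \<in> V l" "\<psi> l v = 0"
  then obtain k where k: "k \<ge> l" "\<phi> l k v = 0" using psi_zero assms by blast
  have 0: "0 \<in> V l" using subspace[OF assms] cv.subspace_0 by blast
  have "\<phi> l k 0 = 0" using linear_on_0[OF phi_linear[OF assms k(1)] 0] .
  then show "v = 0" using inj[OF assms k(1)] k v 0 by (metis inj_onD)
qed (use assms in auto)

text \<open>The action on the image of stage k in the limit, transported along the injective map
  \<open>\<psi> k\<close>; it has a meaning on that image only.\<close>

definition op :: "nat \<Rightarrow> 'u \<Rightarrow> 'w \<Rightarrow> 'w" where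
  "op k u w = \<psi> k (\<rho> k u (inv_into (V k) (\<psi> k) w))"

abbreviation "I \<equiv> \<lambda>k. \<psi> k ` V k"

lemma op_psi: "1 \<le> k \<Longrightarrow> v \<in> V k \<Longrightarrow> op k u (\<psi> k v) = \<psi> k (\<rho> k u v)"
  using psi_inj by (simp add: op_def)

lemma op_psi_le:
  assumes "1 \<le> l" "l \<le> k" "v \<in> V l" shows "op k u (\<psi> l v) = \<psi> k (\<rho> k u (\<phi> l k v))"
  using op_psi[of k "\<phi> l k v" u] psi_phi[OF assms] phi_in[OF assms] assms by simp

lemma rho_in: "1 \<le> k \<Longrightarrow> v \<in> V k \<Longrightarrow> \<rho> k u v \<in> V k"
  using module by (simp add: is_module_def linear_on_def)

lemma op_in: "1 \<le> k \<Longrightarrow> w \<in> I k \<Longrightarrow> op k u w \<in> I k"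
  using op_psi rho_in by auto

text \<open>The images of the stages increase, so a vector lies in all of them from its own stage
  on.\<close>

lemma eventually_in: "\<forall>\<^sub>F k in sequentially. 1 \<le> k \<and> w \<in> I k"
proof -
  obtain l v where l: "l \<ge> 1" "v \<in> V l" "w = \<psi> l v" using psi_surj by blast
  have "1 \<le> k \<and> w \<in> I k" if "k \<ge> l" for k
    using psi_phi[OF l(1) that l(2)] phi_in[OF l(1) that l(2)] l that by (metis image_eqI order_trans)
  then show ?thesis unfolding eventually_sequentially by blast
qed

lemma op_mult: "1 \<le> k \<Longrightarrow> w \<in> I k \<Longrightarrow> op k (u * u') w = op k u (op k u' w)"
  and op_add: "1 \<le> k \<Longrightarrow> w \<in> I k \<Longrightarrow> op k (u + u') w = op k u w + op k u' w"
  and op_scale: "1 \<le> k \<Longrightarrow> w \<in> I k \<Longrightarrow> op k (c *\<^sub>C u) w = c *\<^sub>C op k u w"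
  and op_one: "1 \<le> k \<Longrightarrow> w \<in> I k \<Longrightarrow> op k 1 w = w"
  using module[of k] psi_linear[of k] rho_in[of k]
  by (auto simp: op_psi is_module_def linear_on_def)

lemma subspace_I:
  assumes "1 \<le> k" shows "cv.subspace (I k)"
  unfolding cv.subspace_def
proof (intro conjI ballI allI)
  note lin = psi_linear[OF assms, unfolded linear_on_def] and sub = subspace[OF assms, unfolded cv.subspace_def]
  show "0 \<in> I k" using linear_on_0[OF psi_linear[OF assms]] sub by (metis image_eqI)
  fix x assume "x \<in> I k"
  then obtain v where v: "v \<in> V k" "x = \<psi> k v" by blast
  show "c *\<^sub>C x \<in> I k" for c using lin sub v by (metis image_eqI)
  fix y assume "y \<in> I k"
  then obtain v' where "v' \<in> V k" "y = \<psi> k v'" by blast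
  then show "x + y \<in> I k" using lin sub v by (metis image_eqI)
qed

lemma op_linear:
  assumes "1 \<le> k" shows "linear_on (I k) (I k) (op k u)"
proof (rule linear_onI)
  note lin = psi_linear[OF assms, unfolded linear_on_def] and sub = subspace[OF assms, unfolded cv.subspace_def]
  have rho: "linear_on (V k) (V k) (\<rho> k u)" using module[OF assms] by (simp add: is_module_def)
  fix x assume "x \<in> I k"
  then show "op k u x \<in> I k" using op_in assms by blast
  from \<open>x \<in> I k\<close> obtain v where v: "v \<in> V k" "x = \<psi> k v" by blast
  have rv: "\<rho> k u v \<in> V k" using rho_in[OF assms v(1)] .
  show "op k u (c *\<^sub>C x) = c *\<^sub>C op k u x" for c
  proof -
    have cv: "c *\<^sub>C x = \<psi> k (c *\<^sub>C v)" "c *\<^sub>C v \<in> V k" using lin sub v by auto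
    have "op k u (c *\<^sub>C x) = \<psi> k (\<rho> k u (c *\<^sub>C v))" unfolding cv(1) by (rule op_psi[OF assms cv(2)])
    also have "\<rho> k u (c *\<^sub>C v) = c *\<^sub>C \<rho> k u v" using rho v unfolding linear_on_def by blast
    also have "\<psi> k \<dots> = c *\<^sub>C \<psi> k (\<rho> k u v)" using lin rv by blast
    finally show ?thesis unfolding v(2) op_psi[OF assms v(1)] .
  qed
  fix y assume "y \<in> I k"
  then obtain v' where v': "v' \<in> V k" "y = \<psi> k v'" by blast
  have rv': "\<rho> k u v' \<in> V k" using rho_in[OF assms v'(1)] .
  have vv: "x + y = \<psi> k (v + v')" "v + v' \<in> V k" using lin sub v v' by auto
  have "op k u (x + y) = \<psi> k (\<rho> k u (v + v'))" unfolding vv(1) by (rule op_psi[OF assms vv(2)])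
  also have "\<rho> k u (v + v') = \<rho> k u v + \<rho> k u v'" using rho v v' unfolding linear_on_def by blast
  also have "\<psi> k \<dots> = \<psi> k (\<rho> k u v) + \<psi> k (\<rho> k u v')" using lin rv rv' by blast
  finally show "op k u (x + y) = op k u x + op k u y"
    unfolding v(2) v'(2) op_psi[OF assms v(1)] op_psi[OF assms v'(1)] .
qed

text \<open>The scale \<open>s\<close> absorbs the growth with \<open>k\<close> of the eigenvalues of \<open>k\<^sub>i\<close> on \<open>L(M\<^sub>k)\<close>.\<close>

definition asy :: "complex \<Rightarrow> 'u \<Rightarrow> 'w endo \<Rightarrow> bool" where
  "asy s u X \<longleftrightarrow> (\<forall>w. const_term z (\<lambda>k. s ^ k *\<^sub>C op k u w) (app X w))"

lemma asy_unique: "asy s u X \<Longrightarrow> asy s u Y \<Longrightarrow> X = Y"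
  unfolding asy_def using const_term_unique[OF z] endo_eqI by metis

lemma asy_one: "asy 1 1 1"
  unfolding asy_def
proof
  fix w
  have "\<forall>\<^sub>F k in sequentially. w = 1 ^ k *\<^sub>C op k 1 w"
    using eventually_in[of w] by eventually_elim (simp add: op_one scaleC_one)
  from const_term_cong[OF const_term_const this]
  show "const_term z (\<lambda>k. 1 ^ k *\<^sub>C op k 1 w) (app 1 w)" by simp
qed

lemma asy_add:
  assumes "asy s u X" "asy s u' X'" shows "asy s (u + u') (X + X')"
  unfolding asy_def
proof
  fix w
  have "\<forall>\<^sub>F k in sequentially. s ^ k *\<^sub>C op k u w + s ^ k *\<^sub>C op k u' w = s ^ k *\<^sub>C op k (u + u') w"
    using eventually_in[of w] by eventually_elim (simp add: op_add scaleC_add_right)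
  from const_term_cong[OF const_term_add this] assms
  show "const_term z (\<lambda>k. s ^ k *\<^sub>C op k (u + u') w) (app (X + X') w)"
    unfolding asy_def by simp
qed

lemma asy_scale:
  assumes "asy s u X" shows "asy s (c *\<^sub>C u) (c *\<^sub>C X)"
  unfolding asy_def
proof
  fix w
  have "\<forall>\<^sub>F k in sequentially. c *\<^sub>C (s ^ k *\<^sub>C op k u w) = s ^ k *\<^sub>C op k (c *\<^sub>C u) w"
    using eventually_in[of w] by eventually_elim (simp add: op_scale scaleC_scaleC mult.commute)
  from const_term_cong[OF const_term_scale this] assms
  show "const_term z (\<lambda>k. s ^ k *\<^sub>C op k (c *\<^sub>C u) w) (app (c *\<^sub>C X) w)"
    unfolding asy_def by simp
qed

text \<open>The inner operator yields a polynomial whose coefficients \<open>d r\<close> are fixed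
  vectors of the limit. There are finitely many, so eventually all lie in the image of stage k, and
  the asymptotics of the outer operator apply to each of them.\<close>

lemma asy_mult:
  assumes X: "asy s u X" and X': "asy t u' X'" shows "asy (s * t) (u * u') (X * X')"
  unfolding asy_def
proof
  fix w
  obtain n d where d: "d 0 = app X' w"
    "\<forall>\<^sub>F k in sequentially. t ^ k *\<^sub>C op k u' w = (\<Sum>r\<le>n. z ^ (k * r) *\<^sub>C d r)"
    using X' unfolding asy_def const_term_def by blast
  have ct: "const_term z (\<lambda>k. \<Sum>r\<le>n. z ^ (k * r) *\<^sub>C (s ^ k *\<^sub>C op k u (d r))) (app X (d 0))"
    using X by (intro const_term_sum) (simp add: asy_def)
  have "\<forall>\<^sub>F k in sequentially. \<forall>r\<in>{..n}. 1 \<le> k \<and> d r \<in> I k"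
    using eventually_in by (intro eventually_ball_finite) auto
  with d(2) eventually_in[of w]
  have "\<forall>\<^sub>F k in sequentially. (\<Sum>r\<le>n. z ^ (k * r) *\<^sub>C (s ^ k *\<^sub>C op k u (d r))) =
    (s * t) ^ k *\<^sub>C op k (u * u') w"
  proof eventually_elim
    case (elim k)
    then have k: "1 \<le> k" and w: "w \<in> I k" by auto
    have "(s * t) ^ k *\<^sub>C op k (u * u') w = s ^ k *\<^sub>C (t ^ k *\<^sub>C op k u (op k u' w))"
      by (simp add: op_mult[OF k w] power_mult_distrib scaleC_scaleC)
    also have "t ^ k *\<^sub>C op k u (op k u' w) = op k u (t ^ k *\<^sub>C op k u' w)"
      using op_linear[OF k, of u] op_in[OF k w, of u'] unfolding linear_on_def by metis
    also have "\<dots> = (\<Sum>r\<le>n. z ^ (k * r) *\<^sub>C op k u (d r))"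
      unfolding elim(1) by (rule linear_on_sum[OF op_linear[OF k] subspace_I[OF k]]) (use elim in auto)
    finally show ?case by (simp add: cv.scale_sum_right scaleC_scaleC mult.commute)
  qed
  from const_term_cong[OF ct this]
  show "const_term z (\<lambda>k. (s * t) ^ k *\<^sub>C op k (u * u') w) (app (X * X') w)"
    by (simp add: d(1))
qed

lemma asy_mult_1: "asy 1 u X \<Longrightarrow> asy 1 u' X' \<Longrightarrow> asy 1 (u * u') (X * X')"
  using asy_mult[of 1 u X 1] by simp

lemma asy_power: "asy 1 u X \<Longrightarrow> asy 1 (u ^ n) (X ^ n)"
  by (induction n) (simp_all add: asy_one asy_mult_1)

lemma asy_zero: "asy 1 0 0"
  using asy_scale[OF asy_one, of 0] by simp

lemma asy_sum: "(\<And>i. i \<in> A \<Longrightarrow> asy 1 (u i) (X i)) \<Longrightarrow> asy 1 (\<Sum>i\<in>A. u i) (\<Sum>i\<in>A. X i)"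
  by (induction A rule: infinite_finite_induct) (simp_all add: asy_zero asy_add)

lemma asy_qserre: "asy 1 u X \<Longrightarrow> asy 1 u' X' \<Longrightarrow> asy 1 (qserre p n u u') (qserre p n X X')"
  unfolding qserre_def by (intro asy_sum asy_scale asy_mult_1 asy_power)

text \<open>Linearity of the operator of constant terms follows from their uniqueness.\<close>

lemma asy_exists:
  assumes "\<And>w. \<exists>c. const_term z (\<lambda>k. s ^ k *\<^sub>C op k u w) c"
  shows "\<exists>X. asy s u X"
proof -
  from assms obtain f where f: "\<And>w. const_term z (\<lambda>k. s ^ k *\<^sub>C op k u w) (f w)" by metis
  have "linear_on UNIV UNIV f"
  proof (rule linear_onI)
    fix v w
    have "\<forall>\<^sub>F k in sequentially. s ^ k *\<^sub>C op k u v + s ^ k *\<^sub>C op k u w = s ^ k *\<^sub>C op k u (v + w)"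
      using eventually_in[of v] eventually_in[of w]
    proof eventually_elim
      case (elim k)
      then have "op k u (v + w) = op k u v + op k u w"
        using op_linear[of k u] unfolding linear_on_def by blast
      then show ?case by (simp add: scaleC_add_right)
    qed
    from const_term_cong[OF const_term_add[OF f f] this] show "f (v + w) = f v + f w"
      using const_term_unique[OF z f] by blast
  next
    fix c w
    have "\<forall>\<^sub>F k in sequentially. c *\<^sub>C (s ^ k *\<^sub>C op k u w) = s ^ k *\<^sub>C op k u (c *\<^sub>C w)"
      using eventually_in[of w]
    proof eventually_elim
      case (elim k)
      then have "op k u (c *\<^sub>C w) = c *\<^sub>C op k u w"
        using op_linear[of k u] unfolding linear_on_def by blast
      then show ?case by (simp add: scaleC_scaleC mult.commute)
    qed
    from const_term_cong[OF const_term_scale[OF f] this] show "f (c *\<^sub>C w) = c *\<^sub>C f w"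
      using const_term_unique[OF z f] by blast
  qed simp
  then have "asy s u (Endo f)" using f by (simp add: asy_def app_Endo)
  then show ?thesis by blast
qed

text \<open>Every vector of the limit comes from a stage, so constant terms at stage vectors give
  existence; uniqueness identifies the operator with the one induced by \<open>S\<close>.\<close>

lemma asy_stages:
  assumes S: "\<And>l v. 1 \<le> l \<Longrightarrow> v \<in> V l \<Longrightarrow> const_term z (\<lambda>k. s ^ k *\<^sub>C \<psi> k (\<rho> k u (\<phi> l k v))) (\<psi> (l + N l) (S l v))"
  obtains X where "asy s u X" "induced_by V \<psi> N S (app X)"
proof -
  have ct: "const_term z (\<lambda>k. s ^ k *\<^sub>C op k u (\<psi> l v)) (\<psi> (l + N l) (S l v))" if "1 \<le> l" "v \<in> V l" for l v
  proof (rule const_term_cong[OF S[OF that]])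
    show "\<forall>\<^sub>F k in sequentially. s ^ k *\<^sub>C \<psi> k (\<rho> k u (\<phi> l k v)) = s ^ k *\<^sub>C op k u (\<psi> l v)"
      using eventually_ge_at_top[of l] by eventually_elim (simp add: op_psi_le[OF that(1) _ that(2)])
  qed
  have "\<exists>c. const_term z (\<lambda>k. s ^ k *\<^sub>C op k u w) c" for w
  proof -
    obtain l v where "l \<ge> 1" "v \<in> V l" "w = \<psi> l v" using psi_surj by blast
    then show ?thesis using ct by blast
  qed
  from asy_exists[OF this] obtain X where X: "asy s u X" by blast
  moreover have "induced_by V \<psi> N S (app X)"
    unfolding induced_by_def
  proof (intro allI impI ballI)
    fix l v assume lv: "1 \<le> l" "v \<in> V l"
    have "const_term z (\<lambda>k. s ^ k *\<^sub>C op k u (\<psi> l v)) (app X (\<psi> l v))"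
      using X unfolding asy_def by blast
    from const_term_unique[OF z this ct[OF lv]] show "app X (\<psi> l v) = \<psi> (l + N l) (S l v)" .
  qed
  ultimately show ?thesis by (rule that)
qed

end

section \<open>Transition maps\<close>

lemma phi_Plus_0: "phi T g h Plus j 0 = g (K Plus (rep T j))"
  by (simp add: phi_def fps_exp_nth_def scaleC_one)

text \<open>A Laurent expansion does not see the value at the point itself, hence the continuity
  hypothesis.\<close>

lemma expands_Plus_0:
  assumes "expands Plus f F" "isCont f 0" shows "fps_nth F 0 = f 0"
proof -
  have "f \<midarrow>0\<rightarrow> fls_nth (fps_to_fls F) 0"
    using assms(1) by (intro has_laurent_expansion_imp_tendsto_0) (simp_all add: fls_subdegree_fls_to_fps_gt0)
  then have "f \<midarrow>0\<rightarrow> fps_nth F 0" by simp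
  then show ?thesis
    using assms(2) by (metis isCont_def LIM_unique)
qed

lemma tens_0_right:
  assumes "v \<in> V" "cv.subspace W" shows "tens V W v 0 = 0"
proof
  fix \<beta>
  show "tens V W v 0 \<beta> = 0 \<beta>"
    using linear_on_0[of W UNIV "\<beta> v"] assms cv.subspace_0[OF assms(2)]
    by (auto simp: tens_def bilinear_form_def)
qed

lemma tens_scale_right:
  assumes "v \<in> V" "w \<in> W" shows "tens V W v (c *\<^sub>C w) = c *\<^sub>C tens V W v w"
proof
  fix \<beta>
  show "tens V W v (c *\<^sub>C w) \<beta> = (c *\<^sub>C tens V W v w) \<beta>"
    using assms by (auto simp: tens_def bilinear_form_def linear_on_def scaleC_apply)
qed

lemma tens_in: "v \<in> V \<Longrightarrow> w \<in> W \<Longrightarrow> tens V W v w \<in> tensor_space V W"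
  unfolding tensor_space_def by (rule cv.span_base) blast

lemma is_L_module: "is_L T g x h \<Psi> H \<Longrightarrow> is_module UNIV (carr H) (act H)"
  unfolding is_L_def is_simple_def by (elim conjE)

lemma is_module_in: "is_module UNIV V \<rho> \<Longrightarrow> v \<in> V \<Longrightarrow> \<rho> u v \<in> V"
  by (simp add: is_module_def linear_on_def)

lemma is_L_hwv: "is_L T g x h \<Psi> H \<Longrightarrow> hwv H \<in> carr H"
  unfolding is_L_def by (elim conjE)

text \<open>In the coproduct of e_j^+ the second summand applies e_j^+ to the highest l-weight
  vector of the right factor, which gives 0. The first summand passes through the
  intertwiner.\<close>

lemma transition_raising:
  assumes tr: "is_transition T g h i l k H1 H2 H3 f"
    and H: "is_L T g x h \<Psi>1 H1" "is_L T g x h \<Psi>2 H2"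
    and j: "j \<in> hatI T" "act H2 (g (E Plus j)) (hwv H2) = 0" and v: "v \<in> carr H1"
  shows "act H3 (g (E Plus j)) (f v) = f (act H1 (g (E Plus j)) v)"
proof -
  let ?V = "carr H1" and ?W = "carr H2" and ?e = "g (E Plus j)"
  obtain \<mu> \<nu> R \<theta> where
    \<mu>: "is_tensor_module T g ?V (act H1) ?W (act H2) \<mu>" and
    R: "is_hom (tensor_space ?V ?W) \<mu> (tensor_space ?W ?V) \<nu> R" and
    \<theta>: "is_hom (R ` tensor_space ?V ?W) \<nu> (carr H3) (act H3) \<theta>" and
    f: "\<And>v. v \<in> ?V \<Longrightarrow> f v = \<theta> (R (tens ?V ?W v (hwv H2)))"
    using tr unfolding is_transition_def by blast
  have w: "hwv H2 \<in> ?W" by (rule is_L_hwv[OF H(2)])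
  let ?t = "tens ?V ?W v (hwv H2)"
  have t: "?t \<in> tensor_space ?V ?W" by (rule tens_in[OF v w])
  have in1: "act H1 u v \<in> ?V" for u by (rule is_module_in[OF is_L_module[OF H(1)] v])
  have sub: "cv.subspace ?W" using is_L_module[OF H(2)] by (simp add: is_module_def)
  have "\<mu> ?e ?t = tens ?V ?W (act H1 ?e v) (hwv H2) +
      tens ?V ?W (act H1 (g (K Plus j)) v) (act H2 ?e (hwv H2))"
    using \<mu> j(1) v w unfolding is_tensor_module_def by blast
  also have "\<dots> = tens ?V ?W (act H1 ?e v) (hwv H2)"
    by (simp add: j(2) tens_0_right[OF in1 sub])
  finally have \<mu>t: "\<mu> ?e ?t = tens ?V ?W (act H1 ?e v) (hwv H2)" .
  have "act H3 ?e (f v) = \<theta> (\<nu> ?e (R ?t))"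
    using \<theta> t f[OF v] by (simp add: is_hom_def)
  also have "\<nu> ?e (R ?t) = R (\<mu> ?e ?t)" using R t by (simp add: is_hom_def)
  finally show ?thesis by (simp add: \<mu>t f[OF in1])
qed

text \<open>k_j is group-like and the highest l-weight vector of the right factor is an eigenvector,
  so the two actions differ by its eigenvalue.\<close>

lemma transition_cartan:
  assumes tr: "is_transition T g h i l k H1 H2 H3 f"
    and H: "is_L T g x h \<Psi>1 H1" "is_L T g x h \<Psi>2 H2"
    and j: "j \<in> hatI T" "act H2 (g (K s j)) (hwv H2) = c *\<^sub>C hwv H2" and v: "v \<in> carr H1"
  shows "act H3 (g (K s j)) (f v) = c *\<^sub>C f (act H1 (g (K s j)) v)"
proof -
  let ?V = "carr H1" and ?W = "carr H2" and ?e = "g (K s j)"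
  obtain \<mu> \<nu> R \<theta> where
    \<mu>: "is_tensor_module T g ?V (act H1) ?W (act H2) \<mu>" and
    R: "is_hom (tensor_space ?V ?W) \<mu> (tensor_space ?W ?V) \<nu> R" and
    \<theta>: "is_hom (R ` tensor_space ?V ?W) \<nu> (carr H3) (act H3) \<theta>" and
    f: "\<And>v. v \<in> ?V \<Longrightarrow> f v = \<theta> (R (tens ?V ?W v (hwv H2)))"
    using tr unfolding is_transition_def by blast
  have w: "hwv H2 \<in> ?W" by (rule is_L_hwv[OF H(2)])
  let ?t = "tens ?V ?W v (hwv H2)"
  have t: "?t \<in> tensor_space ?V ?W" by (rule tens_in[OF v w])
  have in1: "act H1 ?e v \<in> ?V" by (rule is_module_in[OF is_L_module[OF H(1)] v])
  let ?t' = "tens ?V ?W (act H1 ?e v) (hwv H2)"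
  have t': "?t' \<in> tensor_space ?V ?W" by (rule tens_in[OF in1 w])
  have "\<mu> ?e ?t = tens ?V ?W (act H1 ?e v) (act H2 ?e (hwv H2))"
    using \<mu> j(1) v w unfolding is_tensor_module_def by blast
  also have "\<dots> = c *\<^sub>C ?t'"
    by (simp only: j(2) tens_scale_right[OF in1 w])
  finally have \<mu>t: "\<mu> ?e ?t = c *\<^sub>C ?t'" .
  have "act H3 ?e (f v) = \<theta> (\<nu> ?e (R ?t))"
    using \<theta> t f[OF v] by (simp add: is_hom_def)
  also have "\<nu> ?e (R ?t) = R (\<mu> ?e ?t)" using R t by (simp add: is_hom_def)
  also have "\<dots> = c *\<^sub>C R ?t'" using R t' by (simp add: \<mu>t is_hom_def linear_on_def)
  also have "\<theta> \<dots> = c *\<^sub>C \<theta> (R ?t')" using \<theta> t' by (simp add: is_hom_def linear_on_def)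
  finally show ?thesis by (simp add: f[OF in1])
qed

text \<open>At u = 0 a factor is q^(N_i) or 1, whatever its spectral parameter. The value gives the
  eigenvalue of k_j on the highest l-weight vector.\<close>

lemma (in twisted_data) Mlw_0:
  assumes "j \<in> Isig T"
  shows "Mlw T i l k j 0 = (if j = i then qq T ^ NN T i else 1) ^ (k - l)"
    and "isCont (Mlw T i l k j) 0"
proof -
  have M0: "M > 0" using M_cases by auto
  have Z: "Zrep T i b j 0 = (if j = i then qq T ^ NN T i else 1)" for b
    by (simp add: Zrep_def Let_def rep_Isig[OF assms] NN_def zero_power[OF M0])
  then show "Mlw T i l k j 0 = (if j = i then qq T ^ NN T i else 1) ^ (k - l)"
    unfolding Mlw_def Z prod_constant by simp
  have "isCont (Zrep T i b j) 0" for b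
    unfolding Zrep_def[abs_def] Let_def
    by (cases "rep T j = i"; cases "\<sigma> i = i")
      (auto intro!: continuous_intros simp: zero_power[OF M0])
  then show "isCont (Mlw T i l k j) 0"
    unfolding Mlw_def[abs_def] by (intro continuous_intros)
qed

lemma (in twisted_data) act_cartan_hwv:
  assumes H: "is_L T g x h (Mlw T i l k) H" and j: "j \<in> Isig T"
  shows "act H (g (K Plus j)) (hwv H) = (if j = i then qq T ^ NN T i else 1) ^ (k - l) *\<^sub>C hwv H"
proof -
  have "j \<in> nodes T" using j Isig_nodes by blast
  with H obtain F where F: "expands Plus (Mlw T i l k j) F"
    "\<And>n. act H (phi T g h Plus j (sg Plus * int n)) (hwv H) = fps_nth F n *\<^sub>C hwv H"
    unfolding is_L_def by blast
  have "fps_nth F 0 = Mlw T i l k j 0"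
    using expands_Plus_0[OF F(1)] Mlw_0[OF j] by blast
  then show ?thesis
    using F(2)[of 0] by (simp add: phi_Plus_0 rep_Isig[OF j] Mlw_0[OF j])
qed

section \<open>Representations of a subalgebra from a presentation\<close>

lemma factor_through_kernel:
  fixes g :: "'a \<Rightarrow> 'u::complex_algebra_1" and X :: "'a \<Rightarrow> 'b::unital_algebra"
  assumes kernel: "\<And>p. p \<in> free_on S \<Longrightarrow> word_eval g p = 0 \<Longrightarrow> word_eval X p = 0"
  shows "\<exists>\<Phi>. \<forall>p\<in>free_on S. \<Phi> (word_eval g p) = word_eval X p"
proof -
  have eq: "word_eval X p = word_eval X r"
    if p: "p \<in> free_on S" and r: "r \<in> free_on S" and pr: "word_eval g p = word_eval g r" for p r
  proof -
    let ?d = "p + free_const (-1) * r"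
    have d: "?d \<in> free_on S" by (intro free_on_add free_on_mult free_on_const p r)
    have ev: "word_eval h ?d = word_eval h p - word_eval h r" for h :: "'a \<Rightarrow> 'c::unital_algebra"
      by (simp add: word_eval_hom scaleC_mult_left)
    have "word_eval g ?d = 0" by (simp add: ev pr)
    from kernel[OF d this] show ?thesis by (simp add: ev)
  qed
  \<comment> \<open>The choice is harmless: two preimages differ by an element of the
    kernel.\<close>
  define \<Phi> where "\<Phi> b = word_eval X (SOME p. p \<in> free_on S \<and> word_eval g p = b)" for b
  have "\<Phi> (word_eval g p) = word_eval X p" if "p \<in> free_on S" for p
  proof -
    let ?P = "\<lambda>r. r \<in> free_on S \<and> word_eval g r = word_eval g p"
    have "?P (SOME r. ?P r)" by (rule someI[of ?P p]) (simp add: that)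
    then show ?thesis unfolding \<Phi>_def using eq that by blast
  qed
  then show ?thesis by blast
qed

lemma module_from_kernel:
  fixes g :: "'a \<Rightarrow> 'u::complex_algebra_1" and X :: "'a \<Rightarrow> 'w::complex_vector endo"
  assumes kernel: "\<And>p. p \<in> free_on S \<Longrightarrow> word_eval g p = 0 \<Longrightarrow> word_eval X p = 0"
  obtains \<rho> where "is_module (gen_subalgebra (g ` S)) UNIV \<rho>" "\<And>s. s \<in> S \<Longrightarrow> \<rho> (g s) = app (X s)"
proof -
  obtain \<Phi> where \<Phi>: "\<And>p. p \<in> free_on S \<Longrightarrow> \<Phi> (word_eval g p) = word_eval X p"
    using factor_through_kernel[of S g X] kernel by blast
  have one: "\<Phi> 1 = 1" using \<Phi>[OF free_on_1] by simp
  have hom: "\<Phi> (b + c) = \<Phi> b + \<Phi> c" "\<Phi> (b * c) = \<Phi> b * \<Phi> c"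
    if b: "b \<in> gen_subalgebra (g ` S)" and c: "c \<in> gen_subalgebra (g ` S)" for b c
  proof -
    obtain p r where "p \<in> free_on S" "word_eval g p = b" "r \<in> free_on S" "word_eval g r = c"
      using gen_subalgebra_word_eval[OF b] gen_subalgebra_word_eval[OF c] by blast
    then show "\<Phi> (b + c) = \<Phi> b + \<Phi> c" "\<Phi> (b * c) = \<Phi> b * \<Phi> c"
      using \<Phi>[of p] \<Phi>[of r] \<Phi>[OF free_on_add[of p S r]] \<Phi>[OF free_on_mult[of p S r]]
      by (simp_all add: word_eval_hom)
  qed
  have scale: "\<Phi> (z *\<^sub>C b) = z *\<^sub>C \<Phi> b" if b: "b \<in> gen_subalgebra (g ` S)" for b z
  proof -
    obtain p where p: "p \<in> free_on S" "word_eval g p = b"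
      using gen_subalgebra_word_eval[OF b] by blast
    have "free_const z * p \<in> free_on S" by (intro free_on_mult free_on_const p)
    from \<Phi>[OF this] show ?thesis using \<Phi>[OF p(1)] p(2) by (simp add: word_eval_hom scaleC_mult_left)
  qed
  have "is_module (gen_subalgebra (g ` S)) UNIV (\<lambda>b. app (\<Phi> b))"
    unfolding is_module_def by (simp add: linear_app one hom scale)
  moreover have "app (\<Phi> (g s)) = app (X s)" if "s \<in> S" for s
    using \<Phi>[OF free_on_var[OF that]] by simp
  ultimately show ?thesis using that by blast
qed

section \<open>The limit module\<close>

lemma (in twisted_data) Uq_relations:
  fixes g :: "gen \<Rightarrow> 'u::complex_algebra_1"
  assumes g: "is_Uq T a g"
  shows "i \<in> hatI T \<Longrightarrow> g (K Plus i) * g (K Minus i) = 1"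
    and "i \<in> hatI T \<Longrightarrow> g (K Minus i) * g (K Plus i) = 1"
    and "i \<in> hatI T \<Longrightarrow> j \<in> hatI T \<Longrightarrow> g (K Plus i) * g (K Plus j) = g (K Plus j) * g (K Plus i)"
    and "i \<in> hatI T \<Longrightarrow> j \<in> hatI T \<Longrightarrow>
      g (K Plus i) * g (E Plus j) = (qi T i powi Csig T i j) *\<^sub>C (g (E Plus j) * g (K Plus i))"
    and "i \<in> hatI T \<Longrightarrow> j \<in> hatI T \<Longrightarrow> i \<noteq> j \<Longrightarrow>
      qserre (qi T i) (Suc (serre_order i j)) (g (E Plus i)) (g (E Plus j)) = 0"
proof -
  have rel: "word_eval g r = 0" if "r \<in> relators T a" for r
    using presented_by_relator[OF g[unfolded is_Uq_def] that] .
  show "g (K Plus i) * g (K Minus i) = 1" if "i \<in> hatI T"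
  proof -
    have "Kv Plus i * Kv Minus i - 1 \<in> relators T a" unfolding relators_def using that by blast
    from rel[OF this] show ?thesis by (simp add: word_eval_hom)
  qed
  show "g (K Minus i) * g (K Plus i) = 1" if "i \<in> hatI T"
  proof -
    have "Kv Minus i * Kv Plus i - 1 \<in> relators T a" unfolding relators_def using that by blast
    from rel[OF this] show ?thesis by (simp add: word_eval_hom)
  qed
  show "g (K Plus i) * g (K Plus j) = g (K Plus j) * g (K Plus i)" if "i \<in> hatI T" "j \<in> hatI T"
  proof -
    have "Kv Plus i * Kv Plus j - Kv Plus j * Kv Plus i \<in> relators T a"
      unfolding relators_def using that by blast
    from rel[OF this] show ?thesis by (simp add: word_eval_hom)
  qed
  show "g (K Plus i) * g (E Plus j) = (qi T i powi Csig T i j) *\<^sub>C (g (E Plus j) * g (K Plus i))"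
    if "i \<in> hatI T" "j \<in> hatI T"
  proof -
    have "Kv Plus i * Ev Plus j - free_const (qi T i powi (sg Plus * Csig T i j)) * Ev Plus j * Kv Plus i
        \<in> relators T a"
      unfolding relators_def using that by blast
    from rel[OF this] show ?thesis by (simp add: word_eval_hom scaleC_mult_left)
  qed
  show "qserre (qi T i) (Suc (serre_order i j)) (g (E Plus i)) (g (E Plus j)) = 0"
    if "i \<in> hatI T" "j \<in> hatI T" "i \<noteq> j"
  proof -
    have "serre T Plus i j \<in> relators T a" unfolding relators_def using that by blast
    from rel[OF this] show ?thesis by (simp add: word_eval_serre that)
  qed
qed

theorem theorem3p15:
  fixes T :: twisted
    and a :: "nat \<Rightarrow> nat"
    and g :: "gen \<Rightarrow> 'u::complex_algebra_1"
    and x :: "sign \<Rightarrow> nat \<Rightarrow> int \<Rightarrow> 'u"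
    and h :: "nat \<Rightarrow> int \<Rightarrow> 'u"
    and i :: nat
    and L :: "nat \<Rightarrow> ('u, 'v::complex_vector) hwmod"
    and L' :: "nat \<Rightarrow> nat \<Rightarrow> ('u, 'v) hwmod"
    and \<phi> :: "nat \<Rightarrow> nat \<Rightarrow> 'v \<Rightarrow> 'v"
    and \<psi> :: "nat \<Rightarrow> 'v \<Rightarrow> 'w::complex_vector"
    and N :: "nat \<Rightarrow> nat"
    and D :: "nat \<Rightarrow> nat \<Rightarrow> 'v \<Rightarrow> 'v"
  assumes "is_twisted T"
    and "is_marks T a"
    and "is_Uq T a g"
    and "is_drinfeld T g x h"
    and "i \<in> Isig T"
    and "\<And>k. 1 \<le> k \<Longrightarrow> is_L T g x h (Mlw T i 0 k) (L k)"
    and "\<And>l k. 1 \<le> l \<Longrightarrow> l < k \<Longrightarrow> is_L T g x h (Mlw T i l k) (L' l k)"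
    and "\<And>l k. 1 \<le> l \<Longrightarrow> l < k \<Longrightarrow> is_transition T g h i l k (L l) (L' l k) (L k) (\<phi> l k)"
    and "inductive_system (\<lambda>k. carr (L k)) \<phi>"
    and "is_inductive_limit (\<lambda>k. carr (L k)) \<phi> \<psi>"
    and "eps_expansion T g L \<phi> N D"
  shows "\<exists>\<rho> :: 'u \<Rightarrow> 'w \<Rightarrow> 'w.
     is_module (Uq_borel T g) UNIV \<rho> \<and>
     (\<forall>j\<in>Isig T.
        induced_by (\<lambda>l. carr (L l)) \<psi> (\<lambda>_. 0) (\<lambda>l. act (L l) (x Plus j 0)) (\<rho> (g (E Plus j)))) \<and>
     (\<forall>j\<in>Isig T.
        induced_by (\<lambda>l. carr (L l)) \<psi> (\<lambda>_. 0)
          (\<lambda>l v. if j = i then (qq T powi (- int (l * NN T i))) *\<^sub>C act (L l) (g (K Plus j)) v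
                 else act (L l) (g (K Plus j)) v)
          (\<rho> (g (K Plus j)))) \<and>
     induced_by (\<lambda>l. carr (L l)) \<psi> N (\<lambda>l. D l 0) (\<rho> (g (E Plus eps)))"
proof -
  note L = assms(6) and L' = assms(7) and tr = assms(8) and system = assms(9) and limit = assms(10)
    and expansion = assms(11)
  interpret twisted_data T by unfold_locales (rule assms(1))
  let ?V = "\<lambda>k. carr (L k)"
  note rel = Uq_relations[OF assms(3)]
  have Isig_hat: "j \<in> hatI T" if "j \<in> Isig T" for j using that by (simp add: hatI_def)
  have "\<forall>s. \<forall>j\<in>Isig T. x s j 0 = g (E s j)"
    using assms(4) unfolding is_drinfeld_def by (elim conjE)
  then have x0: "x Plus j 0 = g (E Plus j)" if "j \<in> Isig T" for j
    using that by blast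
  have phi_self: "\<phi> k k v = v" if "1 \<le> k" "v \<in> ?V k" for k v
    using system that unfolding inductive_system_def by blast
  \<comment> \<open>This is q^(-2), so that z^(k r) is the power occurring in
    \<open>eps_expansion\<close>.\<close>
  define z where "z = inverse ((qq T)\<^sup>2)"
  have z: "generic z"
    unfolding z_def by (intro generic_inverse generic_power generic_sqrt_q) simp_all
  interpret asymptotic_limit ?V \<phi> \<psi> "\<lambda>k. act (L k)" z
  proof
    show "inj_on (\<phi> l k) (?V l)" if lk: "1 \<le> l" "l \<le> k" for l k
    proof (cases "l = k")
      case True
      then show ?thesis using phi_self lk by (auto simp: inj_on_def)
    next
      case False
      then show ?thesis using tr[of l k] lk unfolding is_transition_def bij_betw_def by simp
    qed
  qed (use system limit L z is_L_module in blast)+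

  \<comment> \<open>The transition maps commute with e_j, so in the limit its action is eventually
    constant in k.\<close>
  have raise: "act (L k) (g (E Plus j)) (\<phi> l k v) = \<phi> l k (act (L l) (g (E Plus j)) v)"
    if j: "j \<in> Isig T" and lk: "1 \<le> l" "l \<le> k" and v: "v \<in> ?V l" for j l k v
  proof (cases "l = k")
    case True
    then show ?thesis using phi_self lk v rho_in[OF lk(1) v] by simp
  next
    case False
    then have lk': "l < k" using lk by simp
    have "act (L' l k) (x Plus j 0) (hwv (L' l k)) = 0"
      using L'[OF lk(1) lk'] Isig_nodes j unfolding is_L_def by blast
    then show ?thesis
      using transition_raising[OF tr[OF lk(1) lk'] L[OF lk(1)] L'[OF lk(1) lk'] Isig_hat[OF j] _ v]
        x0[OF j] by simp
  qed
  \<comment> \<open>The eigenvalue of k_j on the highest l-weight vector of \<open>L' l k\<close> is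
    \<open>c j ^ (k - l)\<close>. The scales \<open>inverse (c j)\<close> for k_j and
    \<open>c j\<close> for its inverse remove this growth.\<close>
  define c where "c j = (if j = i then qq T ^ NN T i else 1)" for j
  have c0: "c j \<noteq> 0" for j using sqrt_q_nonzero by (simp add: c_def)
  have cartan: "act (L k) (g (K Plus j)) (\<phi> l k v) = c j ^ (k - l) *\<^sub>C \<phi> l k (act (L l) (g (K Plus j)) v)"
    if j: "j \<in> Isig T" and lk: "1 \<le> l" "l \<le> k" and v: "v \<in> ?V l" for j l k v
  proof (cases "l = k")
    case True
    then show ?thesis using phi_self lk v rho_in[OF lk(1) v] by (simp add: scaleC_one)
  next
    case False
    then have lk': "l < k" using lk by simp
    show ?thesis
      by (rule transition_cartan[OF tr[OF lk(1) lk'] L[OF lk(1)] L'[OF lk(1) lk'] Isig_hat[OF j] _ v])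
        (use act_cartan_hwv[OF L'[OF lk(1) lk'] j] in \<open>simp add: c_def\<close>)
  qed
  have cartan_inv: "act (L k) (g (K Minus j)) (\<phi> l k v) =
      inverse (c j) ^ (k - l) *\<^sub>C \<phi> l k (act (L l) (g (K Minus j)) v)"
    if j: "j \<in> Isig T" and lk: "1 \<le> l" "l \<le> k" and v: "v \<in> ?V l" for j l k v
  proof -
    have k1: "1 \<le> k" using lk by simp
    have cancel: "act (L m) (g (K Plus j)) (act (L m) (g (K Minus j)) u) = u"
      "act (L m) (g (K Minus j)) (act (L m) (g (K Plus j)) u) = u" if "1 \<le> m" "u \<in> ?V m" for m u
      using module[OF that(1)] that(2) rel(1,2)[OF Isig_hat[OF j]] unfolding is_module_def
      by (metis UNIV_I)+
    let ?w = "act (L l) (g (K Minus j)) v"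
    have w: "?w \<in> ?V l" by (rule rho_in[OF lk(1) v])
    have "\<phi> l k ?w = act (L k) (g (K Minus j)) (act (L k) (g (K Plus j)) (\<phi> l k ?w))"
      using cancel(2)[OF k1 phi_in[OF lk w]] by simp
    also have "act (L k) (g (K Plus j)) (\<phi> l k ?w) = c j ^ (k - l) *\<^sub>C \<phi> l k v"
      using cartan[OF j lk w] cancel(1)[OF lk(1) v] by simp
    also have "act (L k) (g (K Minus j)) \<dots> = c j ^ (k - l) *\<^sub>C act (L k) (g (K Minus j)) (\<phi> l k v)"
      using module[OF k1] phi_in[OF lk v] unfolding is_module_def linear_on_def by blast
    finally show ?thesis using c0 by (simp add: scaleC_scaleC power_inverse)
  qed

  have "\<exists>X. asy 1 (g (E Plus j)) X \<and>
      induced_by ?V \<psi> (\<lambda>_. 0) (\<lambda>l. act (L l) (x Plus j 0)) (app X)" if j: "j \<in> Isig T" for j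
  proof -
    have "const_term z (\<lambda>k. 1 ^ k *\<^sub>C \<psi> k (act (L k) (g (E Plus j)) (\<phi> l k v))) (\<psi> (l + 0) (act (L l) (x Plus j 0) v))"
      if lv: "1 \<le> l" "v \<in> ?V l" for l v
    proof (rule const_term_cong[OF const_term_const])
      show "\<forall>\<^sub>F k in sequentially. \<psi> (l + 0) (act (L l) (x Plus j 0) v) =
          1 ^ k *\<^sub>C \<psi> k (act (L k) (g (E Plus j)) (\<phi> l k v))"
        using eventually_ge_at_top[of l]
        by eventually_elim (simp add: raise[OF j lv(1) _ lv(2)] psi_phi[OF lv(1) _ rho_in[OF lv]] x0[OF j] scaleC_one)
    qed
    from asy_stages[where N = "\<lambda>_. 0" and S = "\<lambda>l. act (L l) (x Plus j 0)", OF this]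
    show ?thesis by blast
  qed
  then obtain e' where e': "\<And>j. j \<in> Isig T \<Longrightarrow> asy 1 (g (E Plus j)) (e' j)"
    "\<And>j. j \<in> Isig T \<Longrightarrow> induced_by ?V \<psi> (\<lambda>_. 0) (\<lambda>l. act (L l) (x Plus j 0)) (app (e' j))"
    by metis

  let ?S = "\<lambda>j l v. if j = i then (qq T powi (- int (l * NN T i))) *\<^sub>C act (L l) (g (K Plus j)) v
                 else act (L l) (g (K Plus j)) v"
  have "\<exists>X. asy (inverse (c j)) (g (K Plus j)) X \<and> induced_by ?V \<psi> (\<lambda>_. 0) (?S j) (app X)"
    if j: "j \<in> Isig T" for j
  proof -
    have "const_term z (\<lambda>k. inverse (c j) ^ k *\<^sub>C \<psi> k (act (L k) (g (K Plus j)) (\<phi> l k v))) (\<psi> (l + 0) (?S j l v))"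
      if lv: "1 \<le> l" "v \<in> ?V l" for l v
    proof (rule const_term_cong[OF const_term_const])
      let ?w = "act (L l) (g (K Plus j)) v"
      have w: "?w \<in> ?V l" by (rule rho_in[OF lv])
      \<comment> \<open>The prescribed twist by q^(-l N_i) is the rescaling of k_j by the scale
        \<open>inverse (c j)\<close> at stage l.\<close>
      have S: "?S j l v = inverse (c j) ^ l *\<^sub>C ?w"
      proof (cases "j = i")
        case True
        have "qq T powi (- int (l * NN T i)) = inverse (qq T ^ NN T i) ^ l"
          by (simp only: power_int_minus power_int_of_nat mult.commute[of l] power_mult power_inverse)
        then show ?thesis using True by (simp only: c_def refl if_True)
      qed (simp add: c_def scaleC_one)
      have psi_scale: "\<psi> k (d *\<^sub>C u) = d *\<^sub>C \<psi> k u" if "1 \<le> k" "u \<in> ?V k" for k d u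
        using psi_linear[OF that(1)] that(2) unfolding linear_on_def by blast
      show "\<forall>\<^sub>F k in sequentially. \<psi> (l + 0) (?S j l v) =
          inverse (c j) ^ k *\<^sub>C \<psi> k (act (L k) (g (K Plus j)) (\<phi> l k v))"
        using eventually_ge_at_top[of l]
      proof eventually_elim
        case (elim k)
        have "inverse (c j) ^ k *\<^sub>C \<psi> k (act (L k) (g (K Plus j)) (\<phi> l k v)) =
            (inverse (c j) ^ k * c j ^ (k - l)) *\<^sub>C \<psi> l ?w"
          using lv(1) elim
          by (simp add: cartan[OF j lv(1) elim lv(2)] psi_scale phi_in[OF lv(1) elim w]
              psi_phi[OF lv(1) elim w] scaleC_scaleC)
        \<comment> \<open>The dependence on k cancels, so the rescaled sequence is eventually
          constant.\<close>
        also have "inverse (c j) ^ k * c j ^ (k - l) = inverse (c j) ^ l"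
          using elim c0[of j] by (simp add: power_diff power_inverse field_simps)
        finally show ?case unfolding S using psi_scale[OF lv(1) w] by simp
      qed
    qed
    from asy_stages[where N = "\<lambda>_. 0" and S = "?S j", OF this]
    show ?thesis by blast
  qed
  then have "\<forall>j\<in>Isig T. \<exists>X. asy (inverse (c j)) (g (K Plus j)) X \<and>
      induced_by ?V \<psi> (\<lambda>_. 0) (?S j) (app X)" by (rule ballI)
  from bchoice[OF this] obtain k where "\<forall>j\<in>Isig T. asy (inverse (c j)) (g (K Plus j)) (k j) \<and>
      induced_by ?V \<psi> (\<lambda>_. 0) (?S j) (app (k j))" by (elim exE)
  then have k: "\<And>j. j \<in> Isig T \<Longrightarrow> asy (inverse (c j)) (g (K Plus j)) (k j)"
    "\<And>j. j \<in> Isig T \<Longrightarrow> induced_by ?V \<psi> (\<lambda>_. 0) (?S j) (app (k j))"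
    by (blast, blast)

  have "\<exists>X. asy (c j) (g (K Minus j)) X" if j: "j \<in> Isig T" for j
  proof -
    have "const_term z (\<lambda>k. c j ^ k *\<^sub>C \<psi> k (act (L k) (g (K Minus j)) (\<phi> l k v)))
        (\<psi> (l + 0) (c j ^ l *\<^sub>C act (L l) (g (K Minus j)) v))"
      if lv: "1 \<le> l" "v \<in> ?V l" for l v
    proof (rule const_term_cong[OF const_term_const])
      let ?w = "act (L l) (g (K Minus j)) v"
      have w: "?w \<in> ?V l" by (rule rho_in[OF lv])
      have psi_scale: "\<psi> k (d *\<^sub>C u) = d *\<^sub>C \<psi> k u" if "1 \<le> k" "u \<in> ?V k" for k d u
        using psi_linear[OF that(1)] that(2) unfolding linear_on_def by blast
      show "\<forall>\<^sub>F k in sequentially. \<psi> (l + 0) (c j ^ l *\<^sub>C ?w) =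
          c j ^ k *\<^sub>C \<psi> k (act (L k) (g (K Minus j)) (\<phi> l k v))"
        using eventually_ge_at_top[of l]
      proof eventually_elim
        case (elim k)
        have "c j ^ k *\<^sub>C \<psi> k (act (L k) (g (K Minus j)) (\<phi> l k v)) =
            (c j ^ k * inverse (c j) ^ (k - l)) *\<^sub>C \<psi> l ?w"
          using lv(1) elim
          by (simp add: cartan_inv[OF j lv(1) elim lv(2)] psi_scale phi_in[OF lv(1) elim w]
              psi_phi[OF lv(1) elim w] scaleC_scaleC)
        also have "c j ^ k * inverse (c j) ^ (k - l) = c j ^ l"
          using elim c0[of j] by (simp add: power_diff power_inverse field_simps)
        finally show ?case using psi_scale[OF lv(1) w] by simp
      qed
    qed
    from asy_stages[where N = "\<lambda>_. 0" and S = "\<lambda>l v. c j ^ l *\<^sub>C act (L l) (g (K Minus j)) v", OF this]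
    show ?thesis by blast
  qed
  then obtain k' where k': "\<And>j. j \<in> Isig T \<Longrightarrow> asy (c j) (g (K Minus j)) (k' j)"
    by metis

  have "const_term z (\<lambda>k. 1 ^ k *\<^sub>C \<psi> k (act (L k) (g (E Plus 0)) (\<phi> l k v))) (\<psi> (l + N l) (D l 0 v))"
    if lv: "1 \<le> l" "v \<in> ?V l" for l v
  proof (rule const_term_cong[OF const_termI])
    \<comment> \<open>The coefficients live at this stage, which does not depend on k; their images
      are fixed vectors of the limit, so the sum is a polynomial in z^k.\<close>
    let ?m = "l + N l"
    have m1: "1 \<le> ?m" using lv by simp
    have D: "D l r v \<in> ?V ?m" if "r \<le> N l" for r
      using expansion lv that unfolding eps_expansion_def linear_on_def by blast
    show "\<forall>\<^sub>F k in sequentially. (\<Sum>r\<le>N l. z ^ (k * r) *\<^sub>C \<psi> ?m (D l r v)) =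
        (\<Sum>r\<le>N l. z ^ (k * r) *\<^sub>C \<psi> ?m (D l r v))" by simp
    show "\<forall>\<^sub>F k in sequentially. (\<Sum>r\<le>N l. z ^ (k * r) *\<^sub>C \<psi> ?m (D l r v)) =
        1 ^ k *\<^sub>C \<psi> k (act (L k) (g (E Plus 0)) (\<phi> l k v))"
      using eventually_ge_at_top[of ?m]
    proof eventually_elim
      case (elim k)
      let ?u = "act (L k) (g (E Plus 0)) (\<phi> l k v)" and ?s = "\<Sum>r\<le>N l. z ^ (k * r) *\<^sub>C D l r v"
      have u: "?u \<in> \<phi> ?m k ` ?V ?m"
        "inv_into (?V ?m) (\<phi> ?m k) ?u = (\<Sum>r\<le>N l. (qq T powi (- 2 * int k * int r)) *\<^sub>C D l r v)"
        using expansion lv elim unfolding eps_expansion_def by blast+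
      have "qq T powi (- 2 * int k * int r) = z ^ (k * r)" for r
      proof -
        have "- 2 * int k * int r = - int (2 * (k * r))" by simp
        then have "qq T powi (- 2 * int k * int r) = inverse (qq T ^ (2 * (k * r)))"
          by (simp only: power_int_minus power_int_of_nat)
        then show ?thesis by (simp only: z_def power_mult power_inverse)
      qed
      then have "?u = \<phi> ?m k ?s" using f_inv_into_f[OF u(1)] u(2) by simp
      moreover have s: "?s \<in> ?V ?m"
        using subspace[OF m1] D by (intro cv.subspace_sum cv.subspace_scale) auto
      ultimately have "\<psi> k ?u = \<psi> ?m ?s" using psi_phi[OF m1 elim s] by simp
      also have "\<dots> = (\<Sum>r\<le>N l. z ^ (k * r) *\<^sub>C \<psi> ?m (D l r v))"
        by (rule linear_on_sum[OF psi_linear[OF m1] subspace[OF m1]]) (use D in auto)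
      finally show ?case by (simp add: scaleC_one)
    qed
  qed
  from asy_stages[where N = N and S = "\<lambda>l. D l 0", OF this]
  obtain e0 where e0: "asy 1 (g (E Plus 0)) e0" "induced_by ?V \<psi> N (\<lambda>l. D l 0) (app e0)"
    by blast

  define e where "e j = (if j = 0 then e0 else e' j)" for j
  have nz: "j \<noteq> 0" if "j \<in> Isig T" for j using that eps_notin_Isig by metis
  have e: "asy 1 (g (E Plus j)) (e j)" if "j \<in> hatI T" for j
    using that e0(1) e'(1) by (auto simp: e_def hatI_def)
  let ?X = "borel_extend a e k k'"
  \<comment> \<open>In each relation both sides are constant terms of the same algebra element at
    the same scale, so \<open>asy_unique\<close> identifies them. The scales of k_j and its inverse
    multiply to 1, and the Serre relations have scale 1.\<close>
  have "borel_rep a ?X"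
  proof (rule borel_rep_extend[OF assms(2)])
    fix j assume j: "j \<in> Isig T"
    have "asy 1 1 (k j * k' j)" "asy 1 1 (k' j * k j)"
      using asy_mult[OF k(1) k'] asy_mult[OF k' k(1)] j rel(1,2)[OF Isig_hat[OF j]] c0[of j]
      by (metis left_inverse, metis right_inverse)
    then show "k j * k' j = 1" "k' j * k j = 1" using asy_unique asy_one by blast+
  next
    fix j l assume "j \<in> Isig T" "l \<in> Isig T"
    then have "asy (inverse (c j) * inverse (c l)) (g (K Plus j) * g (K Plus l)) (k j * k l)"
      "asy (inverse (c j) * inverse (c l)) (g (K Plus j) * g (K Plus l)) (k l * k j)"
      using asy_mult[OF k(1) k(1), of j l] asy_mult[OF k(1) k(1), of l j] rel(3) Isig_hat
      by (simp_all add: mult.commute)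
    then show "k j * k l = k l * k j" by (rule asy_unique)
  next
    fix j l assume jl: "j \<in> Isig T" "l \<in> hatI T"
    have "asy (inverse (c j)) (g (K Plus j) * g (E Plus l)) (k j * e l)"
      using asy_mult[OF k(1)[OF jl(1)] e[OF jl(2)]] by simp
    moreover have "asy (inverse (c j)) (g (K Plus j) * g (E Plus l)) ((qi T j powi Csig T j l) *\<^sub>C (e l * k j))"
      using asy_scale[OF asy_mult[OF e[OF jl(2)] k(1)[OF jl(1)]]] rel(4)[OF Isig_hat[OF jl(1)] jl(2)] by simp
    ultimately show "k j * e l = (qi T j powi Csig T j l) *\<^sub>C (e l * k j)" by (rule asy_unique)
  next
    fix j l assume jl: "j \<in> hatI T" "l \<in> hatI T" "j \<noteq> l"
    have "asy 1 0 (qserre (qi T j) (Suc (serre_order j l)) (e j) (e l))"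
      using asy_qserre[OF e[OF jl(1)] e[OF jl(2)]] rel(5)[OF jl] by metis
    then show "qserre (qi T j) (Suc (serre_order j l)) (e j) (e l) = 0"
      using asy_unique asy_zero by blast
  qed
  then interpret coinduction T a ?X
    by unfold_locales (use assms(2) in auto)
  obtain \<rho> where \<rho>: "is_module (gen_subalgebra (g ` borel_letters)) UNIV \<rho>"
    "\<And>s. s \<in> borel_letters \<Longrightarrow> \<rho> (g s) = app (?X s)"
    by (rule module_from_kernel[of borel_letters g ?X]) (use borel_kernel[OF assms(3)] in blast)+
  have "\<rho> (g (E Plus j)) = app (e j)" if "j \<in> hatI T" for j
    using \<rho>(2)[of "E Plus j"] that by (auto simp: borel_letters_def borel_extend_def)
  moreover have "\<rho> (g (K Plus j)) = app (k j)" if "j \<in> Isig T" for j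
    using \<rho>(2)[of "K Plus j"] Isig_hat[OF that] nz[OF that]
    by (auto simp: borel_letters_def borel_extend_def)
  ultimately show ?thesis
    using \<rho>(1) e'(2) k(2) e0(2) nz Isig_hat
    by (intro exI[of _ \<rho>]) (simp add: Uq_borel_eq e_def hatI_def eps_notin_Isig)
qed

end
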